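(* Let $f$ be a transcendental meromorphic function in $\mathbb{C}$ that has no simple pole, and let $k\geq 1$, $q_0\geq 2$, $q_k\geq 1$ be integers. Then $$T(r,f)\leq \frac{6}{2q_0-3}\,\overline{N}\left(r,\frac{1}{f^{q_0}(f^{(k)})^{q_k}-1}\right)+S(r,f).$$
   Context: Standard Nevanlinna theory notation: $T(r,f)$ is the Nevanlinna characteristic function of $f$, and $\overline{N}(r,1/G)$ is the reduced counting function of zeros of $G$ in $|z|\le r$ (each distinct zero counted once). $S(r,f)$ denotes any quantity with $S(r,f)=o(T(r,f))$ as $r\to\infty$, $r\notin E$, where $E$ is a set of positive reals of finite linear (Lebesgue) measure, not necessarily the same at each occurrence. *)

theory Defs
  imports "HOL-Complex_Analysis.Complex_Analysis" "HOL-Computational_Algebra.Polynomial"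
begin

definition logplus :: "real \<Rightarrow> real" where
  "logplus x = (if x \<le> 1 then 0 else ln x)"

definition integrated_count :: "(real \<Rightarrow> real) \<Rightarrow> real \<Rightarrow> real" where
  "integrated_count n r = integral {0..r} (\<lambda>t. (n t - n 0) / t) + n 0 * ln r"

definition prox :: "(complex \<Rightarrow> complex) \<Rightarrow> real \<Rightarrow> real" where
  "prox f r = integral {0..2*pi} (\<lambda>\<theta>. logplus (cmod (f (rcis r \<theta>)))) / (2*pi)"

definition pole_count :: "(complex \<Rightarrow> complex) \<Rightarrow> real \<Rightarrow> real" where
  "pole_count f t = real (\<Sum>z\<in>{z. cmod z \<le> t \<and> is_pole f z}. nat (- zorder f z))"

definition pole_N :: "(complex \<Rightarrow> complex) \<Rightarrow> real \<Rightarrow> real" where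
  "pole_N f r = integrated_count (pole_count f) r"

definition nev_T :: "(complex \<Rightarrow> complex) \<Rightarrow> real \<Rightarrow> real" where
  "nev_T f r = prox f r + pole_N f r"

definition zero_count_reduced :: "(complex \<Rightarrow> complex) \<Rightarrow> real \<Rightarrow> real" where
  "zero_count_reduced G t = real (card {z. cmod z \<le> t \<and> (G \<midarrow>z\<rightarrow> 0)})"

definition zero_Nbar :: "(complex \<Rightarrow> complex) \<Rightarrow> real \<Rightarrow> real" where
  "zero_Nbar G r = integrated_count (zero_count_reduced G) r"

definition transcendental_mero :: "(complex \<Rightarrow> complex) \<Rightarrow> bool" where
  "transcendental_mero f \<longleftrightarrow>
     \<not> (\<exists>p q :: complex poly. q \<noteq> 0 \<and> (\<forall>z. poly q z \<noteq> 0 \<longrightarrow> f z = poly p z / poly q z))"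

definition le_up_to_S :: "(complex \<Rightarrow> complex) \<Rightarrow> (real \<Rightarrow> real) \<Rightarrow> (real \<Rightarrow> real) \<Rightarrow> bool" where
  "le_up_to_S f A B \<longleftrightarrow>
     (\<exists>S E. E \<in> sets lebesgue \<and> emeasure lebesgue E < \<infinity> \<and>
        (\<forall>\<epsilon>>0. \<exists>R. \<forall>r\<ge>R. r \<notin> E \<longrightarrow> \<bar>S r\<bar> \<le> \<epsilon> * nev_T f r) \<and>
        (\<forall>r>0. r \<notin> E \<longrightarrow> A r \<le> B r + S r))"

end

theory Submission
  imports Defs
begin

text \<open>
  Put \<open>F = f ^ q0 * (f\<^sup>(\<^sup>k\<^sup>)) ^ qk\<close>, \<open>n = q0 + qk\<close> and \<open>H = F' / (F - 1)\<close>. The identity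
  \<open>1 / f ^ n = (f\<^sup>(\<^sup>k\<^sup>) / f) ^ qk - (f\<^sup>(\<^sup>k\<^sup>) / f) ^ qk * (F' / F) * (1 / H)\<close> and the lemma on the
  logarithmic derivative bound \<open>n m(r, 1/f)\<close> by \<open>m(r, 1/H) + S(r, f)\<close>, and Jensen's formula turns
  \<open>m(r, 1/H)\<close> into \<open>- N\<close> of the divisor of \<open>H\<close>. Comparing orders pointwise,
  \<open>n T(r, f) \<le> (qk + 1) N(r, 1/f) + Nbar(r, f) + Nbar(r, 1/(F - 1)) + S(r, f)\<close>. Since all poles are
  multiple, \<open>2 Nbar(r, f) \<le> T(r, f)\<close>, so \<open>(q0 - 3/2) T(r, f) \<le> Nbar(r, 1/(F - 1)) + S(r, f)\<close>,
  which is even stronger than the claim by a factor of three.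

  The error terms are bounded at every radius \<open>r\<close> off a countable set and every step \<open>d\<close> by a constant
  multiple of a function of \<open>r\<close> and \<open>d\<close> that is logarithmic in a monotone majorant of \<open>T\<close> at \<open>r + d\<close>;
  Borel's growth lemma is applied only once, at the end, with \<open>d = 1 / T\<close>.
\<close>

section \<open>Circle means\<close>

text \<open>The logarithmic derivative lemma is applied to \<open>f\<close>, to its derivatives, to
  \<open>F\<close> and to \<open>F - 1\<close>, and each application by itself would bring an
  exceptional set and an error measured by the characteristic of that function. A free step
  \<open>d\<close> in all bounds avoids this. Only the logarithm of a characteristic enters an error
  term, so crude exponential bounds for the auxiliary functions suffice, and they are stable under
  the operations that build them from \<open>f\<close>. Two facts about \<open>f\<close> make the
  one final choice of \<open>d\<close> effective: its characteristic is monotone, which gives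
  Borel's lemma a monotone function to work on, and it outgrows every multiple of
  \<open>ln r\<close> because \<open>f\<close> is transcendental, which absorbs the explicit
  \<open>ln (r + 1)\<close> of the error. The identity divides by \<open>F'\<close>, so
  \<open>F\<close> must not be constant. If it were, \<open>1 / f ^ n\<close> would be a constant
  multiple of a power of \<open>f\<^sup>(\<^sup>k\<^sup>) / f\<close>, and the whole characteristic
  of \<open>f\<close> would be an error term.\<close>

lemma logplus_eq: "logplus x = ln (max 1 x)"
  by (auto simp: logplus_def max_def)

lemma logplus_nonneg [simp]: "0 \<le> logplus x"
  by (simp add: logplus_eq)

lemma logplus_mono: "x \<le> y \<Longrightarrow> logplus x \<le> logplus y"
  by (auto simp: logplus_eq)

lemma ln_eq_logplus_diff: "0 < x \<Longrightarrow> ln x = logplus x - logplus (inverse x)"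
  by (auto simp: logplus_def ln_inverse one_less_inverse_iff inverse_le_1_iff)

lemma abs_ln_eq_logplus_sum: "0 < x \<Longrightarrow> \<bar>ln x\<bar> = logplus x + logplus (inverse x)"
  by (auto simp: logplus_def ln_inverse inverse_le_1_iff)

lemma logplus_mult:
  assumes "0 \<le> x" "0 \<le> y"
  shows "logplus (x * y) \<le> logplus x + logplus y"
proof -
  have "x * y \<le> max 1 x * max 1 y"
    using assms by (intro mult_mono) auto
  moreover have "1 * 1 \<le> max 1 x * max 1 y"
    by (intro mult_mono) auto
  ultimately have "ln (max 1 (x * y)) \<le> ln (max 1 x * max 1 y)"
    by (subst ln_le_cancel_iff) auto
  moreover have "max 1 x \<noteq> 0" "max 1 y \<noteq> 0"
    by (simp_all add: max_def)
  ultimately show ?thesis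
    by (simp add: logplus_eq ln_mult)
qed

lemma logplus_add:
  assumes "0 \<le> x" "0 \<le> y"
  shows "logplus (x + y) \<le> logplus x + logplus y + ln 2"
proof -
  have 1: "1 * 1 \<le> max 1 x * max 1 y" "x * 1 \<le> max 1 x * max 1 y" "1 * y \<le> max 1 x * max 1 y"
    using assms by (intro mult_mono; simp)+
  hence "max 1 (x + y) \<le> 2 * (max 1 x * max 1 y)"
    by (auto simp: max_def)
  hence "ln (max 1 (x + y)) \<le> ln (2 * (max 1 x * max 1 y))"
    by (subst ln_le_cancel_iff) (auto simp: zero_less_mult_iff)
  moreover have "max 1 x \<noteq> 0" "max 1 y \<noteq> 0"
    by (simp_all add: max_def)
  ultimately show ?thesis
    by (simp add: logplus_eq ln_mult)
qed

lemma logplus_power: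
  assumes "0 \<le> x"
  shows "logplus (x ^ n) = real n * logplus x"
proof (cases "x \<le> 1")
  case True
  thus ?thesis using assms by (simp add: logplus_def power_le_one)
next
  case False
  have "1 \<le> x ^ n" using False by simp
  hence "max 1 (x ^ n) = max 1 x ^ n"
    using False by (simp add: max_def)
  thus ?thesis by (simp add: logplus_eq ln_realpow)
qed

lemma continuous_on_logplus [continuous_intros]:
  assumes "continuous_on S f"
  shows "continuous_on S (\<lambda>x. logplus (f x))"
  unfolding logplus_eq by (intro continuous_intros assms) auto

definition circle_mean :: "(complex \<Rightarrow> real) \<Rightarrow> real \<Rightarrow> real" where
  "circle_mean u r = integral {0..2*pi} (\<lambda>\<theta>. u (rcis r \<theta>)) / (2*pi)"

lemma prox_eq_circle_mean: "prox f r = circle_mean (\<lambda>z. logplus (cmod (f z))) r"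
  by (simp add: prox_def circle_mean_def)

lemma rcis_in_sphere [simp]: "0 \<le> r \<Longrightarrow> rcis r \<theta> \<in> sphere 0 r"
  by (simp add: rcis_def norm_mult)

lemma continuous_on_rcis [continuous_intros]: "continuous_on A (rcis r)"
  unfolding rcis_def by (intro continuous_intros)

lemma continuous_on_circle:
  assumes "continuous_on (sphere 0 r) u" "0 \<le> r"
  shows "continuous_on A (\<lambda>\<theta>. u (rcis r \<theta>))"
  by (rule continuous_on_compose2[OF assms(1) continuous_on_rcis]) (use assms in auto)

lemma integrable_on_circle:
  fixes u :: "complex \<Rightarrow> 'a :: banach"
  assumes "continuous_on (sphere 0 r) u" "0 \<le> r"
  shows "(\<lambda>\<theta>. u (rcis r \<theta>)) integrable_on {0..2*pi}"
  using continuous_on_circle[OF assms] by (rule integrable_continuous_real)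

lemma circle_mean_cong:
  assumes "\<And>z. z \<in> sphere 0 r \<Longrightarrow> u z = v z" "0 \<le> r"
  shows "circle_mean u r = circle_mean v r"
proof -
  have "(\<lambda>\<theta>. u (rcis r \<theta>)) = (\<lambda>\<theta>. v (rcis r \<theta>))"
    using assms by (intro ext assms(1)) simp
  thus ?thesis by (simp add: circle_mean_def)
qed

lemma circle_mean_add:
  assumes "continuous_on (sphere 0 r) u" "continuous_on (sphere 0 r) v" "0 \<le> r"
  shows "circle_mean (\<lambda>z. u z + v z) r = circle_mean u r + circle_mean v r"
  using integral_add[OF integrable_on_circle[OF assms(1,3)] integrable_on_circle[OF assms(2,3)]]
  by (simp add: circle_mean_def add_divide_distrib)

lemma circle_mean_diff:
  assumes "continuous_on (sphere 0 r) u" "continuous_on (sphere 0 r) v" "0 \<le> r"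
  shows "circle_mean (\<lambda>z. u z - v z) r = circle_mean u r - circle_mean v r"
  using integral_diff[OF integrable_on_circle[OF assms(1,3)] integrable_on_circle[OF assms(2,3)]]
  by (simp add: circle_mean_def diff_divide_distrib)

lemma circle_mean_cmult: "circle_mean (\<lambda>z. c * u z) r = c * circle_mean u r"
  by (simp add: circle_mean_def)

lemma circle_mean_const [simp]: "circle_mean (\<lambda>_. c) r = c"
  by (simp add: circle_mean_def)

lemma circle_mean_sum:
  assumes "finite I" "\<And>i. i \<in> I \<Longrightarrow> continuous_on (sphere 0 r) (u i)" "0 \<le> r"
  shows "circle_mean (\<lambda>z. \<Sum>i\<in>I. u i z) r = (\<Sum>i\<in>I. circle_mean (u i) r)"
  using assms(1,2)
proof (induction I rule: finite_induct)
  case (insert i I)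
  have "continuous_on (sphere 0 r) (\<lambda>z. \<Sum>i\<in>I. u i z)"
    using insert by (intro continuous_intros) auto
  with insert show ?case
    by (simp add: circle_mean_add assms(3))
qed auto

lemma circle_mean_mono:
  assumes "continuous_on (sphere 0 r) u" "continuous_on (sphere 0 r) v" "0 \<le> r"
    and "\<And>z. z \<in> sphere 0 r \<Longrightarrow> u z \<le> v z"
  shows "circle_mean u r \<le> circle_mean v r"
proof -
  have "integral {0..2*pi} (\<lambda>\<theta>. u (rcis r \<theta>)) \<le> integral {0..2*pi} (\<lambda>\<theta>. v (rcis r \<theta>))"
    using assms by (intro integral_le integrable_on_circle assms(4)) simp_all
  thus ?thesis by (simp add: circle_mean_def divide_right_mono)
qed

lemma circle_mean_nonneg:
  assumes "continuous_on (sphere 0 r) u" "0 \<le> r" "\<And>z. z \<in> sphere 0 r \<Longrightarrow> 0 \<le> u z"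
  shows "0 \<le> circle_mean u r"
  using circle_mean_mono[of r "\<lambda>_. 0" u] assms by simp

lemma prox_nonneg:
  assumes "continuous_on (sphere 0 r) f" "0 \<le> r"
  shows "0 \<le> prox f r"
  unfolding prox_eq_circle_mean by (intro circle_mean_nonneg continuous_intros assms) auto

section \<open>Cauchy's formula in terms of circle means\<close>

lemma circle_integral_holomorphic:
  fixes L :: "complex \<Rightarrow> complex"
  assumes "L holomorphic_on ball 0 R" "0 < r" "r < R"
  shows "integral {0..2*pi} (\<lambda>\<theta>. L (rcis r \<theta>)) = 2 * pi * L 0"
proof -
  have "((\<lambda>u. L u / (u - 0) ^ Suc 0) has_contour_integral
          (2 * pi * \<i> / fact 0 * (deriv ^^ 0) L 0)) (circlepath 0 r)"
    using assms by (intro Cauchy_has_contour_integral_higher_derivative_circlepath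
      holomorphic_on_imp_continuous_on) (auto intro: holomorphic_on_subset)
  hence "((\<lambda>t. L (0 + r * cis t) / (0 + r * cis t - 0) ^ Suc 0 * r * \<i> * cis t) has_integral
          (2 * pi * \<i> * L 0)) {0..2*pi}"
    unfolding circlepath_def by (subst (asm) has_contour_integral_part_circlepath_iff) auto
  hence "((\<lambda>t. L (rcis r t) * \<i>) has_integral (2 * pi * \<i> * L 0)) {0..2*pi}"
    using \<open>0 < r\<close> by (auto simp: rcis_def field_simps)
  from has_integral_mult_left[OF this, of "-\<i>"]
  have "((\<lambda>t. L (rcis r t)) has_integral (2 * pi * L 0)) {0..2*pi}"
    by (simp add: algebra_simps)
  thus ?thesis by (rule integral_unique)
qed

lemma circle_mean_Re_holomorphic:
  assumes "L holomorphic_on ball 0 R" "0 < r" "r < R"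
  shows "circle_mean (\<lambda>z. Re (L z)) r = Re (L 0)"
proof -
  have "continuous_on (sphere 0 r) L"
    using assms by (intro holomorphic_on_imp_continuous_on holomorphic_on_subset[OF assms(1)]) auto
  hence "(\<lambda>\<theta>. L (rcis r \<theta>)) integrable_on {0..2*pi}"
    using assms by (intro integrable_on_circle) auto
  hence "integral {0..2*pi} (\<lambda>\<theta>. Re (L (rcis r \<theta>))) = Re (2 * pi * L 0)"
    using integral_linear[OF _ bounded_linear_Re, of "\<lambda>\<theta>. L (rcis r \<theta>)" "{0..2*pi}"]
      circle_integral_holomorphic[OF assms] by (simp add: o_def)
  thus ?thesis by (simp add: circle_mean_def)
qed

text \<open>
  Cauchy's formula for \<open>deriv L\<close> has kernel \<open>w / (w - z)\<^sup>2\<close>. The same kernel integrates \<open>cnj (L w)\<close>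
  to zero, because on the circle \<open>cnj w = s\<^sup>2 / w\<close>; hence \<open>L\<close> may be replaced by \<open>2 Re L\<close>.
\<close>
lemma norm_deriv_le_circle_mean_Re:
  fixes L :: "complex \<Rightarrow> complex"
  assumes L: "L holomorphic_on ball 0 R" and s: "0 < s" "s < R" and z: "cmod z < s"
  shows "cmod (deriv L z) \<le> 2 * s / (s - cmod z)\<^sup>2 * circle_mean (\<lambda>z. \<bar>Re (L z)\<bar>) s"
proof -
  define K where "K w = w / (w - z)\<^sup>2" for w :: complex
  have contL: "continuous_on (sphere 0 s) L"
    using s by (intro holomorphic_on_imp_continuous_on holomorphic_on_subset[OF L]) auto
  have neq: "w \<noteq> z" if "w \<in> sphere 0 s" for w
    using that z by auto
  have contK: "continuous_on (sphere 0 s) K"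
    unfolding K_def by (intro continuous_intros) (use neq in auto)
  have "((\<lambda>u. L u / (u - z) ^ Suc 1) has_contour_integral
          (2 * pi * \<i> / fact 1 * (deriv ^^ 1) L z)) (circlepath 0 s)"
    using assms by (intro Cauchy_has_contour_integral_higher_derivative_circlepath
      holomorphic_on_imp_continuous_on) (auto intro: holomorphic_on_subset)
  hence "((\<lambda>t. L (0 + s * cis t) / (0 + s * cis t - z) ^ Suc 1 * s * \<i> * cis t) has_integral
          (2 * pi * \<i> * deriv L z)) {0..2*pi}"
    unfolding circlepath_def by (subst (asm) has_contour_integral_part_circlepath_iff) auto
  hence "((\<lambda>t. L (rcis s t) * K (rcis s t) * \<i>) has_integral (2 * pi * \<i> * deriv L z)) {0..2*pi}"
    by (simp add: rcis_def K_def power2_eq_square mult_ac)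
  from has_integral_mult_left[OF this, of "-\<i>"]
  have 1: "((\<lambda>t. L (rcis s t) * K (rcis s t)) has_integral (2 * pi * deriv L z)) {0..2*pi}"
    by (simp add: algebra_simps)
  \<comment> \<open>\<open>h\<close> is a holomorphic stand-in: substituting
    \<open>cnj w = s^2 / w\<close> gives \<open>cnj (h w) = cnj (L w) * K w\<close> on the circle.
    Its factor \<open>w\<close> makes it vanish at the centre, so its mean is zero.\<close>
  define h where "h w = L w * (s\<^sup>2 * w / (s\<^sup>2 - cnj z * w)\<^sup>2)" for w :: complex
  have nz: "complex_of_real (s\<^sup>2) - cnj z * w \<noteq> 0" if "cmod w * cmod z < s\<^sup>2" for w
  proof
    assume "complex_of_real (s\<^sup>2) - cnj z * w = 0"
    hence "cmod (complex_of_real (s\<^sup>2)) = cmod (cnj z * w)" by simp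
    thus False using that by (simp add: norm_mult norm_power mult.commute)
  qed
  \<comment> \<open>The denominator of \<open>h\<close> vanishes at \<open>s^2 / cnj z\<close>,
    which lies outside the closed disc because \<open>cmod z < s\<close>. For \<open>z = 0\<close>
    there is no such point, while the quotient would be 0 by the division convention.\<close>
  define R' where "R' = (if z = 0 then R else min R (s\<^sup>2 / cmod z))"
  have R': "s < R'" "R' \<le> R"
    using s z by (auto simp: R'_def field_simps power2_eq_square)
  have nz': "complex_of_real (s\<^sup>2) - cnj z * w \<noteq> 0" if "w \<in> ball 0 R'" for w
    using that s by (intro nz) (auto simp: R'_def field_simps split: if_splits)
  have "h holomorphic_on ball 0 R'"
    unfolding h_def using R' nz'
    by (intro holomorphic_intros holomorphic_on_subset[OF L]) auto
  hence hint: "integral {0..2*pi} (\<lambda>\<theta>. h (rcis s \<theta>)) = 0"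
    using circle_integral_holomorphic[of h R' s] R' s by (simp add: h_def)
  have conth: "continuous_on (sphere 0 s) h"
    using R' by (intro holomorphic_on_imp_continuous_on
      holomorphic_on_subset[OF \<open>h holomorphic_on ball 0 R'\<close>]) auto
  have "(\<lambda>\<theta>. h (rcis s \<theta>)) integrable_on {0..2*pi}"
    using conth s by (intro integrable_on_circle) auto
  with hint have "((\<lambda>\<theta>. h (rcis s \<theta>)) has_integral 0) {0..2*pi}"
    by (simp add: has_integral_integrable_integral)
  hence 2: "((\<lambda>\<theta>. cnj (h (rcis s \<theta>))) has_integral 0) {0..2*pi}"
    using has_integral_linear[OF _ bounded_linear_cnj, of "\<lambda>\<theta>. h (rcis s \<theta>)" 0 "{0..2*pi}"]
    by (simp add: o_def)
  have cnjh: "cnj (h w) = cnj (L w) * K w" if "w \<in> sphere 0 s" for w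
  proof -
    have w0: "w \<noteq> 0" using that s by auto
    have ww: "w * cnj w = complex_of_real (s\<^sup>2)"
      using that by (simp add: complex_norm_square[symmetric])
    have c: "complex_of_real s ^ 2 = w * cnj w" using ww by simp
    have "cnj w \<noteq> 0" "w - z \<noteq> 0" using w0 neq[OF that] by auto
    have "(w * b) * b / (w * b - z * b)\<^sup>2 = w / (w - z)\<^sup>2" if "b \<noteq> 0" for b
    proof -
      have "w * b - z * b = b * (w - z)" by (simp add: algebra_simps)
      thus ?thesis using that \<open>w - z \<noteq> 0\<close> by (simp add: power_mult_distrib power2_eq_square)
    qed
    from this[of "cnj w"] have "complex_of_real s ^ 2 * cnj w / (complex_of_real s ^ 2 - z * cnj w)\<^sup>2 = K w"
      unfolding c K_def using \<open>cnj w \<noteq> 0\<close> by simp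
    thus ?thesis by (simp add: h_def del: times_divide_eq_right)
  qed
  have "((\<lambda>t. L (rcis s t) * K (rcis s t) + cnj (h (rcis s t))) has_integral
          (2 * pi * deriv L z + 0)) {0..2*pi}"
    by (intro has_integral_add 1 2)
  moreover have "(\<lambda>t. L (rcis s t) * K (rcis s t) + cnj (h (rcis s t))) =
      (\<lambda>t. 2 * Re (L (rcis s t)) * K (rcis s t))"
    using s by (auto simp: cnjh fun_eq_iff complex_add_cnj distrib_right[symmetric])
  ultimately have int: "((\<lambda>t. 2 * Re (L (rcis s t)) * K (rcis s t)) has_integral
          (2 * pi * deriv L z)) {0..2*pi}"
    by simp
  define B where "B = 2 * s / (s - cmod z)\<^sup>2"
  have Kle: "cmod (2 * K w) \<le> B" if "w \<in> sphere 0 s" for w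
  proof -
    have "s - cmod z \<le> cmod (w - z)"
      using norm_triangle_ineq2[of w z] that by simp
    hence "(s - cmod z)\<^sup>2 \<le> (cmod (w - z))\<^sup>2"
      using z by (intro power_mono) auto
    moreover have "0 < (s - cmod z)\<^sup>2"
      using z by simp
    ultimately have "2 * s / (cmod (w - z))\<^sup>2 \<le> 2 * s / (s - cmod z)\<^sup>2"
      using s by (intro divide_left_mono mult_pos_pos) auto
    thus ?thesis
      using that by (simp add: K_def B_def norm_divide norm_mult norm_power)
  qed
  have contA: "continuous_on (sphere 0 s) (\<lambda>w. \<bar>Re (L w)\<bar>)"
    by (intro continuous_intros contL)
  have "cmod (integral {0..2*pi} (\<lambda>t. 2 * Re (L (rcis s t)) * K (rcis s t))) \<le>
        integral {0..2*pi} (\<lambda>t. B * \<bar>Re (L (rcis s t))\<bar>)"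
  proof (intro integral_norm_bound_integral)
    show "(\<lambda>t. 2 * Re (L (rcis s t)) * K (rcis s t)) integrable_on {0..2*pi}"
      using int by auto
    show "(\<lambda>t. B * \<bar>Re (L (rcis s t))\<bar>) integrable_on {0..2*pi}"
      using s by (intro integrable_on_circle continuous_intros contL) auto
    fix t
    have "cmod (2 * Re (L (rcis s t)) * K (rcis s t)) = cmod (2 * K (rcis s t)) * \<bar>Re (L (rcis s t))\<bar>"
      by (simp add: norm_mult)
    also have "\<dots> \<le> B * \<bar>Re (L (rcis s t))\<bar>"
      using s by (intro mult_right_mono Kle) auto
    finally show "cmod (2 * Re (L (rcis s t)) * K (rcis s t)) \<le> B * \<bar>Re (L (rcis s t))\<bar>" .
  qed
  hence "2 * pi * cmod (deriv L z) \<le> B * integral {0..2*pi} (\<lambda>t. \<bar>Re (L (rcis s t))\<bar>)"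
    using integral_unique[OF int] by (simp add: norm_mult)
  hence "cmod (deriv L z) \<le> B * circle_mean (\<lambda>z. \<bar>Re (L z)\<bar>) s"
    by (simp add: circle_mean_def field_simps)
  thus ?thesis by (simp add: B_def)
qed

section \<open>Nonzero meromorphic functions and their divisors\<close>

text \<open>On the connected plane this is "meromorphic and not identically zero", insensitive to
  values on a sparse set. It is the condition under which \<open>zorder\<close> is additive under
  products.\<close>

definition mero_nz :: "(complex \<Rightarrow> complex) \<Rightarrow> bool" where
  "mero_nz g \<longleftrightarrow> g meromorphic_on UNIV \<and> eventually (\<lambda>z. g z \<noteq> 0) (cosparse UNIV)"

lemma mero_nz_const: "c \<noteq> 0 \<Longrightarrow> mero_nz (\<lambda>_. c)"
  by (auto simp: mero_nz_def)

lemma mero_nz_mult: "mero_nz g \<Longrightarrow> mero_nz h \<Longrightarrow> mero_nz (\<lambda>z. g z * h z)"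
  by (auto simp: mero_nz_def intro!: meromorphic_intros elim: eventually_elim2)

lemma mero_nz_inverse: "mero_nz g \<Longrightarrow> mero_nz (\<lambda>z. inverse (g z))"
  by (auto simp: mero_nz_def intro!: meromorphic_intros)

lemma mero_nz_divide: "mero_nz g \<Longrightarrow> mero_nz h \<Longrightarrow> mero_nz (\<lambda>z. g z / h z)"
  using mero_nz_mult[OF _ mero_nz_inverse] by (simp add: divide_inverse)

lemma mero_nz_power:
  assumes "mero_nz g"
  shows "mero_nz (\<lambda>z. g z ^ n)"
proof -
  have "eventually (\<lambda>z. g z \<noteq> 0) (cosparse UNIV)" using assms by (simp add: mero_nz_def)
  hence "eventually (\<lambda>z. g z ^ n \<noteq> 0) (cosparse UNIV)" by (rule eventually_mono) simp
  thus ?thesis using assms by (simp add: mero_nz_def meromorphic_on_power)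
qed

lemma mero_nz_power_int:
  assumes "mero_nz g"
  shows "mero_nz (\<lambda>z. g z powi n)"
proof -
  have "eventually (\<lambda>z. g z \<noteq> 0) (cosparse UNIV)" using assms by (simp add: mero_nz_def)
  hence "eventually (\<lambda>z. g z powi n \<noteq> 0) (cosparse UNIV)" by (rule eventually_mono) simp
  thus ?thesis using assms by (simp add: mero_nz_def meromorphic_on_powi)
qed

lemma mero_nz_prod:
  assumes "finite I" "\<And>i. i \<in> I \<Longrightarrow> mero_nz (g i)"
  shows "mero_nz (\<lambda>z. \<Prod>i\<in>I. g i z)"
  using assms by (induction I rule: finite_induct) (auto intro: mero_nz_const mero_nz_mult)

text \<open>The identity theorem as a dichotomy. Later nondegeneracy proofs, for the derivatives of
  \<open>f\<close> and for \<open>F - 1\<close> and its derivative, refute the second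
  alternative.\<close>

lemma mero_nz_or_zero:
  assumes "g meromorphic_on UNIV"
  shows "mero_nz g \<or> eventually (\<lambda>z. g z = 0) (cosparse UNIV)"
  using meromorphic_imp_constant_or_avoid[OF assms, of 0] assms by (auto simp: mero_nz_def)

lemma mero_nzD:
  assumes "mero_nz g"
  shows "g meromorphic_on A" "eventually (\<lambda>z. g z \<noteq> 0) (at z)" "frequently (\<lambda>z. g z \<noteq> 0) (at z)"
proof -
  show "g meromorphic_on A"
    using assms meromorphic_on_subset by (auto simp: mero_nz_def)
  show "eventually (\<lambda>z. g z \<noteq> 0) (at z)"
    using assms by (auto simp: mero_nz_def eventually_cosparse_open_eq)
  thus "frequently (\<lambda>z. g z \<noteq> 0) (at z)"
    by (intro eventually_frequently) auto
qed

lemma mero_nz_zorder_mult: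
  "mero_nz g \<Longrightarrow> mero_nz h \<Longrightarrow> zorder (\<lambda>z. g z * h z) a = zorder g a + zorder h a"
  by (intro zorder_mult mero_nzD)

lemma mero_nz_zorder_divide:
  "mero_nz g \<Longrightarrow> mero_nz h \<Longrightarrow> zorder (\<lambda>z. g z / h z) a = zorder g a - zorder h a"
  by (intro zorder_divide mero_nzD)

lemma mero_nz_zorder_power: "mero_nz g \<Longrightarrow> zorder (\<lambda>z. g z ^ n) a = int n * zorder g a"
  by (intro zorder_power mero_nzD)

lemma mero_nz_zorder_power_int: "mero_nz g \<Longrightarrow> zorder (\<lambda>z. g z powi n) a = n * zorder g a"
  by (intro zorder_power_int mero_nzD)

lemma mero_nz_is_pole_iff: "mero_nz g \<Longrightarrow> is_pole g a \<longleftrightarrow> zorder g a < 0"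
  using isolated_pole_imp_neg_zorder[OF meromorphic_on_isolated_singularity[OF mero_nzD(1)]]
    zorder_neg_imp_is_pole[OF mero_nzD(1,2)] by blast

text \<open>\<open>zero_count_reduced\<close> tests for the limit 0 and not for the value 0, so an
  arbitrary value at an isolated point neither creates nor hides a zero. This turns the test into
  one on orders.\<close>

lemma mero_nz_tendsto_0_iff:
  assumes "mero_nz g"
  shows "g \<midarrow>a\<rightarrow> 0 \<longleftrightarrow> zorder g a > 0"
proof -
  have "g \<midarrow>a\<rightarrow> 0 \<longleftrightarrow> isolated_zero g a"
    using mero_nzD(2)[OF assms] by (simp add: isolated_zero_def)
  also have "\<dots> \<longleftrightarrow> zorder g a > 0"
    using zorder_isolated_zero_pos'[OF _ meromorphic_on_isolated_singularity[OF mero_nzD(1)[OF assms]]]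
      zorder_pos_imp_isolated_zero[OF mero_nzD(1,2)[OF assms]] by blast
  finally show ?thesis .
qed

text \<open>
  Only radii of circles free of zeros and poles are used, so that all integrands over circles are
  continuous; the other radii form a countable set, which is absorbed into the exceptional set.
\<close>
definition regular :: "(complex \<Rightarrow> complex) \<Rightarrow> real \<Rightarrow> bool" where
  "regular g r \<longleftrightarrow> 0 < r \<and> (\<forall>z\<in>sphere 0 r. g analytic_on {z} \<and> g z \<noteq> 0)"

lemma regular_pos: "regular g r \<Longrightarrow> 0 < r"
  by (simp add: regular_def)

lemma regular_inverse: "regular g r \<Longrightarrow> regular (\<lambda>z. inverse (g z)) r"
  by (auto simp: regular_def intro!: analytic_intros)

lemma regular_divide: "regular g r \<Longrightarrow> regular h r \<Longrightarrow> regular (\<lambda>z. g z / h z) r"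
  by (auto simp: regular_def intro!: analytic_intros)

lemma regular_continuous_on: "regular g r \<Longrightarrow> continuous_on (sphere 0 r) g"
  by (rule continuous_at_imp_continuous_on) (simp add: regular_def analytic_at_imp_isCont)

lemma regular_nonzero: "regular g r \<Longrightarrow> z \<in> sphere 0 r \<Longrightarrow> g z \<noteq> 0"
  by (simp add: regular_def)

lemma regular_zorder: "regular g r \<Longrightarrow> cmod z = r \<Longrightarrow> zorder g z = 0"
  by (rule zorder_eq_0I) (simp_all add: regular_def)

lemma mero_nz_sparse_irregular:
  assumes "mero_nz g"
  shows "{z. \<not> (g analytic_on {z} \<and> g z \<noteq> 0)} sparse_in UNIV"
proof -
  have "eventually (\<lambda>z. g analytic_on {z} \<and> g z \<noteq> 0) (cosparse UNIV)"
  proof (rule eventually_conj)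
    show "eventually (\<lambda>z. g analytic_on {z}) (cosparse UNIV)"
      using assms by (intro meromorphic_on_imp_analytic_cosparse) (simp add: mero_nz_def)
    show "eventually (\<lambda>z. g z \<noteq> 0) (cosparse UNIV)"
      using assms by (simp add: mero_nz_def)
  qed
  thus ?thesis by (simp add: eventually_cosparse)
qed

lemma countable_not_regular:
  assumes "mero_nz g"
  shows "countable {r. 0 < r \<and> \<not> regular g r}"
proof -
  have 1: "countable {z. \<not> (g analytic_on {z} \<and> g z \<noteq> 0)}"
    using sparse_imp_countable[OF open_UNIV mero_nz_sparse_irregular[OF assms]]
    by (simp only: Int_UNIV_left)
  have "{r. 0 < r \<and> \<not> regular g r} \<subseteq> cmod ` {z. \<not> (g analytic_on {z} \<and> g z \<noteq> 0)}"
  proof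
    fix r assume "r \<in> {r. 0 < r \<and> \<not> regular g r}"
    then obtain z where "z \<in> sphere 0 r" "\<not> (g analytic_on {z} \<and> g z \<noteq> 0)"
      unfolding regular_def by blast
    thus "r \<in> cmod ` {z. \<not> (g analytic_on {z} \<and> g z \<noteq> 0)}"
      by (intro image_eqI[of _ _ z]) simp_all
  qed
  thus ?thesis
    by (rule countable_subset[OF _ countable_image[OF 1]])
qed

section \<open>Divisors and their counting functions\<close>

lemma finite_zorder_nz:
  assumes "mero_nz g"
  shows "finite {z. cmod z \<le> r \<and> zorder g z \<noteq> 0}"
proof -
  have "finite (cball 0 r \<inter> {z. \<not> (g analytic_on {z} \<and> g z \<noteq> 0)})"
    by (intro sparse_in_compact_finite sparse_in_subset[OF mero_nz_sparse_irregular[OF assms]]) auto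
  moreover have "{z. cmod z \<le> r \<and> zorder g z \<noteq> 0} \<subseteq> cball 0 r \<inter> {z. \<not> (g analytic_on {z} \<and> g z \<noteq> 0)}"
    using zorder_eq_0I[of g] by (simp add: subset_iff) blast
  ultimately show ?thesis
    by (rule rev_finite_subset)
qed

text \<open>A sum over an infinite set is 0 by convention, so finiteness in every disc is what makes
  \<open>divisor_N\<close> meaningful and additive.\<close>

definition locally_finite :: "(complex \<Rightarrow> real) \<Rightarrow> bool" where
  "locally_finite D \<longleftrightarrow> (\<forall>r. finite {a. cmod a \<le> r \<and> D a \<noteq> 0})"

lemma locally_finiteI:
  assumes "mero_nz g" "\<And>a. zorder g a = 0 \<Longrightarrow> D a = 0"
  shows "locally_finite D"
  unfolding locally_finite_def
proof
  fix r show "finite {a. cmod a \<le> r \<and> D a \<noteq> 0}"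
    by (rule finite_subset[OF _ finite_zorder_nz[OF assms(1), of r]]) (use assms(2) in auto)
qed

lemma locally_finite_add:
  assumes "locally_finite D1" "locally_finite D2"
  shows "locally_finite (\<lambda>a. D1 a + D2 a)"
  unfolding locally_finite_def
proof
  fix r show "finite {a. cmod a \<le> r \<and> D1 a + D2 a \<noteq> 0}"
    by (rule finite_subset[of _ "{a. cmod a \<le> r \<and> D1 a \<noteq> 0} \<union> {a. cmod a \<le> r \<and> D2 a \<noteq> 0}"])
       (use assms in \<open>auto simp: locally_finite_def\<close>)
qed

lemma locally_finite_cmult:
  assumes "locally_finite D"
  shows "locally_finite (\<lambda>a. c * D a)"
  unfolding locally_finite_def
proof
  fix r show "finite {a. cmod a \<le> r \<and> c * D a \<noteq> 0}"
    by (rule finite_subset[of _ "{a. cmod a \<le> r \<and> D a \<noteq> 0}"])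
       (use assms in \<open>auto simp: locally_finite_def\<close>)
qed

text \<open>The origin contributes \<open>D 0 * ln r\<close>, as in \<open>integrated_count\<close>.\<close>
definition divisor_N :: "(complex \<Rightarrow> real) \<Rightarrow> real \<Rightarrow> real" where
  "divisor_N D r = (\<Sum>a | cmod a \<le> r \<and> D a \<noteq> 0. D a * ln (r / (if a = 0 then 1 else cmod a)))"

lemma divisor_N_eq_sum:
  assumes "finite A" "\<And>a. a \<in> A \<Longrightarrow> cmod a \<le> r" "\<And>a. cmod a \<le> r \<Longrightarrow> a \<notin> A \<Longrightarrow> D a = 0"
  shows "divisor_N D r = (\<Sum>a\<in>A. D a * ln (r / (if a = 0 then 1 else cmod a)))"
  unfolding divisor_N_def by (rule sum.mono_neutral_left) (use assms in auto)

lemma divisor_N_add: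
  assumes "locally_finite D1" "locally_finite D2"
  shows "divisor_N (\<lambda>a. D1 a + D2 a) r = divisor_N D1 r + divisor_N D2 r"
proof -
  let ?A = "{a. cmod a \<le> r \<and> D1 a \<noteq> 0} \<union> {a. cmod a \<le> r \<and> D2 a \<noteq> 0}"
  have fin: "finite ?A"
    using assms by (auto simp: locally_finite_def)
  have "divisor_N D r = (\<Sum>a\<in>?A. D a * ln (r / (if a = 0 then 1 else cmod a)))"
    if "D \<in> {D1, D2, \<lambda>a. D1 a + D2 a}" for D
    using that by (intro divisor_N_eq_sum[OF fin]) auto
  thus ?thesis
    by (simp add: sum.distrib distrib_right)
qed

lemma divisor_N_cmult: "divisor_N (\<lambda>a. c * D a) r = c * divisor_N D r"
  by (cases "c = 0") (auto simp: divisor_N_def sum_distrib_left mult_ac)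

lemma divisor_N_diff:
  assumes "locally_finite D1" "locally_finite D2"
  shows "divisor_N (\<lambda>a. D1 a - D2 a) r = divisor_N D1 r - divisor_N D2 r"
  using divisor_N_add[OF assms(1) locally_finite_cmult[OF assms(2), of "-1"]]
    divisor_N_cmult[of "-1" D2] by simp

text \<open>For \<open>1 \<le> r\<close> every weight is nonnegative, including the weight
  \<open>ln r\<close> of the origin.\<close>

lemma divisor_N_mono:
  assumes "locally_finite D1" "locally_finite D2" "1 \<le> r" "\<And>a. D1 a \<le> D2 a"
  shows "divisor_N D1 r \<le> divisor_N D2 r"
proof -
  let ?A = "{a. cmod a \<le> r \<and> D1 a \<noteq> 0} \<union> {a. cmod a \<le> r \<and> D2 a \<noteq> 0}"
  have fin: "finite ?A"
    using assms by (auto simp: locally_finite_def)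
  have eq: "divisor_N D r = (\<Sum>a\<in>?A. D a * ln (r / (if a = 0 then 1 else cmod a)))"
    if "D \<in> {D1, D2}" for D
    using that by (intro divisor_N_eq_sum[OF fin]) auto
  have "(\<Sum>a\<in>?A. D1 a * ln (r / (if a = 0 then 1 else cmod a))) \<le>
        (\<Sum>a\<in>?A. D2 a * ln (r / (if a = 0 then 1 else cmod a)))"
  proof (intro sum_mono mult_right_mono assms)
    fix a assume "a \<in> ?A"
    thus "0 \<le> ln (r / (if a = 0 then 1 else cmod a))"
      using assms(3) by (intro ln_ge_zero) auto
  qed
  thus ?thesis
    by (simp add: eq)
qed

lemma divisor_N_nonneg:
  assumes "\<And>a. 0 \<le> D a" "1 \<le> r"
  shows "0 \<le> divisor_N D r"
  unfolding divisor_N_def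
proof (intro sum_nonneg mult_nonneg_nonneg assms)
  fix a assume "a \<in> {a. cmod a \<le> r \<and> D a \<noteq> 0}"
  thus "0 \<le> ln (r / (if a = 0 then 1 else cmod a))"
    using assms(2) by (intro ln_ge_zero) auto
qed

text \<open>Each point in the smaller disc has weight at least \<open>ln (r / s)\<close>; for the
  origin this uses \<open>1 \<le> s\<close>. So a bound on the integrated count in a larger disc
  bounds the number of points in a smaller one.\<close>

lemma sum_le_divisor_N:
  assumes "locally_finite D" "\<And>a. 0 \<le> D a" "1 \<le> s" "s \<le> r"
  shows "(\<Sum>a | cmod a \<le> s \<and> D a \<noteq> 0. D a) * ln (r / s) \<le> divisor_N D r"
proof -
  have "(\<Sum>a | cmod a \<le> s \<and> D a \<noteq> 0. D a) * ln (r / s) =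
        (\<Sum>a | cmod a \<le> s \<and> D a \<noteq> 0. D a * ln (r / s))"
    by (rule sum_distrib_right)
  also have "\<dots> \<le> (\<Sum>a | cmod a \<le> s \<and> D a \<noteq> 0. D a * ln (r / (if a = 0 then 1 else cmod a)))"
  proof (intro sum_mono mult_left_mono assms)
    fix a assume "a \<in> {a. cmod a \<le> s \<and> D a \<noteq> 0}"
    hence "r / s \<le> r / (if a = 0 then 1 else cmod a)"
      using assms by (intro divide_left_mono) auto
    moreover have "0 < r / s" using assms by simp
    ultimately show "ln (r / s) \<le> ln (r / (if a = 0 then 1 else cmod a))"
      by (subst ln_le_cancel_iff) auto
  qed
  also have "\<dots> \<le> divisor_N D r"
    unfolding divisor_N_def
  proof (intro sum_mono2)
    show "finite {a. cmod a \<le> r \<and> D a \<noteq> 0}"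
      using assms by (auto simp: locally_finite_def)
    show "{a. cmod a \<le> s \<and> D a \<noteq> 0} \<subseteq> {a. cmod a \<le> r \<and> D a \<noteq> 0}"
      using assms by auto
    fix a assume "a \<in> {a. cmod a \<le> r \<and> D a \<noteq> 0} - {a. cmod a \<le> s \<and> D a \<noteq> 0}"
    thus "0 \<le> D a * ln (r / (if a = 0 then 1 else cmod a))"
      using assms by (intro mult_nonneg_nonneg ln_ge_zero) auto
  qed
  finally show ?thesis .
qed

text \<open>The share of a single point at distance \<open>s\<close> from the origin in the integral
  of \<open>integrated_count\<close>.\<close>

lemma has_integral_step_over:
  fixes r s :: real
  assumes "0 < s" "s \<le> r"
  shows "((\<lambda>t. (if s \<le> t then 1 else 0) / t) has_integral ln (r / s)) {0..r}"
proof -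
  have "((\<lambda>t. 1 / t) has_integral (ln r - ln s)) {s..r}"
  proof (rule fundamental_theorem_of_calculus[OF assms(2)])
    fix x assume "x \<in> {s..r}"
    thus "(ln has_vector_derivative 1 / x) (at x within {s..r})"
      using assms(1) by (auto intro!: derivative_eq_intros simp: has_real_derivative_iff_has_vector_derivative[symmetric])
  qed
  hence "((\<lambda>t. if t \<in> {s..r} then 1 / t else 0) has_integral (ln r - ln s)) {0..r}"
    using assms by (subst has_integral_restrict) auto
  moreover have "(if t \<in> {s..r} then 1 / t else 0) = (if s \<le> t then 1 else 0) / t" if "t \<in> {0..r}" for t
    using that by auto
  ultimately have "((\<lambda>t. (if s \<le> t then 1 else 0) / t) has_integral (ln r - ln s)) {0..r}"
    by (rule has_integral_eq[rotated])
  thus ?thesis using assms by (simp add: ln_div)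
qed

text \<open>Finite sum and integral are exchanged. The origin is treated apart, since
  \<open>n t - n 0\<close> removes it from the integrand and \<open>n 0 * ln r\<close> puts it
  back.\<close>

lemma integrated_count_eq_divisor_N:
  assumes D: "locally_finite D" and r: "0 < r"
    and n: "\<And>t. 0 \<le> t \<Longrightarrow> n t = (\<Sum>a | cmod a \<le> t \<and> D a \<noteq> 0. D a)"
  shows "integrated_count n r = divisor_N D r"
proof -
  define A where "A = {a. cmod a \<le> r \<and> D a \<noteq> 0}"
  have fin: "finite A"
    using D by (auto simp: A_def locally_finite_def)
  have n': "n t = (\<Sum>a\<in>A. D a * (if cmod a \<le> t then 1 else 0))" if "t \<in> {0..r}" for t
  proof -
    have "(\<Sum>a | cmod a \<le> t \<and> D a \<noteq> 0. D a) = (\<Sum>a\<in>A. if cmod a \<le> t then D a else 0)"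
      using that fin unfolding A_def
      by (subst sum.inter_filter[symmetric]) (auto intro!: sum.cong)
    thus ?thesis using n[of t] that by (simp add: if_distrib cong: if_cong)
  qed
  have n0: "n 0 = (if 0 \<in> A then D 0 else 0)"
  proof -
    have "n 0 = (\<Sum>a\<in>A. if a = 0 then D 0 else 0)"
      using n'[of 0] r by (auto intro!: sum.cong)
    thus ?thesis using fin by simp
  qed
  have "((\<lambda>t. \<Sum>a\<in>A-{0}. D a * ((if cmod a \<le> t then 1 else 0) / t)) has_integral
          (\<Sum>a\<in>A-{0}. D a * ln (r / cmod a))) {0..r}"
    using fin by (intro has_integral_sum has_integral_mult_right has_integral_step_over)
      (auto simp: A_def)
  moreover have "(\<Sum>a\<in>A-{0}. D a * ((if cmod a \<le> t then 1 else 0) / t)) = (n t - n 0) / t"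
    if "t \<in> {0..r}" for t
  proof -
    have "n t = (\<Sum>a\<in>A-{0}. D a * (if cmod a \<le> t then 1 else 0)) + n 0"
      using fin n'[OF that] n0 that by (cases "0 \<in> A") (auto simp: sum.remove)
    thus ?thesis by (simp add: sum_divide_distrib)
  qed
  ultimately have "((\<lambda>t. (n t - n 0) / t) has_integral (\<Sum>a\<in>A-{0}. D a * ln (r / cmod a))) {0..r}"
    by (rule has_integral_eq[rotated])
  hence "integrated_count n r = (\<Sum>a\<in>A-{0}. D a * ln (r / cmod a)) + n 0 * ln r"
    by (simp add: integrated_count_def integral_unique)
  also have "\<dots> = (\<Sum>a\<in>A. D a * ln (r / (if a = 0 then 1 else cmod a)))"
    using fin n0 by (cases "0 \<in> A") (auto simp: sum.remove intro!: sum.cong)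
  finally show ?thesis unfolding divisor_N_def A_def .
qed

definition pole_mult :: "(complex \<Rightarrow> complex) \<Rightarrow> complex \<Rightarrow> real" where
  "pole_mult g a = real (nat (- zorder g a))"

definition zero_mult :: "(complex \<Rightarrow> complex) \<Rightarrow> complex \<Rightarrow> real" where
  "zero_mult g a = real (nat (zorder g a))"

lemma pole_mult_nonneg [simp]: "0 \<le> pole_mult g a" and zero_mult_nonneg [simp]: "0 \<le> zero_mult g a"
  by (simp_all add: pole_mult_def zero_mult_def)

lemma zero_mult_minus_pole_mult: "zero_mult g a - pole_mult g a = real_of_int (zorder g a)"
  by (simp add: zero_mult_def pole_mult_def)

lemma locally_finite_pole_mult [simp]: "mero_nz g \<Longrightarrow> locally_finite (pole_mult g)"
  and locally_finite_zero_mult [simp]: "mero_nz g \<Longrightarrow> locally_finite (zero_mult g)"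
  and locally_finite_zorder [simp]: "mero_nz g \<Longrightarrow> locally_finite (\<lambda>a. real_of_int (zorder g a))"
proof -
  assume g: "mero_nz g"
  show "locally_finite (pole_mult g)"
    by (rule locally_finiteI[OF g]) (simp add: pole_mult_def)
  show "locally_finite (zero_mult g)"
    by (rule locally_finiteI[OF g]) (simp add: zero_mult_def)
  show "locally_finite (\<lambda>a. real_of_int (zorder g a))"
    by (rule locally_finiteI[OF g]) simp
qed

lemma pole_N_eq_divisor_N:
  assumes "mero_nz g" "0 < r"
  shows "pole_N g r = divisor_N (pole_mult g) r"
  unfolding pole_N_def
proof (rule integrated_count_eq_divisor_N)
  fix t :: real assume "0 \<le> t"
  have "{z. cmod z \<le> t \<and> is_pole g z} = {a. cmod a \<le> t \<and> pole_mult g a \<noteq> 0}"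
    using assms by (auto simp: pole_mult_def mero_nz_is_pole_iff)
  thus "pole_count g t = (\<Sum>a | cmod a \<le> t \<and> pole_mult g a \<noteq> 0. pole_mult g a)"
    by (simp add: pole_count_def pole_mult_def)
qed (use assms in auto)

lemma zero_Nbar_eq_divisor_N:
  assumes "mero_nz g" "0 < r"
  shows "zero_Nbar g r = divisor_N (\<lambda>a. if zorder g a > 0 then 1 else 0) r"
  unfolding zero_Nbar_def
proof (rule integrated_count_eq_divisor_N)
  show "locally_finite (\<lambda>a. if zorder g a > 0 then 1 else 0)"
    by (rule locally_finiteI[OF assms(1)]) simp
  fix t :: real assume "0 \<le> t"
  have "(\<Sum>a | cmod a \<le> t \<and> (if zorder g a > 0 then 1 else 0 :: real) \<noteq> 0.
      if zorder g a > 0 then 1 else 0 :: real) = (\<Sum>a | cmod a \<le> t \<and> zorder g a > 0. 1)"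
    by (rule sum.cong) auto
  thus "zero_count_reduced g t = (\<Sum>a | cmod a \<le> t \<and> (if zorder g a > 0 then 1 else 0 :: real) \<noteq> 0.
      if zorder g a > 0 then 1 else 0)"
    unfolding zero_count_reduced_def mero_nz_tendsto_0_iff[OF assms(1)] by simp
qed (use assms in auto)

section \<open>Jensen's formula\<close>

text \<open>Scaled to the disc of radius \<open>s\<close>: a simple zero at \<open>a\<close>, no
  other zero or pole in the closed disc, and modulus 1 on its boundary. Dividing such factors out
  removes zeros and poles without changing \<open>ln (cmod (g z))\<close> on the circle.\<close>

definition blaschke :: "real \<Rightarrow> complex \<Rightarrow> complex \<Rightarrow> complex" where
  "blaschke s a z = s * (z - a) / (complex_of_real (s\<^sup>2) - cnj a * z)"

lemma blaschke_denom_nz: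
  assumes "cmod a < s" "cmod z \<le> s"
  shows "complex_of_real (s\<^sup>2) - cnj a * z \<noteq> 0"
proof
  assume "complex_of_real (s\<^sup>2) - cnj a * z = 0"
  hence "cmod (complex_of_real (s\<^sup>2)) = cmod (cnj a * z)" by simp
  hence "s\<^sup>2 = cmod a * cmod z" by (simp add: norm_mult norm_power)
  also have "\<dots> \<le> cmod a * s" using assms by (intro mult_left_mono) auto
  also have "\<dots> < s * s"
    using assms norm_ge_zero[of a] by (intro mult_strict_right_mono) linarith+
  finally show False by (simp add: power2_eq_square)
qed

lemma blaschke_eq_0_iff:
  assumes "cmod a < s" "cmod z \<le> s"
  shows "blaschke s a z = 0 \<longleftrightarrow> z = a"
  using blaschke_denom_nz[OF assms] assms norm_ge_zero[of a] by (auto simp: blaschke_def)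

lemma blaschke_analytic:
  assumes "cmod a < s" "cmod z \<le> s"
  shows "blaschke s a analytic_on {z}"
  unfolding blaschke_def using blaschke_denom_nz[OF assms] by (intro analytic_intros) auto

lemma norm_blaschke_circle:
  assumes "cmod a < s" "cmod z = s"
  shows "cmod (blaschke s a z) = 1"
proof -
  have "z \<noteq> 0" using assms norm_ge_zero[of a] by auto
  have c: "complex_of_real (s\<^sup>2) = z * cnj z"
    using assms by (simp add: complex_norm_square[symmetric])
  have "complex_of_real (s\<^sup>2) - cnj a * z = z * cnj (z - a)"
    unfolding c by (simp add: algebra_simps)
  hence "cmod (complex_of_real (s\<^sup>2) - cnj a * z) = s * cmod (z - a)"
    using assms by (simp only: norm_mult complex_mod_cnj)
  moreover have "z \<noteq> a" "0 < s" using assms norm_ge_zero[of a] by auto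
  ultimately show ?thesis
    using assms by (simp add: blaschke_def norm_divide norm_mult)
qed

lemma mero_nz_blaschke:
  assumes "cmod a < s"
  shows "mero_nz (blaschke s a)"
proof -
  have m: "blaschke s a meromorphic_on UNIV"
    unfolding blaschke_def by (intro meromorphic_intros)
  have "\<not> eventually (\<lambda>z. blaschke s a z = 0) (cosparse UNIV)"
  proof
    assume "eventually (\<lambda>z. blaschke s a z = 0) (cosparse UNIV)"
    hence ev: "eventually (\<lambda>z. blaschke s a z = 0) (at a)"
      by (auto simp: eventually_cosparse_open_eq)
    have "eventually (\<lambda>z. z \<in> ball 0 s - {a}) (at a)"
      using assms by (intro eventually_at_in_open) auto
    with ev have "eventually (\<lambda>z. False) (at a)"
      by eventually_elim (use assms in \<open>auto simp: blaschke_eq_0_iff\<close>)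
    thus False by simp
  qed
  thus ?thesis using mero_nz_or_zero[OF m] by blast
qed

text \<open>In this logarithmic form the first summand carries the singularity at \<open>a\<close>,
  the second the one at the reflected point \<open>s^2 / cnj a\<close> when \<open>a\<close> is not
  0.\<close>

lemma blaschke_deriv:
  assumes "cmod a < s" "cmod z \<le> s" "z \<noteq> a"
  shows "(blaschke s a has_field_derivative
           blaschke s a z * (1 / (z - a) + cnj a / (complex_of_real (s\<^sup>2) - cnj a * z))) (at z)"
proof -
  note nz = blaschke_denom_nz[OF assms(1,2)]
  have "(blaschke s a has_field_derivative
      (s * (complex_of_real (s\<^sup>2) - cnj a * z) - s * (z - a) * (- cnj a)) / ((complex_of_real (s\<^sup>2) - cnj a * z) * (complex_of_real (s\<^sup>2) - cnj a * z))) (at z)"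
    unfolding blaschke_def using nz by (auto intro!: derivative_eq_intros)
  moreover have "\<And>d x r c :: complex. d \<noteq> 0 \<Longrightarrow> x \<noteq> 0 \<Longrightarrow>
      (r * d - r * x * (- c)) / (d * d) = r * x / d * (1 / x + c / d)"
    by (simp add: field_simps)
  ultimately show ?thesis
    using nz assms by (simp add: blaschke_def)
qed

lemma zorder_blaschke:
  assumes "cmod a < s" "cmod z \<le> s"
  shows "zorder (blaschke s a) z = (if z = a then 1 else 0)"
proof (cases "z = a")
  case False
  thus ?thesis
    using assms by (auto intro!: zorder_eq_0I simp: blaschke_analytic blaschke_eq_0_iff)
next
  case True
  have "zorder (blaschke s a) a = 1"
  proof (rule zorder_eqI)
    show "open (ball 0 s :: complex set)" "a \<in> ball 0 s" using assms by auto
    show "(\<lambda>z. s / (complex_of_real (s\<^sup>2) - cnj a * z)) holomorphic_on ball 0 s"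
      using blaschke_denom_nz[OF assms(1)] by (intro holomorphic_intros) auto
    show "complex_of_real s / (complex_of_real (s\<^sup>2) - cnj a * a) \<noteq> 0"
      using blaschke_denom_nz[OF assms(1), of a] assms norm_ge_zero[of a] by auto
  qed (simp add: blaschke_def)
  thus ?thesis using True by simp
qed

lemma open_analytic_nonzero:
  fixes g :: "complex \<Rightarrow> complex"
  shows "open {z. g analytic_on {z} \<and> g z \<noteq> 0}"
proof (rule openI)
  fix z assume "z \<in> {z. g analytic_on {z} \<and> g z \<noteq> 0}"
  then obtain S where S: "open S" "z \<in> S" "g holomorphic_on S" and nz: "g z \<noteq> 0"
    by (auto simp: analytic_at)
  have "open (S \<inter> g -` (- {0}))"
    by (rule continuous_open_preimage[OF holomorphic_on_imp_continuous_on[OF S(3)] S(1)]) auto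
  moreover have "z \<in> S \<inter> g -` (- {0})" using S nz by auto
  moreover have "S \<inter> g -` (- {0}) \<subseteq> {z. g analytic_on {z} \<and> g z \<noteq> 0}"
    using S by (auto simp: analytic_at)
  ultimately show "\<exists>e>0. ball z e \<subseteq> {z. g analytic_on {z} \<and> g z \<noteq> 0}"
    by (meson open_contains_ball subset_trans)
qed

text \<open>Compactness yields a uniform margin \<open>e\<close>, and a point at distance at most
  \<open>e\<close> beyond the circle is within \<open>e\<close> of its radial projection. This room
  beyond the circle lets the mean value property be applied on the circle itself.\<close>

lemma open_superset_cball_ball:
  fixes W :: "complex set"
  assumes "open W" "cball 0 s \<subseteq> W" "0 < s"
  obtains R where "s < R" "ball 0 R \<subseteq> W"
proof -
  obtain e where e: "e > 0" "(\<Union>x\<in>cball 0 s. cball x e) \<subseteq> W"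
    using compact_subset_open_imp_cball_epsilon_subset[OF compact_cball assms(1,2)] by blast
  have "ball 0 (s + e) \<subseteq> W"
  proof
    fix z :: complex assume z: "z \<in> ball 0 (s + e)"
    show "z \<in> W"
    proof (cases "cmod z \<le> s")
      case True thus ?thesis using assms by auto
    next
      case False
      define x where "x = (s / cmod z) *\<^sub>R z"
      have "cmod z > 0" using False assms by linarith
      have "cmod x = s" using \<open>cmod z > 0\<close> assms by (simp add: x_def)
      have "z - x = (1 - s / cmod z) *\<^sub>R z" by (simp add: x_def algebra_simps)
      hence "cmod (z - x) = \<bar>1 - s / cmod z\<bar> * cmod z" by simp
      also have "\<dots> = cmod z - s"
        using False \<open>cmod z > 0\<close> by (simp add: abs_if field_simps)
      finally have "dist x z \<le> e" using z by (simp add: dist_norm norm_minus_commute)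
      moreover have "x \<in> cball 0 s" using \<open>cmod x = s\<close> by simp
      ultimately show ?thesis using e(2) by (meson UN_I mem_cball subsetD)
    qed
  qed
  thus ?thesis using that[of "s + e"] e by auto
qed

text \<open>Dividing by Blaschke factors, raised to the orders of \<open>g\<close>, leaves a
  function without zeros or poles on the closed disc, hence on a larger disc, where it has a
  holomorphic logarithm \<open>L\<close>. On the circle the factors have modulus 1, so only
  \<open>L\<close> contributes there.\<close>

lemma mero_nz_factorization:
  assumes g: "mero_nz g" and regular: "regular g s"
  defines "A \<equiv> {a. cmod a \<le> s \<and> zorder g a \<noteq> 0}"
  shows "\<exists>R L. s < R \<and> L holomorphic_on ball 0 R \<and>
    (\<forall>z. cmod z \<le> s \<longrightarrow> g analytic_on {z} \<longrightarrow> g z \<noteq> 0 \<longrightarrow>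
       g z = exp (L z) * (\<Prod>a\<in>A. blaschke s a z powi zorder g a)) \<and>
    (\<forall>z\<in>sphere 0 s. ln (cmod (g z)) = Re (L z))"
proof -
  define P where "P z = (\<Prod>a\<in>A. blaschke s a z powi zorder g a)" for z
  have fin: "finite A" using finite_zorder_nz[OF g] by (simp add: A_def)
  have A: "cmod a < s" if "a \<in> A" for a
    using that regular_zorder[OF regular] by (force simp: A_def)
  have s: "0 < s" using regular by (rule regular_pos)
  have mf: "mero_nz (\<lambda>z. blaschke s a z powi zorder g a)" if "a \<in> A" for a
    by (intro mero_nz_power_int mero_nz_blaschke A that)
  have mP: "mero_nz P"
    unfolding P_def by (intro mero_nz_prod fin mf)
  have ordP: "zorder P z = zorder g z" if "cmod z \<le> s" for z
  proof -
    have "zorder P z = (\<Sum>a\<in>A. zorder (\<lambda>z. blaschke s a z powi zorder g a) z)"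
      unfolding P_def using mero_nzD(2)[OF mP] mf
      by (intro zorder_prod) (auto simp: P_def mero_nzD)
    also have "\<dots> = (\<Sum>a\<in>A. if z = a then zorder g z else 0)"
      using A that by (intro sum.cong) (auto simp: mero_nz_zorder_power_int mero_nz_blaschke zorder_blaschke)
    also have "\<dots> = zorder g z"
      using fin that by (auto simp: A_def)
    finally show ?thesis .
  qed
  define q where "q z = g z / P z" for z
  have mq: "mero_nz q" unfolding q_def by (intro mero_nz_divide g mP)
  have ordq: "zorder q z = 0" if "cmod z \<le> s" for z
    using ordP[OF that] unfolding q_def by (simp add: mero_nz_zorder_divide g mP)
  \<comment> \<open>At the points of \<open>A\<close> the quotient has order 0 but possibly a wrong
    value; removing the singularities corrects it.\<close>
  define h where "h = remove_sings q"
  have h: "h analytic_on {z} \<and> h z \<noteq> 0" if z: "cmod z \<le> s" for z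
  proof -
    have iso: "isolated_singularity_at q z" and ness: "not_essential q z"
      using mero_nzD(1)[OF mq] meromorphic_on_isolated_singularity meromorphic_on_not_essential by blast+
    have "\<not> is_pole q z" "\<not> q \<midarrow>z\<rightarrow> 0"
      using ordq[OF z] by (simp_all add: mero_nz_is_pole_iff mero_nz_tendsto_0_iff mq)
    then obtain c where c: "q \<midarrow>z\<rightarrow> c" "c \<noteq> 0"
      using ness unfolding not_essential_def by blast
    have "h z = c" unfolding h_def using c(1) by (rule remove_sings_eqI)
    thus ?thesis using remove_sings_analytic_at[OF iso c(1)] c(2) by (simp add: h_def)
  qed
  obtain R where R: "s < R" "ball 0 R \<subseteq> {z. h analytic_on {z} \<and> h z \<noteq> 0}"
    using open_superset_cball_ball[OF open_analytic_nonzero, of s h] h s by (auto simp: subset_iff)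
  have "h holomorphic_on ball 0 R"
    using R(2) by (intro analytic_imp_holomorphic) (auto simp: analytic_on_analytic_at[of h "ball 0 R"])
  then obtain L where L: "L holomorphic_on ball 0 R" "\<And>z. z \<in> ball 0 R \<Longrightarrow> h z = exp (L z)"
    by (rule contractible_imp_holomorphic_log)
       (use R(2) in \<open>auto intro: convex_imp_contractible\<close>)
  have eq: "g z = exp (L z) * P z" if z: "cmod z \<le> s" "g analytic_on {z}" "g z \<noteq> 0" for z
  proof -
    have "zorder g z = 0" using z by (intro zorder_eq_0I)
    hence zA: "z \<noteq> a" if "a \<in> A" for a using that by (auto simp: A_def)
    have nz: "P z \<noteq> 0"
      unfolding P_def using fin zA A z by (auto simp: blaschke_eq_0_iff)
    have "P analytic_on {z}"
      unfolding P_def[abs_def] using zA A z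
      by (intro analytic_intros) (auto simp: blaschke_eq_0_iff blaschke_analytic)
    hence "q analytic_on {z}"
      unfolding q_def[abs_def] using nz z by (intro analytic_intros) auto
    hence "h z = q z" unfolding h_def by simp
    moreover have "h z = exp (L z)" using z R by (intro L) auto
    ultimately show ?thesis
      using nz by (simp add: q_def field_simps)
  qed
  have "ln (cmod (g z)) = Re (L z)" if "z \<in> sphere 0 s" for z
  proof -
    have "cmod (g z) = exp (Re (L z)) * (\<Prod>a\<in>A. cmod (blaschke s a z) powi zorder g a)"
      using that regular by (subst eq) (simp_all add: regular_def P_def norm_mult norm_power_int prod_norm[symmetric])
    also have "(\<Prod>a\<in>A. cmod (blaschke s a z) powi zorder g a) = 1"
      using that by (intro prod.neutral) (auto simp: norm_blaschke_circle A)
    finally show ?thesis by simp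
  qed
  thus ?thesis
    using eq R(1) L(1) unfolding P_def by (intro exI[of _ R] exI[of _ L] conjI allI impI ballI)
qed

lemma ln_powi: "0 < x \<Longrightarrow> ln (x powi n) = real_of_int n * ln (x::real)"
  by (cases "n \<ge> 0") (auto simp: power_int_def ln_realpow ln_inverse)

lemma ln_norm_prod_powi:
  assumes "finite A" "\<And>a. a \<in> A \<Longrightarrow> f a \<noteq> (0::complex)"
  shows "ln (cmod (\<Prod>a\<in>A. f a powi n a)) = (\<Sum>a\<in>A. real_of_int (n a) * ln (cmod (f a)))"
  using assms
proof (induction A rule: finite_induct)
  case (insert a A)
  have "cmod (\<Prod>a\<in>A. f a powi n a) > 0" "cmod (f a) > 0" using insert by auto
  thus ?case using insert
    by (simp add: norm_mult norm_power_int ln_mult ln_powi)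
qed simp

text \<open>On the circle the integrand is \<open>Re (L z)\<close>, so the mean is
  \<open>Re (L 0)\<close>. This is compared with \<open>zor_poly g 0 0\<close>, the leading Laurent
  coefficient at the origin, and the values of the Blaschke factors at 0 make up the
  difference.\<close>

theorem jensen_formula:
  assumes g: "mero_nz g" and regular: "regular g s"
  shows "circle_mean (\<lambda>z. ln (cmod (g z))) s =
    divisor_N (\<lambda>a. real_of_int (zorder g a)) s + ln (cmod (zor_poly g 0 0))"
proof -
  define A where "A = {a. cmod a \<le> s \<and> zorder g a \<noteq> 0}"
  have fin: "finite A" using finite_zorder_nz[OF g] by (simp add: A_def)
  have A: "cmod a < s" if "a \<in> A" for a
    using that regular_zorder[OF regular] by (force simp: A_def)
  have s: "0 < s" using regular by (rule regular_pos)
  obtain R L where *: "s < R \<and> L holomorphic_on ball 0 R \<and>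
    (\<forall>z. cmod z \<le> s \<longrightarrow> g analytic_on {z} \<longrightarrow> g z \<noteq> 0 \<longrightarrow>
       g z = exp (L z) * (\<Prod>a\<in>A. blaschke s a z powi zorder g a)) \<and>
    (\<forall>z\<in>sphere 0 s. ln (cmod (g z)) = Re (L z))"
    using mero_nz_factorization[OF g regular, folded A_def] by (elim exE)
  note RL = conjunct1[OF *] conjunct1[OF conjunct2[OF *]]
  have eq: "g z = exp (L z) * (\<Prod>a\<in>A. blaschke s a z powi zorder g a)"
    if "cmod z \<le> s" "g analytic_on {z}" "g z \<noteq> 0" for z
    using conjunct1[OF conjunct2[OF conjunct2[OF *]]] that by (elim allE impE) assumption+
  have lnL: "ln (cmod (g z)) = Re (L z)" if "z \<in> sphere 0 s" for z
    using conjunct2[OF conjunct2[OF conjunct2[OF *]]] that by (rule bspec)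
  hence 1: "circle_mean (\<lambda>z. ln (cmod (g z))) s = Re (L 0)"
    using circle_mean_cong[of s "\<lambda>z. ln (cmod (g z))" "\<lambda>z. Re (L z)"] circle_mean_Re_holomorphic[OF RL(2) s RL(1)] s
    by simp
  define m where "m = zorder g 0"
  \<comment> \<open>The limit of \<open>g z * z powi (-m)\<close> at 0. The factor belonging to the
    origin is \<open>z / s\<close>, so cancelling the power of \<open>z\<close> leaves
    \<open>s powi (-m)\<close>.\<close>
  define c where "c = exp (L 0) * ((\<Prod>a\<in>A-{0}. blaschke s a 0 powi zorder g a) * complex_of_real s powi (-m))"
  have ev: "eventually (\<lambda>z. g z * (z - 0) powi (-m) =
      exp (L z) * ((\<Prod>a\<in>A-{0}. blaschke s a z powi zorder g a) * complex_of_real s powi (-m))) (at 0)"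
  proof -
    have "eventually (\<lambda>z. g analytic_on {z}) (at 0)"
      using meromorphic_on_imp_analytic_cosparse[OF mero_nzD(1)[OF g, of UNIV]]
      by (auto simp: eventually_cosparse_open_eq)
    moreover have "eventually (\<lambda>z. g z \<noteq> 0) (at 0)" by (rule mero_nzD[OF g])
    moreover have "eventually (\<lambda>z. z \<in> ball 0 s - {0}) (at 0)"
      using s by (intro eventually_at_in_open) auto
    ultimately show ?thesis
    proof eventually_elim
      case (elim z)
      have z0: "z \<noteq> 0" using elim by auto
      have "(\<Prod>a\<in>A. blaschke s a z powi zorder g a) =
            (z / s) powi m * (\<Prod>a\<in>A-{0}. blaschke s a z powi zorder g a)"
      proof (cases "0 \<in> A")
        case True
        have "blaschke s 0 z = z / s" using s by (simp add: blaschke_def power2_eq_square)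
        thus ?thesis using True fin by (simp add: prod.remove m_def)
      next
        case False
        hence "m = 0" using s by (auto simp: A_def m_def)
        thus ?thesis using False by simp
      qed
      moreover have "(z / s) powi m * z powi (-m) = complex_of_real s powi (-m)"
        using z0 s by (simp add: power_int_divide_distrib power_int_minus field_simps)
      ultimately show ?case
        using elim by (subst eq) (auto simp: algebra_simps)
    qed
  qed
  have "((\<lambda>z. exp (L z) *
      ((\<Prod>a\<in>A-{0}. blaschke s a z powi zorder g a) * complex_of_real s powi (-m))) \<longlongrightarrow> c) (at 0)"
    unfolding c_def
  proof (intro tendsto_intros)
    have "L analytic_on {0}"
      using RL s by (meson analytic_at centre_in_ball less_trans open_ball)
    thus "(L \<longlongrightarrow> L 0) (at 0)"
      using analytic_at_imp_isCont isContD by blast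
    fix a assume a: "a \<in> A - {0}"
    show "(blaschke s a \<longlongrightarrow> blaschke s a 0) (at 0)"
      using blaschke_analytic[of a s 0] A[of a] a s analytic_at_imp_isCont isContD by force
    show "blaschke s a 0 \<noteq> 0"
      using a A[of a] s by (subst blaschke_eq_0_iff) auto
  qed
  hence lim: "((\<lambda>z. g z * (z - 0) powi (-m)) \<longlongrightarrow> c) (at 0)"
    using tendsto_cong[OF ev] by simp
  have "zor_poly g 0 0 = c"
    by (rule zor_poly_eqI[where F = "at 0" and g = "\<lambda>z. z"])
       (use lim mero_nzD[OF g] meromorphic_on_isolated_singularity meromorphic_on_not_essential
         in \<open>auto simp: m_def filterlim_ident\<close>)
  moreover have "ln (cmod c) = Re (L 0) + ((\<Sum>a\<in>A-{0}. zorder g a * ln (cmod a / s)) - m * ln s)"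
  proof -
    have b0: "blaschke s a 0 \<noteq> 0" "cmod (blaschke s a 0) = cmod a / s" if "a \<in> A - {0}" for a
      using that A[of a] s by (auto simp: blaschke_eq_0_iff blaschke_def norm_divide norm_mult norm_power power2_eq_square)
    have p: "cmod (\<Prod>a\<in>A-{0}. blaschke s a 0 powi zorder g a) > 0"
      using b0 fin by auto
    have "ln (cmod c) = Re (L 0) + (ln (cmod (\<Prod>a\<in>A-{0}. blaschke s a 0 powi zorder g a)) - m * ln s)"
    proof -
      have "cmod c = exp (Re (L 0)) * (cmod (\<Prod>a\<in>A-{0}. blaschke s a 0 powi zorder g a) * s powi (-m))"
        using s unfolding c_def norm_mult norm_power_int by simp
      thus ?thesis
        using ln_mult_pos[OF exp_gt_zero mult_pos_pos[OF p zero_less_power_int[OF s]]]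
          ln_mult_pos[OF p zero_less_power_int[OF s]] ln_powi[OF s, of "-m"] by simp
    qed
    also have "ln (cmod (\<Prod>a\<in>A-{0}. blaschke s a 0 powi zorder g a)) =
        (\<Sum>a\<in>A-{0}. zorder g a * ln (cmod a / s))"
      using fin b0 by (subst ln_norm_prod_powi) (auto intro!: sum.cong)
    finally show ?thesis .
  qed
  moreover have "divisor_N (\<lambda>a. real_of_int (zorder g a)) s =
      m * ln s - (\<Sum>a\<in>A-{0}. zorder g a * ln (cmod a / s))"
  proof -
    have "divisor_N (\<lambda>a. real_of_int (zorder g a)) s = (\<Sum>a\<in>A. zorder g a * ln (s / (if a = 0 then 1 else cmod a)))"
      by (rule divisor_N_eq_sum) (use fin in \<open>auto simp: A_def\<close>)
    also have "\<dots> = m * ln s + (\<Sum>a\<in>A-{0}. zorder g a * ln (s / (if a = 0 then 1 else cmod a)))"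
    proof (cases "0 \<in> A")
      case True
      show ?thesis by (subst sum.remove[OF fin True]) (simp add: m_def)
    next
      case False
      hence "m = 0" using s by (auto simp: A_def m_def)
      thus ?thesis using False by simp
    qed
    also have "(\<Sum>a\<in>A-{0}. zorder g a * ln (s / (if a = 0 then 1 else cmod a))) =
        (\<Sum>a\<in>A-{0}. - (zorder g a * ln (cmod a / s)))"
      using s by (intro sum.cong) (auto simp: ln_div algebra_simps)
    finally show ?thesis by (simp add: sum_negf)
  qed
  ultimately show ?thesis using 1 by simp
qed

section \<open>The logarithmic derivative inside a disc\<close>

lemma has_field_derivative_prod_powi:
  assumes "finite A" "\<And>a. a \<in> A \<Longrightarrow> (f a has_field_derivative f a z * d a) (at z)"
    "\<And>a. a \<in> A \<Longrightarrow> f a z \<noteq> (0::complex)"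
  shows "((\<lambda>z. \<Prod>a\<in>A. f a z powi n a) has_field_derivative
     (\<Prod>a\<in>A. f a z powi n a) * (\<Sum>a\<in>A. of_int (n a) * d a)) (at z)"
  using assms
proof (induction A rule: finite_induct)
  case (insert a A)
  have "((\<lambda>z. f a z powi n a) has_field_derivative f a z powi n a * (of_int (n a) * d a)) (at z)"
    using insert.prems(1)[of a] insert.prems(2)[of a]
    by (auto intro!: derivative_eq_intros simp: power_int_diff)
  moreover have "((\<lambda>z. \<Prod>a\<in>A. f a z powi n a) has_field_derivative
     (\<Prod>a\<in>A. f a z powi n a) * (\<Sum>a\<in>A. of_int (n a) * d a)) (at z)"
    by (rule insert.IH) (use insert.prems in auto)
  ultimately have "((\<lambda>z. f a z powi n a * (\<Prod>a\<in>A. f a z powi n a)) has_field_derivative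
      f a z powi n a * ((\<Prod>a\<in>A. f a z powi n a) * (\<Sum>a\<in>A. of_int (n a) * d a)) +
      f a z powi n a * (of_int (n a) * d a) * (\<Prod>a\<in>A. f a z powi n a)) (at z)"
    by (rule DERIV_mult')
  thus ?case using insert.hyps
    by (simp add: algebra_simps)
qed simp

text \<open>A differentiated Poisson-Jensen formula: the Blaschke factors contribute the sum, and
  what remains is \<open>deriv L\<close>, which is controlled by the mean of
  \<open>\<bar>Re L\<bar>\<close>, that is, of \<open>\<bar>ln (cmod (g z))\<bar>\<close> on the
  circle.\<close>

theorem log_deriv_bound:
  assumes g: "mero_nz g" and regular: "regular g s"
    and z: "cmod z < s" "g analytic_on {z}" "g z \<noteq> 0"
  shows "cmod (deriv g z / g z - (\<Sum>a | cmod a \<le> s \<and> zorder g a \<noteq> 0.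
           of_int (zorder g a) * (1 / (z - a) + cnj a / (complex_of_real (s\<^sup>2) - cnj a * z))))
         \<le> 2 * s / (s - cmod z)\<^sup>2 * circle_mean (\<lambda>z. \<bar>ln (cmod (g z))\<bar>) s"
proof -
  define A where "A = {a. cmod a \<le> s \<and> zorder g a \<noteq> 0}"
  have fin: "finite A" using finite_zorder_nz[OF g] by (simp add: A_def)
  have A: "cmod a < s" if "a \<in> A" for a
    using that regular_zorder[OF regular] by (force simp: A_def)
  have s: "0 < s" using regular by (rule regular_pos)
  obtain R L where *: "s < R \<and> L holomorphic_on ball 0 R \<and>
    (\<forall>z. cmod z \<le> s \<longrightarrow> g analytic_on {z} \<longrightarrow> g z \<noteq> 0 \<longrightarrow>
       g z = exp (L z) * (\<Prod>a\<in>A. blaschke s a z powi zorder g a)) \<and>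
    (\<forall>z\<in>sphere 0 s. ln (cmod (g z)) = Re (L z))"
    using mero_nz_factorization[OF g regular, folded A_def] by (elim exE)
  note RL = conjunct1[OF *] conjunct1[OF conjunct2[OF *]]
  have eq: "g z = exp (L z) * (\<Prod>a\<in>A. blaschke s a z powi zorder g a)"
    if "cmod z \<le> s" "g analytic_on {z}" "g z \<noteq> 0" for z
    using conjunct1[OF conjunct2[OF conjunct2[OF *]]] that by (elim allE impE) assumption+
  have lnL: "ln (cmod (g z)) = Re (L z)" if "z \<in> sphere 0 s" for z
    using conjunct2[OF conjunct2[OF conjunct2[OF *]]] that by (rule bspec)
  hence cm: "circle_mean (\<lambda>z. \<bar>ln (cmod (g z))\<bar>) s = circle_mean (\<lambda>z. \<bar>Re (L z)\<bar>) s"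
    using s by (intro circle_mean_cong) auto
  define d where "d a = 1 / (z - a) + cnj a / (complex_of_real (s\<^sup>2) - cnj a * z)" for a
  have zA: "z \<noteq> a" if "a \<in> A" for a
    using that zorder_eq_0I[OF z(2,3)] by (auto simp: A_def)
  have "((\<lambda>z. \<Prod>a\<in>A. blaschke s a z powi zorder g a) has_field_derivative
     (\<Prod>a\<in>A. blaschke s a z powi zorder g a) * (\<Sum>a\<in>A. of_int (zorder g a) * d a)) (at z)"
  proof (rule has_field_derivative_prod_powi[OF fin])
    fix a assume a: "a \<in> A"
    show "(blaschke s a has_field_derivative blaschke s a z * d a) (at z)"
      unfolding d_def by (rule blaschke_deriv[OF A[OF a] less_imp_le[OF z(1)] zA[OF a]])
    show "blaschke s a z \<noteq> 0"
      using A[OF a] zA[OF a] z by (simp add: blaschke_eq_0_iff)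
  qed
  moreover have "(L has_field_derivative deriv L z) (at z)"
    using RL z by (intro holomorphic_derivI[OF RL(2)]) auto
  ultimately have D: "((\<lambda>z. exp (L z) * (\<Prod>a\<in>A. blaschke s a z powi zorder g a)) has_field_derivative
     g z * (deriv L z + (\<Sum>a\<in>A. of_int (zorder g a) * d a))) (at z)"
    unfolding eq[OF less_imp_le[OF z(1)] z(2,3)]
    by (auto intro!: derivative_eq_intros simp: algebra_simps)
  \<comment> \<open>Differentiating needs the factorization near \<open>z\<close> and not only at
    \<open>z\<close>; the points of analyticity that are not zeros form an open set.\<close>
  have "eventually (\<lambda>w. w \<in> {w. g analytic_on {w} \<and> g w \<noteq> 0} \<inter> ball 0 s) (nhds z)"
    using z by (intro eventually_nhds_in_open open_Int open_analytic_nonzero) auto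
  hence ev: "eventually (\<lambda>w. exp (L w) * (\<Prod>a\<in>A. blaschke s a w powi zorder g a) = g w) (nhds z)"
    by eventually_elim (use eq in force)
  have "(g has_field_derivative g z * (deriv L z + (\<Sum>a\<in>A. of_int (zorder g a) * d a))) (at z)"
    by (rule iffD1[OF DERIV_cong_ev[OF refl ev refl] D])
  hence "deriv g z / g z - (\<Sum>a\<in>A. of_int (zorder g a) * d a) = deriv L z"
    using z by (simp add: DERIV_imp_deriv)
  thus ?thesis
    using norm_deriv_le_circle_mean_Re[OF RL(2) s RL(1) z(1)] unfolding A_def d_def cm by simp
qed

section \<open>The first main theorem\<close>

lemma prox_mult:
  assumes "continuous_on (sphere 0 r) u" "continuous_on (sphere 0 r) v" "0 \<le> r"
  shows "prox (\<lambda>z. u z * v z) r \<le> prox u r + prox v r"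
proof -
  have "circle_mean (\<lambda>z. logplus (cmod (u z * v z))) r \<le>
        circle_mean (\<lambda>z. logplus (cmod (u z)) + logplus (cmod (v z))) r"
    by (intro circle_mean_mono continuous_intros assms) (simp add: norm_mult logplus_mult)
  also have "\<dots> = prox u r + prox v r"
    unfolding prox_eq_circle_mean by (intro circle_mean_add continuous_intros assms)
  finally show ?thesis by (simp add: prox_eq_circle_mean)
qed

lemma prox_add:
  assumes "continuous_on (sphere 0 r) u" "continuous_on (sphere 0 r) v" "0 \<le> r"
  shows "prox (\<lambda>z. u z + v z) r \<le> prox u r + prox v r + ln 2"
proof -
  have "circle_mean (\<lambda>z. logplus (cmod (u z + v z))) r \<le>
        circle_mean (\<lambda>z. (logplus (cmod (u z)) + logplus (cmod (v z))) + ln 2) r"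
  proof (intro circle_mean_mono continuous_intros assms)
    fix z
    have "logplus (cmod (u z + v z)) \<le> logplus (cmod (u z) + cmod (v z))"
      by (intro logplus_mono norm_triangle_ineq)
    also have "\<dots> \<le> logplus (cmod (u z)) + logplus (cmod (v z)) + ln 2"
      by (intro logplus_add) auto
    finally show "logplus (cmod (u z + v z)) \<le> logplus (cmod (u z)) + logplus (cmod (v z)) + ln 2" .
  qed
  also have "\<dots> = circle_mean (\<lambda>z. logplus (cmod (u z)) + logplus (cmod (v z))) r + circle_mean (\<lambda>z. ln 2) r"
    by (intro circle_mean_add continuous_intros assms)
  also have "circle_mean (\<lambda>z. logplus (cmod (u z)) + logplus (cmod (v z))) r = prox u r + prox v r"
    unfolding prox_eq_circle_mean by (intro circle_mean_add continuous_intros assms)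
  finally show ?thesis by (simp add: prox_eq_circle_mean)
qed

lemma prox_power: "prox (\<lambda>z. u z ^ n) r = real n * prox u r"
  unfolding prox_eq_circle_mean by (simp add: norm_power logplus_power circle_mean_cmult)

lemma prox_cong:
  assumes "\<And>z. z \<in> sphere 0 r \<Longrightarrow> u z = v z" "0 \<le> r"
  shows "prox u r = prox v r"
  unfolding prox_eq_circle_mean using assms by (intro circle_mean_cong) auto

text \<open>Jensen's formula with the logarithm split into its positive and negative parts. For
  \<open>H\<close>, whose own proximity function is an error term, it trades that of
  \<open>1 / H\<close> for minus the counting function of the divisor.\<close>

lemma prox_sub_prox_inverse:
  assumes "mero_nz g" "regular g r"
  shows "prox g r - prox (\<lambda>z. inverse (g z)) r =
    divisor_N (\<lambda>a. real_of_int (zorder g a)) r + ln (cmod (zor_poly g 0 0))"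
proof -
  have r: "0 \<le> r" using regular_pos[OF assms(2)] by simp
  have "prox g r - prox (\<lambda>z. inverse (g z)) r =
        circle_mean (\<lambda>z. logplus (cmod (g z)) - logplus (cmod (inverse (g z)))) r"
    unfolding prox_eq_circle_mean using regular_nonzero[OF assms(2)]
    by (intro circle_mean_diff[symmetric] continuous_intros regular_continuous_on[OF assms(2)] r) auto
  also have "\<dots> = circle_mean (\<lambda>z. ln (cmod (g z))) r"
    using r regular_nonzero[OF assms(2)] by (intro circle_mean_cong) (auto simp: ln_eq_logplus_diff norm_inverse)
  finally show ?thesis using jensen_formula[OF assms] by simp
qed

lemma nev_T_eq: "mero_nz g \<Longrightarrow> 0 < r \<Longrightarrow> nev_T g r = prox g r + divisor_N (pole_mult g) r"
  by (simp add: nev_T_def pole_N_eq_divisor_N)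

lemma divisor_N_zorder:
  "mero_nz g \<Longrightarrow> divisor_N (\<lambda>a. real_of_int (zorder g a)) r = divisor_N (zero_mult g) r - divisor_N (pole_mult g) r"
  by (simp add: zero_mult_minus_pole_mult[symmetric] divisor_N_diff)

text \<open>An exact equality: the bounded term is kept explicit as the logarithm of the leading
  Laurent coefficient at the origin.\<close>

theorem first_main_theorem:
  assumes "mero_nz g" "regular g r"
  shows "nev_T g r =
    prox (\<lambda>z. inverse (g z)) r + divisor_N (zero_mult g) r + ln (cmod (zor_poly g 0 0))"
  using prox_sub_prox_inverse[OF assms] regular_pos[OF assms(2)]
  by (simp add: nev_T_eq assms divisor_N_zorder)

lemma prox_nonneg_regular: "regular g r \<Longrightarrow> 0 \<le> prox g r"
  by (intro prox_nonneg regular_continuous_on) (auto dest: regular_pos)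

lemma nev_T_nonneg: "mero_nz g \<Longrightarrow> regular g r \<Longrightarrow> 1 \<le> r \<Longrightarrow> 0 \<le> nev_T g r"
  by (simp add: nev_T_eq prox_nonneg_regular divisor_N_nonneg)

lemma circle_mean_abs_ln:
  assumes "regular g r"
  shows "circle_mean (\<lambda>z. \<bar>ln (cmod (g z))\<bar>) r = prox g r + prox (\<lambda>z. inverse (g z)) r"
proof -
  have r: "0 \<le> r" using regular_pos[OF assms] by simp
  have "prox g r + prox (\<lambda>z. inverse (g z)) r =
        circle_mean (\<lambda>z. logplus (cmod (g z)) + logplus (cmod (inverse (g z)))) r"
    unfolding prox_eq_circle_mean using regular_nonzero[OF assms]
    by (intro circle_mean_add[symmetric] continuous_intros regular_continuous_on[OF assms] r) auto
  also have "\<dots> = circle_mean (\<lambda>z. \<bar>ln (cmod (g z))\<bar>) r"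
    using r regular_nonzero[OF assms] by (intro circle_mean_cong) (auto simp: abs_ln_eq_logplus_sum norm_inverse)
  finally show ?thesis by simp
qed

section \<open>The lemma on the logarithmic derivative\<close>

lemma abs_sin_ge_half:
  fixes y :: real
  assumes "\<bar>y\<bar> \<le> pi / 2"
  shows "\<bar>y\<bar> / 2 \<le> \<bar>sin y\<bar>"
proof -
  have "\<bar>y / 2\<bar> = \<bar>y\<bar> / 2" by simp
  with assms pi_gt_zero have "\<bar>y / 2\<bar> < pi / 2" by linarith
  hence c: "cos (y / 2) > 0" by (intro cos_gt_zero_pi) auto
  have "0 \<le> cos y" using assms by (intro cos_ge_zero) auto
  hence c2: "1 \<le> 2 * (cos (y / 2))\<^sup>2" using cos_double_cos[of "y / 2"] by simp
  have "\<bar>y / 2\<bar> \<le> \<bar>tan (y / 2)\<bar>" by (rule abs_tan_ge) fact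
  \<comment> \<open>The idea is \<open>sin y = 2 * tan (y / 2) * (cos (y / 2))^2\<close>: the
    tangent is at least its argument in absolute value, and twice the squared cosine is at least 1
    since \<open>cos y\<close> is nonnegative.\<close>
  hence "\<bar>y\<bar> * 1 \<le> 2 * \<bar>tan (y / 2)\<bar> * (2 * (cos (y / 2))\<^sup>2)"
    using c2 by (intro mult_mono) auto
  also have "\<dots> = 2 * (2 * \<bar>sin (y / 2)\<bar> * cos (y / 2))"
    using c by (simp add: tan_def abs_divide power2_eq_square)
  also have "2 * \<bar>sin (y / 2)\<bar> * cos (y / 2) = \<bar>sin y\<bar>"
    using sin_double[of "y / 2"] c by (simp add: abs_mult)
  finally show ?thesis by simp
qed

lemma abs_sin_ge_nearest:
  fixes x :: real
  assumes "\<bar>x - of_int j * pi\<bar> \<le> pi / 2"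
  shows "\<bar>x - of_int j * pi\<bar> / 2 \<le> \<bar>sin x\<bar>"
proof -
  have s0: "sin (of_int j * pi) = 0" by (auto simp: sin_zero_iff_int2)
  hence "(cos (of_int j * pi))\<^sup>2 = 1" using sin_cos_squared_add[of "of_int j * pi"] by simp
  hence "\<bar>cos (of_int j * pi)\<bar> = 1" by (simp add: abs_square_eq_1)
  hence "\<bar>sin (x - of_int j * pi)\<bar> = \<bar>sin x\<bar>" by (simp add: sin_diff s0 abs_mult)
  thus ?thesis using abs_sin_ge_half[OF assms] by simp
qed

text \<open>The real \<open>sqrt\<close> is extended to negative numbers as an odd function. Hence
  \<open>2 * sqrt (x - c)\<close> is a continuous antiderivative on both sides of \<open>c\<close>,
  and no case distinction on the position of \<open>c\<close> is needed.\<close>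

lemma has_integral_inverse_sqrt_dist:
  fixes c :: real
  shows "((\<lambda>t. 1 / sqrt \<bar>t - c\<bar>) has_integral 2 * sqrt (2 * pi - c) - 2 * sqrt (0 - c)) {0..2*pi}"
proof (rule fundamental_theorem_of_calculus_interior_strong[where S = "{c}"])
  show "continuous_on {0..2*pi} (\<lambda>x. 2 * sqrt (x - c))" by (intro continuous_intros)
  fix x assume "x \<in> {0<..<2*pi} - {c}"
  hence "x \<noteq> c" by auto
  have "((\<lambda>x. 2 * sqrt (x - c)) has_real_derivative 1 / sqrt \<bar>x - c\<bar>) (at x)"
  proof (cases "x > c")
    case True
    thus ?thesis by (auto intro!: derivative_eq_intros simp: field_simps)
  next
    case False
    have "(sqrt has_real_derivative - inverse (sqrt (x - c)) / 2) (at (x - c))"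
      using False \<open>x \<noteq> c\<close> by (intro DERIV_real_sqrt_generic) auto
    moreover have "((\<lambda>x. x - c) has_real_derivative 1) (at x)"
      by (auto intro!: derivative_eq_intros)
    ultimately have "((\<lambda>x. sqrt (x - c)) has_real_derivative - inverse (sqrt (x - c)) / 2 * 1) (at x)"
      by (rule DERIV_chain2)
    from DERIV_cmult[OF this, of 2]
    have "((\<lambda>x. 2 * sqrt (x - c)) has_real_derivative - inverse (sqrt (x - c))) (at x)"
      by simp
    moreover have "1 / sqrt \<bar>x - c\<bar> = - inverse (sqrt (x - c))"
      using False real_sqrt_minus[of "x - c"] by (simp add: inverse_eq_divide flip: minus_divide_right)
    ultimately show ?thesis by simp
  qed
  thus "((\<lambda>x. 2 * sqrt (x - c)) has_vector_derivative 1 / sqrt \<bar>x - c\<bar>) (at x)"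
    by (simp add: has_real_derivative_iff_has_vector_derivative)
qed auto

text \<open>The distance from \<open>rcis r \<theta>\<close> to \<open>a\<close> is at least its
  distance to the line through 0 and \<open>a\<close>, which is
  \<open>r * \<bar>sin (\<theta> - Arg a)\<bar>\<close>. Near each zero of this sine the integrand
  is dominated by an integrable inverse square root, so the bound does not depend on how close
  \<open>a\<close> is to the circle.\<close>

lemma circle_mean_sqrt_inverse_dist:
  assumes r: "0 < r" and a: "cmod a \<noteq> r"
  shows "circle_mean (\<lambda>z. sqrt (1 / cmod (z - a))) r \<le> 40 / sqrt r"
proof -
  define \<phi> where "\<phi> = Arg a"
  define c where "c j = \<phi> + of_int j * pi" for j :: int
  \<comment> \<open>\<open>\<theta> - \<phi>\<close> lies between \<open>-pi\<close> and
    \<open>3 * pi\<close>, so these indices include its nearest multiple of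
    \<open>pi\<close>.\<close>
  define J where "J = {-1..3::int}"
  define S where "S = c ` J"
  have \<phi>: "-pi < \<phi>" "\<phi> \<le> pi" unfolding \<phi>_def by (rule mpi_less_Arg, rule Arg_le_pi)
  have aeq: "a = rcis (cmod a) \<phi>" unfolding \<phi>_def by (simp add: rcis_cmod_Arg)
  define u where "u \<theta> = sqrt (1 / cmod (rcis r \<theta> - a))" for \<theta>
  define h where "h \<theta> = sqrt (2 / r) * (\<Sum>j\<in>J. 1 / sqrt \<bar>\<theta> - c j\<bar>)" for \<theta>
  define I where "I = sqrt (2 / r) * (\<Sum>j\<in>J. 2 * sqrt (2 * pi - c j) - 2 * sqrt (0 - c j))"
  have hint: "(h has_integral I) {0..2*pi}"
    unfolding h_def I_def
    by (intro has_integral_mult_right has_integral_sum has_integral_inverse_sqrt_dist) (simp add: J_def)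
  \<comment> \<open>At the points of \<open>S\<close> a summand of \<open>h\<close> is
    \<open>1 / sqrt 0 = 0\<close>, so \<open>h\<close> need not dominate \<open>u\<close> there.
    Changing finitely many values does not affect the integral.\<close>
  have "((\<lambda>\<theta>. if \<theta> \<in> S then u \<theta> else h \<theta>) has_integral I) {0..2*pi}"
    by (rule has_integral_spike_finite[OF _ _ hint, of S]) (auto simp: S_def J_def)
  moreover have "u integrable_on {0..2*pi}"
  proof -
    have "continuous_on (sphere 0 r) (\<lambda>z. sqrt (1 / cmod (z - a)))"
      using a by (intro continuous_intros) auto
    from integrable_on_circle[OF this] r show ?thesis by (simp add: u_def[abs_def])
  qed
  moreover have "u \<theta> \<le> (if \<theta> \<in> S then u \<theta> else h \<theta>)" if th: "\<theta> \<in> {0..2*pi}" for \<theta>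
  proof (cases "\<theta> \<in> S")
    case False
    define x where "x = \<theta> - \<phi>"
    define j where "j = round (x / pi)"
    have "\<bar>of_int j - x / pi\<bar> \<le> 1 / 2" unfolding j_def by (rule of_int_round_abs_le)
    hence "\<bar>of_int j - x / pi\<bar> * pi \<le> 1 / 2 * pi" by (intro mult_right_mono) auto
    moreover have "\<bar>of_int j - x / pi\<bar> * pi = \<bar>(of_int j - x / pi) * pi\<bar>" by (simp add: abs_mult)
    moreover have "(of_int j - x / pi) * pi = of_int j * pi - x" by (simp add: field_simps)
    ultimately have xj: "\<bar>x - of_int j * pi\<bar> \<le> pi / 2" by (simp add: abs_minus_commute)
    have "-pi \<le> x" "x < 3 * pi" using th \<phi> unfolding x_def by auto
    hence "real_of_int j * pi \<le> 3.5 * pi" "-1.5 * pi \<le> real_of_int j * pi"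
      using xj unfolding abs_le_iff by linarith+
    hence "real_of_int j \<le> 3.5" "-1.5 \<le> real_of_int j"
      using mult_right_le_imp_le[OF _ pi_gt_zero] by blast+
    hence j: "j \<in> J" unfolding J_def atLeastAtMost_iff by linarith
    have d: "\<bar>\<theta> - c j\<bar> = \<bar>x - of_int j * pi\<bar>" by (simp add: x_def c_def algebra_simps)
    have dpos: "0 < \<bar>\<theta> - c j\<bar>" using False j by (auto simp: S_def)
    have "(rcis r \<theta> - a) * cis (-\<phi>) = rcis r (\<theta> - \<phi>) - of_real (cmod a)"
    proof -
      have "cis \<theta> * cis (-\<phi>) = cis (\<theta> - \<phi>)" "cis \<phi> * cis (-\<phi>) = 1"
        by (simp_all add: cis_mult)
      thus ?thesis
        by (subst aeq) (simp only: rcis_def left_diff_distrib mult.assoc mult_1_right)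
    qed
    hence "Im ((rcis r \<theta> - a) * cis (-\<phi>)) = r * sin x" by (simp add: x_def)
    hence "r * \<bar>sin x\<bar> \<le> cmod ((rcis r \<theta> - a) * cis (-\<phi>))"
      using abs_Im_le_cmod[of "(rcis r \<theta> - a) * cis (-\<phi>)"] r by (simp add: abs_mult)
    hence "r * \<bar>sin x\<bar> \<le> cmod (rcis r \<theta> - a)" by (simp add: norm_mult)
    moreover have "r * (\<bar>\<theta> - c j\<bar> / 2) \<le> r * \<bar>sin x\<bar>"
      unfolding d using r by (intro mult_left_mono abs_sin_ge_nearest xj) auto
    ultimately have "r * (\<bar>\<theta> - c j\<bar> / 2) \<le> cmod (rcis r \<theta> - a)" by linarith
    moreover have "0 < r * (\<bar>\<theta> - c j\<bar> / 2)" using r dpos by simp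
    ultimately have "1 / cmod (rcis r \<theta> - a) \<le> 1 / (r * (\<bar>\<theta> - c j\<bar> / 2))"
      by (intro frac_le) auto
    hence "u \<theta> \<le> sqrt (1 / (r * (\<bar>\<theta> - c j\<bar> / 2)))" unfolding u_def by (rule real_sqrt_le_mono)
    also have "1 / (r * (\<bar>\<theta> - c j\<bar> / 2)) = (2 / r) * (1 / \<bar>\<theta> - c j\<bar>)" by simp
    also have "sqrt \<dots> = sqrt (2 / r) * (1 / sqrt \<bar>\<theta> - c j\<bar>)"
      by (simp add: real_sqrt_mult real_sqrt_divide)
    also have "1 / sqrt \<bar>\<theta> - c j\<bar> \<le> (\<Sum>j\<in>J. 1 / sqrt \<bar>\<theta> - c j\<bar>)"
      using j by (intro member_le_sum) (auto simp: J_def)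
    finally have "u \<theta> \<le> h \<theta>" using r by (simp add: h_def mult_left_mono)
    thus ?thesis using False by simp
  qed simp
  ultimately have "integral {0..2*pi} u \<le> I"
    by (intro has_integral_le[OF integrable_integral]) auto
  \<comment> \<open>All arguments of the roots are at most \<open>4 * pi < 16\<close> in absolute
    value, so each summand is at most \<open>2 * 4 + 2 * 4\<close>. The five summands give 80, and
    \<open>sqrt 2 * 80 / (2 * pi)\<close> is below 40.\<close>
  also have "I \<le> sqrt (2 / r) * (\<Sum>j\<in>J. 16)"
    unfolding I_def
  proof (intro mult_left_mono sum_mono)
    fix j assume j: "j \<in> J"
    have le4: "\<bar>sqrt y\<bar> \<le> 4" if "\<bar>y\<bar> \<le> 4 * pi" for y
    proof -
      have "4 * pi \<le> 16" using pi_less_4 by simp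
      hence "sqrt \<bar>y\<bar> \<le> sqrt 16" using that by (intro real_sqrt_le_mono) simp
      moreover have "sqrt 16 = (4 :: real)" by (rule real_sqrt_unique) auto
      moreover have "\<bar>sqrt y\<bar> = sqrt \<bar>y\<bar>" by (auto simp: abs_if real_sqrt_minus)
      ultimately show ?thesis by simp
    qed
    have "(-1 :: real) \<le> of_int j" "of_int j \<le> (3 :: real)" using j by (auto simp: J_def)
    hence "(-1) * pi \<le> of_int j * pi" "of_int j * pi \<le> 3 * pi" by (intro mult_right_mono; simp)+
    hence "\<bar>2 * pi - c j\<bar> \<le> 4 * pi" "\<bar>0 - c j\<bar> \<le> 4 * pi" 
      using \<phi> pi_gt_zero unfolding c_def abs_le_iff by linarith+
    from this[THEN le4] show "2 * sqrt (2 * pi - c j) - 2 * sqrt (0 - c j) \<le> 16" by linarith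
  qed (use r in auto)
  also have "\<dots> = sqrt 2 * 80 / sqrt r" by (simp add: J_def real_sqrt_divide)
  finally have "circle_mean (\<lambda>z. sqrt (1 / cmod (z - a))) r \<le> sqrt 2 * 80 / sqrt r / (2 * pi)"
    unfolding circle_mean_def u_def[abs_def] by (intro divide_right_mono) auto
  also have "\<dots> = (sqrt 2 / pi) * (40 / sqrt r)" by simp
  also have "\<dots> \<le> 1 * (40 / sqrt r)"
    using sqrt2_less_2 pi_gt3 r by (intro mult_right_mono) auto
  finally show ?thesis by simp
qed

text \<open>Concavity of the logarithm, via its tangent at the mean value.\<close>
lemma circle_mean_ln_one_plus_le:
  assumes "continuous_on (sphere 0 r) v" "0 \<le> r" "\<And>z. z \<in> sphere 0 r \<Longrightarrow> 0 \<le> v z"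
  shows "circle_mean (\<lambda>z. ln (1 + v z)) r \<le> ln (1 + circle_mean v r)"
proof -
  define m where "m = circle_mean v r"
  have m: "0 \<le> m" unfolding m_def by (intro circle_mean_nonneg assms)
  have nz: "1 + v z \<noteq> 0" if "z \<in> sphere 0 r" for z using assms(3)[OF that] by linarith
  have "circle_mean (\<lambda>z. ln (1 + v z)) r \<le> circle_mean (\<lambda>z. (ln (1 + m) - m / (1 + m)) + 1 / (1 + m) * v z) r"
  proof (intro circle_mean_mono continuous_intros assms)
    fix z :: complex assume "z \<in> sphere 0 r"
    hence "ln (1 + v z) - ln (1 + m) \<le> (1 + v z - (1 + m)) / (1 + m)"
      using assms(3) m by (intro ln_diff_le) (auto simp: add_pos_nonneg)
    thus "ln (1 + v z) \<le> (ln (1 + m) - m / (1 + m)) + 1 / (1 + m) * v z"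
      by (simp add: diff_divide_distrib)
  qed (use nz in auto)
  also have "\<dots> = (ln (1 + m) - m / (1 + m)) + 1 / (1 + m) * m"
  proof (subst circle_mean_add)
    show "circle_mean (\<lambda>z. ln (1 + m) - m / (1 + m)) r + circle_mean (\<lambda>z. 1 / (1 + m) * v z) r =
        ln (1 + m) - m / (1 + m) + 1 / (1 + m) * m"
      unfolding circle_mean_cmult[of "1 / (1 + m)"] by (simp add: m_def)
  qed (use m in \<open>auto intro!: continuous_intros assms\<close>)
  finally show ?thesis by (simp add: m_def)
qed

lemma sqrt_sum_le:
  assumes "finite A" "\<And>a. a \<in> A \<Longrightarrow> 0 \<le> x a"
  shows "sqrt (\<Sum>a\<in>A. x a) \<le> (\<Sum>a\<in>A. sqrt (x a))"
  using assms
proof (induction A rule: finite_induct)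
  case (insert a A)
  have "sqrt (x a + (\<Sum>a\<in>A. x a)) \<le> sqrt (x a) + sqrt (\<Sum>a\<in>A. x a)"
    using insert by (intro sqrt_add_le_add_sqrt sum_nonneg) auto
  thus ?case using insert by (auto intro: order_trans)
qed simp

lemma regular_continuous_on_log_deriv:
  assumes "regular g r"
  shows "continuous_on (sphere 0 r) (\<lambda>z. deriv g z / g z)"
proof (rule continuous_at_imp_continuous_on, rule ballI)
  fix z :: complex assume "z \<in> sphere 0 r"
  hence "(\<lambda>z. deriv g z / g z) analytic_on {z}"
    using assms by (auto simp: regular_def intro!: analytic_intros)
  thus "isCont (\<lambda>z. deriv g z / g z) z" by (rule analytic_at_imp_isCont)
qed

text \<open>
  Taking square roots before averaging keeps the poles of the logarithmic derivative integrable
  uniformly in their distance to the circle.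
\<close>
lemma prox_log_deriv_le:
  assumes g: "mero_nz g" and gr: "regular g r" and gs: "regular g s" and rs: "r < s"
  defines "n \<equiv> (\<Sum>a | cmod a \<le> s \<and> pole_mult g a + zero_mult g a \<noteq> 0. pole_mult g a + zero_mult g a)"
  defines "M \<equiv> prox g s + prox (\<lambda>z. inverse (g z)) s"
  shows "prox (\<lambda>z. deriv g z / g z) r \<le>
    2 * ln (1 + (sqrt (2 * s * M) / (s - r) + n * (40 / sqrt r + 1 / sqrt (s - r))))"
proof -
  define A where "A = {a. cmod a \<le> s \<and> zorder g a \<noteq> 0}"
  have fin: "finite A" using finite_zorder_nz[OF g] by (simp add: A_def)
  have A: "cmod a < s" "cmod a \<noteq> r" if "a \<in> A" for a
    using that regular_zorder[OF gs] regular_zorder[OF gr] by (force simp: A_def)+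
  have r: "0 < r" and s: "0 < s" using gr gs by (auto dest: regular_pos)
  have M: "0 \<le> M" unfolding M_def using prox_nonneg_regular[OF gs] prox_nonneg_regular[OF regular_inverse[OF gs]] by simp
  define k where "k a = \<bar>real_of_int (zorder g a)\<bar>" for a
  have k: "pole_mult g a + zero_mult g a = k a" for a by (simp add: pole_mult_def zero_mult_def k_def)
  have n: "n = (\<Sum>a\<in>A. k a)" unfolding n_def k by (simp add: A_def k_def)
  define B where "B = 2 * s / (s - r)\<^sup>2 * M"
  define Q where "Q z = deriv g z / g z" for z
  define v where "v z = sqrt (cmod (Q z))" for z
  define w where "w z = sqrt B + (\<Sum>a\<in>A. k a * (sqrt (1 / cmod (z - a)) + sqrt (1 / (s - r))))" for z
  have B: "0 \<le> B" unfolding B_def using M s by simp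
  have contQ: "continuous_on (sphere 0 r) Q"
    unfolding Q_def[abs_def] by (rule regular_continuous_on_log_deriv[OF gr])
  have contw: "continuous_on (sphere 0 r) w"
    unfolding w_def[abs_def] using A(2) by (intro continuous_intros) auto
  have contv: "continuous_on (sphere 0 r) v"
    unfolding v_def[abs_def] by (intro continuous_intros contQ)
  have vw: "v z \<le> w z" if z: "z \<in> sphere 0 r" for z
  proof -
    have cz: "cmod z = r" using z by simp
    define d where "d a = 1 / (z - a) + cnj a / (complex_of_real (s\<^sup>2) - cnj a * z)" for a
    have "cmod (Q z - (\<Sum>a\<in>A. of_int (zorder g a) * d a)) \<le> B"
      using log_deriv_bound[OF g gs, of z] gr z rs unfolding A_def d_def B_def Q_def M_def circle_mean_abs_ln[OF gs]
      by (simp add: regular_def)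
    hence "cmod (Q z) \<le> B + cmod (\<Sum>a\<in>A. of_int (zorder g a) * d a)"
      using norm_triangle_sub[of "Q z" "\<Sum>a\<in>A. of_int (zorder g a) * d a"] by linarith
    also have "cmod (\<Sum>a\<in>A. of_int (zorder g a) * d a) \<le> (\<Sum>a\<in>A. k a * (1 / cmod (z - a) + 1 / (s - r)))"
    proof (rule order_trans[OF norm_sum], rule sum_mono)
      fix a assume a: "a \<in> A"
      have "cmod (cnj a / (complex_of_real (s\<^sup>2) - cnj a * z)) \<le> 1 / (s - r)"
      proof -
        \<comment> \<open>The reflected points stay away from the inner circle: the denominator is
          at least \<open>s * (s - r)\<close>, uniformly in \<open>a\<close>.\<close>
        have "s * (s - r) \<le> s\<^sup>2 - cmod a * r"
          using A(1)[OF a] r by (simp add: power2_eq_square algebra_simps mult_right_mono)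
        also have "\<dots> = cmod (complex_of_real (s\<^sup>2)) - cmod (cnj a * z)"
          by (simp add: norm_mult norm_power cz)
        also have "\<dots> \<le> cmod (complex_of_real (s\<^sup>2) - cnj a * z)" by (rule norm_triangle_ineq2)
        finally have le: "s * (s - r) \<le> cmod (complex_of_real (s\<^sup>2) - cnj a * z)" .
        have pos: "0 < s * (s - r)" using s rs by simp
        have "cmod (cnj a / (complex_of_real (s\<^sup>2) - cnj a * z)) \<le> s / (s * (s - r))"
          unfolding norm_divide using A(1)[OF a] le pos s by (intro frac_le) auto
        thus ?thesis using s by simp
      qed
      hence "cmod (d a) \<le> 1 / cmod (z - a) + 1 / (s - r)"
        unfolding d_def by (intro order_trans[OF norm_triangle_ineq]) (simp add: norm_divide)
      thus "cmod (of_int (zorder g a) * d a) \<le> k a * (1 / cmod (z - a) + 1 / (s - r))"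
        unfolding norm_mult k_def by (intro mult_mono) auto
    qed
    finally have "v z \<le> sqrt (B + (\<Sum>a\<in>A. k a * (1 / cmod (z - a) + 1 / (s - r))))"
      unfolding v_def by (simp add: real_sqrt_le_mono)
    also have "\<dots> \<le> sqrt B + sqrt (\<Sum>a\<in>A. k a * (1 / cmod (z - a) + 1 / (s - r)))"
      using B rs by (intro sqrt_add_le_add_sqrt sum_nonneg) (auto simp: k_def)
    also have "sqrt (\<Sum>a\<in>A. k a * (1 / cmod (z - a) + 1 / (s - r))) \<le>
        (\<Sum>a\<in>A. sqrt (k a * (1 / cmod (z - a) + 1 / (s - r))))"
      using fin rs by (intro sqrt_sum_le) (auto simp: k_def)
    also have "\<dots> \<le> (\<Sum>a\<in>A. k a * (sqrt (1 / cmod (z - a)) + sqrt (1 / (s - r))))"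
    proof (rule sum_mono)
      fix a assume a: "a \<in> A"
      \<comment> \<open>The multiplicity is a positive integer, hence at least its own square root,
        so it can be taken out of the root.\<close>
      have "1 \<le> \<bar>zorder g a\<bar>" using a by (auto simp: A_def)
      hence k1: "1 \<le> k a" unfolding k_def by linarith
      have "k a \<le> k a * k a" using mult_left_mono[OF k1, of "k a"] k1 by simp
      hence "sqrt (k a) \<le> sqrt (k a * k a)" by (rule real_sqrt_le_mono)
      hence "sqrt (k a) \<le> k a" using k1 by simp
      moreover have "sqrt (1 / cmod (z - a) + 1 / (s - r)) \<le> sqrt (1 / cmod (z - a)) + sqrt (1 / (s - r))"
        using rs by (intro sqrt_add_le_add_sqrt) auto
      ultimately show "sqrt (k a * (1 / cmod (z - a) + 1 / (s - r))) \<le>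
          k a * (sqrt (1 / cmod (z - a)) + sqrt (1 / (s - r)))"
        unfolding real_sqrt_mult using rs k1 by (intro mult_mono) auto
    qed
    finally show ?thesis unfolding w_def by simp
  qed
  \<comment> \<open>\<open>v\<close> is the square root of \<open>cmod Q\<close>, so the logarithm
    doubles; concavity of the logarithm then moves the mean inside.\<close>
  have "prox Q r \<le> circle_mean (\<lambda>z. 2 * ln (1 + v z)) r"
    unfolding prox_eq_circle_mean
  proof (intro circle_mean_mono continuous_intros contQ contv)
    fix z :: complex assume "z \<in> sphere 0 r"
    have v0: "0 \<le> v z" by (simp add: v_def)
    have "logplus (cmod (Q z)) = logplus (v z ^ 2)" by (simp add: v_def)
    also have "\<dots> = 2 * logplus (v z)" using v0 by (subst logplus_power) auto
    also have "logplus (v z) \<le> ln (1 + v z)" using v0 by (simp add: logplus_eq)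
    finally show "logplus (cmod (Q z)) \<le> 2 * ln (1 + v z)" by simp
  qed (use r in \<open>auto simp: v_def add_nonneg_eq_0_iff\<close>)
  also have "\<dots> \<le> 2 * ln (1 + circle_mean v r)"
    unfolding circle_mean_cmult using r by (intro mult_left_mono circle_mean_ln_one_plus_le contv) (auto simp: v_def)
  also have "\<dots> \<le> 2 * ln (1 + (sqrt (2 * s * M) / (s - r) + n * (40 / sqrt r + 1 / sqrt (s - r))))"
  proof -
    have "circle_mean v r \<le> circle_mean w r" using r by (intro circle_mean_mono contv contw vw) auto
    also have "\<dots> = sqrt B + circle_mean (\<lambda>z. \<Sum>a\<in>A. k a * (sqrt (1 / cmod (z - a)) + sqrt (1 / (s - r)))) r"
      unfolding w_def[abs_def] using A(2) r by (subst circle_mean_add) (auto intro!: continuous_intros)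
    also have "circle_mean (\<lambda>z. \<Sum>a\<in>A. k a * (sqrt (1 / cmod (z - a)) + sqrt (1 / (s - r)))) r =
        (\<Sum>a\<in>A. circle_mean (\<lambda>z. k a * (sqrt (1 / cmod (z - a)) + sqrt (1 / (s - r)))) r)"
      using A(2) r fin by (intro circle_mean_sum) (auto intro!: continuous_intros)
    also have "\<dots> \<le> (\<Sum>a\<in>A. k a * (40 / sqrt r + 1 / sqrt (s - r)))"
    proof (rule sum_mono)
      fix a assume a: "a \<in> A"
      have "circle_mean (\<lambda>z. k a * (sqrt (1 / cmod (z - a)) + sqrt (1 / (s - r)))) r =
          k a * (circle_mean (\<lambda>z. sqrt (1 / cmod (z - a))) r + sqrt (1 / (s - r)))"
        unfolding circle_mean_cmult using A(2)[OF a] r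
        by (subst circle_mean_add) (auto intro!: continuous_intros)
      also have "\<dots> \<le> k a * (40 / sqrt r + 1 / sqrt (s - r))"
        using circle_mean_sqrt_inverse_dist[OF r A(2)[OF a]]
        by (intro mult_left_mono add_mono) (auto simp: real_sqrt_divide k_def)
      finally show "circle_mean (\<lambda>z. k a * (sqrt (1 / cmod (z - a)) + sqrt (1 / (s - r)))) r \<le>
          k a * (40 / sqrt r + 1 / sqrt (s - r))" .
    qed
    also have "\<dots> = n * (40 / sqrt r + 1 / sqrt (s - r))"
      unfolding n by (rule sum_distrib_right[symmetric])
    also have "sqrt B = sqrt (2 * s * M) / (s - r)"
      unfolding B_def using rs by (simp add: real_sqrt_divide real_sqrt_mult)
    finally have "circle_mean v r \<le> sqrt (2 * s * M) / (s - r) + n * (40 / sqrt r + 1 / sqrt (s - r))"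
      by simp
    moreover have "0 \<le> circle_mean v r" using r by (intro circle_mean_nonneg contv) (auto simp: v_def)
    ultimately show ?thesis by simp
  qed
  finally show ?thesis unfolding Q_def[abs_def] .
qed

section \<open>The estimate in terms of radius, step and characteristic\<close>

lemma exists_avoiding_countable:
  fixes a b :: real
  assumes "countable N" "a < b"
  obtains r where "a < r" "r < b" "r \<notin> N"
proof -
  have "\<not> {a<..<b} \<subseteq> N"
    using assms uncountable_open_interval[of a b] countable_subset by blast
  then obtain r where "r \<in> {a<..<b}" "r \<notin> N" by blast
  thus ?thesis using that[of r] by simp
qed

lemma regular_radius_exists:
  assumes "mero_nz g" "0 \<le> a" "a < b"
  obtains r where "a < r" "r < b" "regular g r"
proof -
  obtain r where r: "a < r" "r < b" "r \<notin> {r. 0 < r \<and> \<not> regular g r}"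
    using exists_avoiding_countable[OF countable_not_regular[OF assms(1)] assms(3)] by blast
  thus ?thesis using that assms(2) by auto
qed

text \<open>\<open>X\<close> is any bound for the characteristic between \<open>r\<close> and
  \<open>r + d\<close>. The estimate therefore holds at every regular radius without an exceptional
  set, and a growth lemma can be postponed. Two further radii are used: \<open>s\<close> for the
  bound on the logarithmic derivative, and \<open>R\<close> to count the zeros and poles up to
  \<open>s\<close>.\<close>

theorem log_deriv_lemma:
  assumes g: "mero_nz g"
  shows "\<exists>C\<ge>0. \<forall>r d X. 1 \<le> r \<longrightarrow> 0 < d \<longrightarrow> d \<le> 1 \<longrightarrow> 1 \<le> X \<longrightarrow> regular g r \<longrightarrow>
    (\<forall>s. r \<le> s \<longrightarrow> s \<le> r + d \<longrightarrow> regular g s \<longrightarrow> nev_T g s \<le> X) \<longrightarrow>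
    prox (\<lambda>z. deriv g z / g z) r \<le> C * (1 + ln X + ln (r + 1) + ln (1 / d))"
proof -
  define c where "c = ln (cmod (zor_poly g 0 0))"
  \<comment> \<open>\<open>177 = 1 + 8 + 168\<close> adds the three terms estimated below as
    multiples of \<open>W\<close>; \<open>2 + \<bar>c\<bar>\<close> pays for the two expressions of
    the characteristic that are added in \<open>both\<close>.\<close>
  define C0 where "C0 = 177 * (2 + \<bar>c\<bar>)"
  have C0: "1 \<le> C0" by (simp add: C0_def)
  show ?thesis
  proof (intro exI[of _ "4 + 2 * ln C0"] conjI allI impI)
    show "0 \<le> 4 + 2 * ln C0" using C0 by (simp add: add_nonneg_nonneg)
    fix r d X :: real
    assume r: "1 \<le> r" and d: "0 < d" "d \<le> 1" and X: "1 \<le> X" and gr: "regular g r"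
      and bound: "\<forall>s. r \<le> s \<longrightarrow> s \<le> r + d \<longrightarrow> regular g s \<longrightarrow> nev_T g s \<le> X"
    \<comment> \<open>This choice and the next leave gaps of at least \<open>d / 4\<close> between
      \<open>r\<close> and \<open>s\<close> and between \<open>s\<close> and \<open>R\<close>, all
      inside the range where \<open>X\<close> is a bound.\<close>
    obtain s where s: "r + d / 4 < s" "s < r + d / 2" "regular g s"
      by (rule regular_radius_exists[OF g, of "r + d / 4" "r + d / 2"]) (use r d in auto)
    obtain R where R: "r + 3 * d / 4 < R" "R < r + d" "regular g R"
      by (rule regular_radius_exists[OF g, of "r + 3 * d / 4" "r + d"]) (use r d in auto)
    define Y where "Y = (2 + \<bar>c\<bar>) * X"
    define n where "n = (\<Sum>a | cmod a \<le> s \<and> pole_mult g a + zero_mult g a \<noteq> 0. pole_mult g a + zero_mult g a)"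
    define M where "M = prox g s + prox (\<lambda>z. inverse (g z)) s"
    have r': "0 < r" using r by simp
    have both: "prox g s + prox (\<lambda>z. inverse (g z)) s + (divisor_N (pole_mult g) s + divisor_N (zero_mult g) s) \<le> Y"
      if "r \<le> s" "s \<le> r + d" "regular g s" for s
    proof -
      have "nev_T g s = prox g s + divisor_N (pole_mult g) s"
        using that r by (intro nev_T_eq g) auto
      moreover have "nev_T g s = prox (\<lambda>z. inverse (g z)) s + divisor_N (zero_mult g) s + c"
        unfolding c_def by (intro first_main_theorem g that)
      moreover have "nev_T g s \<le> X" using bound that by blast
      moreover have "\<bar>c\<bar> * 1 \<le> \<bar>c\<bar> * X" using X by (intro mult_left_mono) auto
      moreover have "Y = 2 * X + \<bar>c\<bar> * X" by (simp add: Y_def algebra_simps)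
      ultimately show ?thesis by linarith
    qed
    have Y: "2 \<le> Y"
    proof -
      have "(2 + \<bar>c\<bar>) * 1 \<le> Y" unfolding Y_def using X by (intro mult_left_mono) auto
      moreover have "2 \<le> (2 + \<bar>c\<bar>) * 1" by simp
      ultimately show ?thesis by (rule order_trans[rotated])
    qed
    have M: "0 \<le> M" "M \<le> Y"
    proof -
      show "0 \<le> M" unfolding M_def
        using prox_nonneg_regular[OF s(3)] prox_nonneg_regular[OF regular_inverse[OF s(3)]] by simp
      have "0 \<le> divisor_N (pole_mult g) s" "0 \<le> divisor_N (zero_mult g) s" using r s d by (auto intro!: divisor_N_nonneg)
      thus "M \<le> Y" using both[of s] s d unfolding M_def by simp
    qed
    have n0: "0 \<le> n" unfolding n_def by (intro sum_nonneg) auto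
    have "n * ln (R / s) \<le> divisor_N (\<lambda>a. pole_mult g a + zero_mult g a) R"
      unfolding n_def using r s R d g
      by (intro sum_le_divisor_N locally_finite_add) auto
    also have "\<dots> = divisor_N (pole_mult g) R + divisor_N (zero_mult g) R" using g by (simp add: divisor_N_add)
    also have "\<dots> \<le> Y"
      using both[of R] R d prox_nonneg_regular[OF R(3)] prox_nonneg_regular[OF regular_inverse[OF R(3)]] by simp
    finally have nY: "n * ln (R / s) \<le> Y" .
    \<comment> \<open>To divide by \<open>ln (R / s)\<close> a lower bound is needed: it is at least
      \<open>1 - s / R\<close>, with \<open>R - s\<close> at least \<open>d / 4\<close> and
      \<open>R\<close> at most \<open>r + 1\<close>.\<close>
    have "d / (4 * (r + 1)) = (d / 4) / (r + 1)" by simp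
    also have "\<dots> \<le> (R - s) / R"
      using r d s R by (intro frac_le) auto
    also have "(R - s) / R = 1 - s / R" using R r d by (simp add: diff_divide_distrib)
    also have "\<dots> \<le> ln (R / s)"
    proof -
      have "ln (s / R) \<le> s / R - 1" using r s R d by (intro ln_le_minus_one) auto
      moreover have "ln (s / R) = - ln (R / s)" using r s R d by (simp add: ln_div)
      ultimately show ?thesis by simp
    qed
    finally have "n * (d / (4 * (r + 1))) \<le> n * ln (R / s)" by (intro mult_left_mono n0)
    hence "n * d / (4 * (r + 1)) \<le> Y" using nY by simp
    hence "n * d \<le> Y * (4 * (r + 1))" using r by (subst (asm) pos_divide_le_eq) auto
    hence n: "n \<le> 4 * (r + 1) * Y / d" using d by (simp add: field_simps)
    define W where "W = (r + 1) * Y / d\<^sup>2"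
    have d1: "1 / d \<le> 1 / d\<^sup>2" using d by (intro frac_le) (auto simp: power2_eq_square mult_left_le)
    have W1: "1 \<le> W"
    proof -
      have "1 * 1 \<le> (r + 1) * Y" using r Y by (intro mult_mono) auto
      moreover have "d\<^sup>2 \<le> 1" using d by (simp add: power_le_one)
      ultimately show ?thesis unfolding W_def using d by (simp add: le_divide_eq)
    qed
    have "prox (\<lambda>z. deriv g z / g z) r \<le>
        2 * ln (1 + (sqrt (2 * s * M) / (s - r) + n * (40 / sqrt r + 1 / sqrt (s - r))))"
      unfolding n_def M_def using d s by (intro prox_log_deriv_le g gr) auto
    also have "\<dots> \<le> 2 * ln (177 * W)"
    proof -
      have s1: "sqrt (2 * s * M) / (s - r) \<le> 8 * W"
      proof -
        have "2 * s * M \<le> 2 * (r + 1) * Y"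
          using M r s d by (intro mult_mono) auto
        moreover have one: "1 \<le> 2 * (r + 1) * Y"
        proof -
          have "1 * 1 \<le> (2 * (r + 1)) * Y" using r Y by (intro mult_mono) auto
          thus ?thesis by simp
        qed
        ultimately have "sqrt (2 * s * M) \<le> sqrt (2 * (r + 1) * Y)" by (intro real_sqrt_le_mono)
        also have "\<dots> \<le> sqrt ((2 * (r + 1) * Y)\<^sup>2)"
          unfolding power2_eq_square
          using mult_left_mono[OF one, of "2 * (r + 1) * Y"] one by (intro real_sqrt_le_mono) linarith
        also have "\<dots> = 2 * (r + 1) * Y" using one by simp
        finally have "sqrt (2 * s * M) / (s - r) \<le> 2 * (r + 1) * Y / (d / 4)"
          using s d M r by (intro frac_le) auto
        also have "\<dots> = 8 * ((r + 1) * Y) * (1 / d)" using d by (simp add: field_simps)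
        also have "\<dots> \<le> 8 * ((r + 1) * Y) * (1 / d\<^sup>2)" using r Y by (intro mult_left_mono d1) auto
        finally show ?thesis by (simp add: W_def)
      qed
      have s2: "n * (40 / sqrt r + 1 / sqrt (s - r)) \<le> 168 * W"
      proof -
        have "1 \<le> sqrt r" using r by simp
        hence "40 / sqrt r \<le> 40 / 1" by (intro frac_le) auto
        also have "40 / 1 \<le> 40 / d" using d by (intro frac_le) auto
        finally have a1: "40 / sqrt r \<le> 40 / d" .
        have "(d / 2)\<^sup>2 \<le> d / 4" using d by (simp add: power2_eq_square)
        hence "(d / 2)\<^sup>2 \<le> s - r" using s by simp
        hence "d / 2 \<le> sqrt (s - r)" by (rule real_le_rsqrt)
        hence "1 / sqrt (s - r) \<le> 1 / (d / 2)" using d by (intro frac_le) auto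
        with a1 have "40 / sqrt r + 1 / sqrt (s - r) \<le> 42 / d" by simp
        hence "n * (40 / sqrt r + 1 / sqrt (s - r)) \<le> (4 * (r + 1) * Y / d) * (42 / d)"
          using n n0 s r d Y by (intro mult_mono) auto
        also have "\<dots> = 168 * W" by (simp add: W_def power2_eq_square)
        finally show ?thesis .
      qed
      have "1 + (sqrt (2 * s * M) / (s - r) + n * (40 / sqrt r + 1 / sqrt (s - r))) \<le> 177 * W"
        using s1 s2 W1 by linarith
      moreover have "0 < 1 + (sqrt (2 * s * M) / (s - r) + n * (40 / sqrt r + 1 / sqrt (s - r)))"
        using n0 s d M r by (intro add_pos_nonneg add_nonneg_nonneg mult_nonneg_nonneg divide_nonneg_nonneg) auto
      ultimately show ?thesis by simp
    qed
    also have "177 * W = C0 * X * (r + 1) * ((1 / d) * (1 / d))"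
      by (simp add: W_def C0_def Y_def power2_eq_square)
    also have "ln \<dots> = ln C0 + ln X + ln (r + 1) + 2 * ln (1 / d)"
      using C0 X r d by (simp add: ln_mult_pos ln_div)
    also have "2 * (ln C0 + ln X + ln (r + 1) + 2 * ln (1 / d)) \<le>
        (4 + 2 * ln C0) * (1 + ln X + ln (r + 1) + ln (1 / d))"
    proof -
      have "0 \<le> ln C0" "0 \<le> ln X" "0 \<le> ln (r + 1)" "0 \<le> ln (1 / d)"
        using C0 X r d by auto
      moreover from this have "0 \<le> ln C0 * (ln X + ln (r + 1) + ln (1 / d))" by simp
      ultimately show ?thesis unfolding distrib_left distrib_right by linarith
    qed
    finally show "prox (\<lambda>z. deriv g z / g z) r \<le> (4 + 2 * ln C0) * (1 + ln X + ln (r + 1) + ln (1 / d))" .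
  qed
qed

section \<open>Monotonicity of the characteristic\<close>

text \<open>On the circle \<open>z * cnj z\<close> is the constant \<open>r^2\<close>, so every
  mixed monomial collapses to a power of \<open>z\<close> or of \<open>cnj z\<close>; under
  \<open>Re\<close> a power of \<open>cnj z\<close> can be traded for one of \<open>z\<close> by
  conjugation.\<close>

lemma Re_poly_mult_cnj_poly_circle:
  fixes p q :: "complex poly"
  shows "\<exists>s. \<forall>z\<in>sphere 0 r. Re (poly p z * cnj (poly q z)) = Re (poly s z)"
proof (induction p arbitrary: q)
  case 0
  show ?case by (intro exI[of _ 0]) simp
next
  case (pCons a p)
  obtain b q' where q: "q = pCons b q'" by (cases q)
  obtain s where s: "\<forall>z\<in>sphere 0 r. Re (poly p z * cnj (poly q' z)) = Re (poly s z)"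
    using pCons.IH by blast
  define t where "t = [:a * cnj b:] + smult (cnj b) (pCons 0 p) + smult (cnj a) (pCons 0 q') + smult (of_real (r\<^sup>2)) s"
  show ?case
  proof (intro exI[of _ t] ballI)
    fix z :: complex assume z: "z \<in> sphere 0 r"
    have zz: "z * cnj z = of_real (r\<^sup>2)" using z by (simp add: complex_norm_square[symmetric])
    have "poly (pCons a p) z * cnj (poly q z) =
        a * cnj b + cnj b * (z * poly p z) + cnj (cnj a * (z * poly q' z)) + (z * cnj z) * (poly p z * cnj (poly q' z))"
      by (simp add: q algebra_simps)
    hence "Re (poly (pCons a p) z * cnj (poly q z)) =
        Re (a * cnj b) + Re (cnj b * (z * poly p z)) + Re (cnj a * (z * poly q' z)) + r\<^sup>2 * Re (poly p z * cnj (poly q' z))"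
      unfolding zz by (simp only: plus_complex.sel complex_cnj(1) Re_complex_of_real Im_complex_of_real times_complex.sel) (simp add: algebra_simps)
    also have "\<dots> = Re (poly t z)"
      using s z by (simp add: t_def) (simp add: algebra_simps)
    finally show "Re (poly (pCons a p) z * cnj (poly q z)) = Re (poly t z)" .
  qed
qed

text \<open>This links Stone-Weierstrass to complex analysis: the approximant of a continuous
  function on the circle becomes the trace of a harmonic function on the whole disc.\<close>

lemma real_polynomial_function_eq_Re_poly_circle:
  assumes "real_polynomial_function v"
  shows "\<exists>p. \<forall>z\<in>sphere 0 r. v z = Re (poly p z)"
  using assms
proof (induction rule: real_polynomial_function.induct)
  case (linear f)
  interpret bounded_linear f by fact
  have "f z = Re (poly [:0, f 1 - \<i> * f \<i>:] z)" for z
  proof -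
    have "f (Re z *\<^sub>R 1 + Im z *\<^sub>R \<i>) = Re z * f 1 + Im z * f \<i>"
      by (simp add: add scaleR)
    moreover have "Re z *\<^sub>R 1 + Im z *\<^sub>R \<i> = z" by (simp add: complex_eq_iff)
    ultimately show ?thesis by simp
  qed
  thus ?case by blast
next
  case (const c)
  show ?case by (intro exI[of _ "[:of_real c:]"]) simp
next
  case (add f g)
  then obtain p q where "\<forall>z\<in>sphere 0 r. f z = Re (poly p z)" "\<forall>z\<in>sphere 0 r. g z = Re (poly q z)"
    by blast
  thus ?case by (intro exI[of _ "p + q"]) simp
next
  case (mult f g)
  then obtain p q where pq: "\<forall>z\<in>sphere 0 r. f z = Re (poly p z)" "\<forall>z\<in>sphere 0 r. g z = Re (poly q z)"
    by blast
  obtain s where s: "\<forall>z\<in>sphere 0 r. Re (poly p z * cnj (poly q z)) = Re (poly s z)"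
    using Re_poly_mult_cnj_poly_circle by blast
  show ?case
  proof (intro exI[of _ "smult (1 / 2) (p * q + s)"] ballI)
    fix z :: complex assume z: "z \<in> sphere 0 r"
    \<comment> \<open>A product of real parts is the mean of the real parts of the product and of
      the product with one factor conjugated.\<close>
    have "f z * g z = (Re (poly p z * poly q z) + Re (poly p z * cnj (poly q z))) / 2"
      using pq z by simp
    also have "Re (poly p z * cnj (poly q z)) = Re (poly s z)"
      using s z by blast
    finally show "f z * g z = Re (poly (smult (1 / 2) (p * q + s)) z)"
      by simp
  qed
qed

text \<open>
  The function \<open>ln (max \<bar>f\<bar> \<bar>h\<bar>)\<close> is dominated on the outer circle by the real part of a polynomial
  close to it, and the maximum principle carries this over to the inner circle.
\<close>
lemma circle_mean_ln_max_mono: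
  assumes q: "q analytic_on cball 0 r" and h: "h analytic_on cball 0 r"
    and sr: "0 < s" "s < r"
    and nz: "\<And>z. z \<in> sphere 0 s \<union> sphere 0 r \<Longrightarrow> h z \<noteq> 0"
  shows "circle_mean (\<lambda>z. ln (max (cmod (q z)) (cmod (h z)))) s \<le> circle_mean (\<lambda>z. ln (max (cmod (q z)) (cmod (h z)))) r"
proof (rule field_le_epsilon)
  fix e :: real assume e: "0 < e"
  define u where "u z = ln (max (cmod (q z)) (cmod (h z)))" for z
  have contq: "continuous_on (cball 0 r) q" and conth: "continuous_on (cball 0 r) h"
    using q h by (simp_all add: analytic_imp_holomorphic holomorphic_on_imp_continuous_on)
  have pos: "0 < max (cmod (q z)) (cmod (h z))" if "z \<in> sphere 0 s \<union> sphere 0 r" for z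
    using nz[OF that] by (simp add: less_max_iff_disj)
  have contu: "continuous_on (sphere 0 t) u" if "t = s \<or> t = r" for t
    unfolding u_def[abs_def]
  proof -
    have "continuous_on (sphere 0 t) q" "continuous_on (sphere 0 t) h"
      using that sr by (auto intro: continuous_on_subset[OF contq] continuous_on_subset[OF conth])
    thus "continuous_on (sphere 0 t) (\<lambda>z. ln (max (cmod (q z)) (cmod (h z))))"
      using nz that by (intro continuous_intros) (auto simp: max_def)
  qed
  obtain g where g: "real_polynomial_function g" "\<And>z. z \<in> sphere 0 r \<Longrightarrow> \<bar>u z - g z\<bar> < e / 2"
    using Stone_Weierstrass_real_polynomial_function[OF compact_sphere contu[of r], of "e / 2"] e by auto
  obtain p where p: "\<forall>z\<in>sphere 0 r. g z = Re (poly p z)"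
    using real_polynomial_function_eq_Re_poly_circle[OF g(1)] by blast
  \<comment> \<open>The shift by \<open>e / 2\<close> turns an approximation of \<open>u\<close> on
    the outer circle into a majorant that still lies within \<open>e\<close> of it.\<close>
  define P where "P z = poly p z + of_real (e / 2)" for z
  have holP: "P holomorphic_on A" for A unfolding P_def by (intro holomorphic_intros)
  have contP: "continuous_on A P" for A by (intro holomorphic_on_imp_continuous_on holP)
  have uP: "u z \<le> Re (P z)" "Re (P z) \<le> u z + e" if "z \<in> sphere 0 r" for z
  proof -
    have "\<bar>u z - Re (poly p z)\<bar> < e / 2" using g(2)[OF that] bspec[OF p that] by simp
    moreover have "Re (P z) = Re (poly p z) + e / 2" by (simp add: P_def)
    ultimately show "u z \<le> Re (P z)" "Re (P z) \<le> u z + e" by linarith+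
  qed
  \<comment> \<open>The maximum of the two moduli is not the modulus of a holomorphic function, so
    the maximum principle is applied to \<open>q\<close> and to \<open>h\<close> one at a
    time.\<close>
  have dom: "cmod (f z) \<le> exp (Re (P z))"
    if f: "f analytic_on cball 0 r" and le: "\<And>z. cmod (f z) \<le> max (cmod (q z)) (cmod (h z))"
      and z: "z \<in> sphere 0 s" for f z
  proof -
    have "cmod (f z * exp (- P z)) \<le> 1"
    proof (rule maximum_modulus_frontier[of "\<lambda>z. f z * exp (- P z)" "cball 0 r"])
      have "(\<lambda>z. f z * exp (- P z)) holomorphic_on cball 0 r"
        by (intro holomorphic_intros holP analytic_imp_holomorphic[OF f])
      thus "(\<lambda>z. f z * exp (- P z)) holomorphic_on interior (cball 0 r)"
        "continuous_on (closure (cball 0 r)) (\<lambda>z. f z * exp (- P z))"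
        by (auto intro: holomorphic_on_subset holomorphic_on_imp_continuous_on)
      fix w :: complex assume "w \<in> frontier (cball 0 r)"
      hence w: "w \<in> sphere 0 r" by simp
      have "cmod (f w) \<le> exp (u w)" using le[of w] pos[of w] w by (simp add: u_def)
      also have "\<dots> \<le> exp (Re (P w))" using uP(1)[OF w] by simp
      finally show "cmod (f w * exp (- P w)) \<le> 1"
        by (simp add: norm_mult norm_divide exp_minus divide_inverse[symmetric])
    qed (use z sr in auto)
    thus ?thesis by (simp add: norm_mult norm_divide exp_minus divide_inverse[symmetric])
  qed
  have us: "u z \<le> Re (P z)" if z: "z \<in> sphere 0 s" for z
  proof -
    have "max (cmod (q z)) (cmod (h z)) \<le> exp (Re (P z))"
      using dom[OF q _ z] dom[OF h _ z] by simp
    thus ?thesis unfolding u_def using pos[of z] z by (simp add: ln_le_cancel_iff[symmetric] del: ln_le_cancel_iff max.bounded_iff)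
  qed
  have "circle_mean u s \<le> circle_mean (\<lambda>z. Re (P z)) s"
    using sr us by (intro circle_mean_mono contu continuous_intros contP) auto
  also have "\<dots> = circle_mean (\<lambda>z. Re (P z)) r"
    using circle_mean_Re_holomorphic[OF holP, of s "r + 1"] circle_mean_Re_holomorphic[OF holP, of r "r + 1"] sr by simp
  also have "\<dots> \<le> circle_mean (\<lambda>z. u z + e) r"
    using sr uP by (intro circle_mean_mono contu continuous_intros contP) auto
  also have "\<dots> = circle_mean u r + e"
    using sr by (subst circle_mean_add) (auto intro: contu)
  finally show "circle_mean (\<lambda>z. ln (max (cmod (q z)) (cmod (h z)))) s \<le>
      circle_mean (\<lambda>z. ln (max (cmod (q z)) (cmod (h z)))) r + e"
    by (simp add: u_def[abs_def])
qed

text \<open>The polynomial \<open>h\<close> clears the poles of \<open>f\<close> in the larger disc,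
  and \<open>max 1 (cmod f) * cmod h = max (cmod q) (cmod h)\<close>. Jensen's formula for
  \<open>h\<close> turns the counting function of the poles into the mean of
  \<open>ln (cmod h)\<close>, up to a constant that is the same for both radii. Monotonicity of the
  mean of the logarithm of the maximum then suffices.\<close>

theorem nev_T_mono:
  assumes f: "mero_nz f" and regular: "regular f s" "regular f r" and sr: "s < r"
  shows "nev_T f s \<le> nev_T f r"
proof -
  define B where "B = {b. cmod b \<le> r \<and> zorder f b < 0}"
  define h where "h z = (\<Prod>b\<in>B. (z - b) ^ nat (- zorder f b))" for z
  define q where "q = remove_sings (\<lambda>z. f z * h z)"
  have s: "0 < s" using regular(1) by (rule regular_pos)
  have fin: "finite B"
    by (rule finite_subset[OF _ finite_zorder_nz[OF f, of r]]) (auto simp: B_def)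
  have Bn: "cmod b \<noteq> s" "cmod b \<noteq> r" if "b \<in> B" for b
    using that regular_zorder[OF regular(1)] regular_zorder[OF regular(2)] by (force simp: B_def)+
  have mlin: "mero_nz (\<lambda>z. z - b)" for b
  proof -
    have "eventually (\<lambda>z. z - b \<noteq> 0) (cosparse UNIV)"
      by (simp add: eventually_cosparse)
    thus ?thesis by (auto simp: mero_nz_def intro!: meromorphic_intros)
  qed
  have olin: "zorder (\<lambda>z. z - b) z = (if z = b then 1 else 0)" for b z :: complex
  proof (cases "z = b")
    case True
    have "zorder (\<lambda>z. z - b) b = 1"
      by (rule zorder_eqI[where S = UNIV and g = "\<lambda>_. 1"]) auto
    thus ?thesis using True by simp
  qed (auto intro!: zorder_eq_0I analytic_intros)
  have mh: "mero_nz h"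
    unfolding h_def[abs_def] by (intro mero_nz_prod fin mero_nz_power mlin)
  have hz: "h z \<noteq> 0" if "z \<notin> B" for z
    using that fin by (auto simp: h_def)
  have hana: "h analytic_on A" for A
    unfolding h_def[abs_def] by (intro analytic_intros)
  have oh: "zorder h z = (if z \<in> B then - zorder f z else 0)" for z
  proof -
    have "zorder h z = (\<Sum>b\<in>B. zorder (\<lambda>z. (z - b) ^ nat (- zorder f b)) z)"
      unfolding h_def[abs_def] using mero_nzD(2)[OF mh] mlin
      by (intro zorder_prod) (auto simp: h_def intro!: meromorphic_intros)
    also have "\<dots> = (\<Sum>b\<in>B. if z = b then - zorder f z else 0)"
      by (intro sum.cong) (auto simp: mero_nz_zorder_power mlin olin B_def)
    finally show ?thesis using fin by simp
  qed
  have mfh: "mero_nz (\<lambda>z. f z * h z)" by (intro mero_nz_mult f mh)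
  have qana: "q analytic_on cball 0 r"
  proof (subst analytic_on_analytic_at, rule ballI)
    fix z :: complex assume z: "z \<in> cball 0 r"
    have "0 \<le> zorder (\<lambda>z. f z * h z) z"
      unfolding mero_nz_zorder_mult[OF f mh] oh using z by (auto simp: B_def)
    hence "\<not> is_pole (\<lambda>z. f z * h z) z" by (simp add: mero_nz_is_pole_iff[OF mfh])
    moreover have "not_essential (\<lambda>z. f z * h z) z" "isolated_singularity_at (\<lambda>z. f z * h z) z"
      using mero_nzD(1)[OF mfh] meromorphic_on_isolated_singularity meromorphic_on_not_essential by blast+
    ultimately show "q analytic_on {z}"
      unfolding q_def not_essential_def using remove_sings_analytic_at by blast
  qed
  have T: "nev_T f t = circle_mean (\<lambda>z. ln (max (cmod (q z)) (cmod (h z)))) t - ln (cmod (zor_poly h 0 0))"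
    if t: "t = s \<or> t = r" for t
  proof -
    have tr: "0 < t" "t \<le> r" using t s sr by auto
    have gf: "regular f t" using regular t by auto
    have tB: "z \<notin> B" if "z \<in> sphere 0 t" for z using Bn t that by auto
    hence gh: "regular h t" using tr by (auto simp: regular_def hana intro!: hz)
    have qfh: "q z = f z * h z" if "z \<in> sphere 0 t" for z
      unfolding q_def using that gf gh
      by (intro remove_sings_at_analytic) (auto simp: regular_def intro!: analytic_intros)
    have contu: "continuous_on (sphere 0 t) (\<lambda>z. ln (max (cmod (q z)) (cmod (h z))))"
      "continuous_on (sphere 0 t) (\<lambda>z. ln (cmod (h z)))"
    proof -
      have "continuous_on (cball 0 r) q"
        by (intro holomorphic_on_imp_continuous_on analytic_imp_holomorphic qana)
      hence "continuous_on (sphere 0 t) q" by (rule continuous_on_subset) (use tr in auto)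
      thus "continuous_on (sphere 0 t) (\<lambda>z. ln (max (cmod (q z)) (cmod (h z))))"
        using regular_nonzero[OF gh] regular_continuous_on[OF gh]
        by (intro continuous_intros) (auto simp: max_def)
      show "continuous_on (sphere 0 t) (\<lambda>z. ln (cmod (h z)))"
        using regular_nonzero[OF gh] regular_continuous_on[OF gh] by (intro continuous_intros) auto
    qed
    have "prox f t = circle_mean (\<lambda>z. ln (max (cmod (q z)) (cmod (h z))) - ln (cmod (h z))) t"
      unfolding prox_eq_circle_mean
    proof (rule circle_mean_cong)
      fix z :: complex assume z: "z \<in> sphere 0 t"
      have hp: "0 < cmod (h z)" using regular_nonzero[OF gh z] by simp
      have "max (cmod (q z)) (cmod (h z)) = max 1 (cmod (f z)) * cmod (h z)"
        unfolding qfh[OF z] norm_mult using hp by (auto simp: max_def)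
      thus "logplus (cmod (f z)) = ln (max (cmod (q z)) (cmod (h z))) - ln (cmod (h z))"
        using hp by (simp add: logplus_eq ln_mult_pos)
    qed (use tr in auto)
    also have "\<dots> = circle_mean (\<lambda>z. ln (max (cmod (q z)) (cmod (h z)))) t - circle_mean (\<lambda>z. ln (cmod (h z))) t"
      using tr by (intro circle_mean_diff contu) auto
    also have "circle_mean (\<lambda>z. ln (cmod (h z))) t = divisor_N (\<lambda>a. real_of_int (zorder h a)) t + ln (cmod (zor_poly h 0 0))"
      by (rule jensen_formula[OF mh gh])
    also have "divisor_N (\<lambda>a. real_of_int (zorder h a)) t = divisor_N (pole_mult f) t"
    proof -
      have *: "real_of_int (zorder h a) = pole_mult f a" if "cmod a \<le> t" for a
        using that tr by (auto simp: oh pole_mult_def B_def)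
      hence "{a. cmod a \<le> t \<and> real_of_int (zorder h a) \<noteq> 0} = {a. cmod a \<le> t \<and> pole_mult f a \<noteq> 0}"
        by (intro Collect_cong conj_cong refl arg_cong[of _ _ Not]) (simp only: *)
      thus ?thesis unfolding divisor_N_def using * by (intro sum.cong) auto
    qed
    finally show ?thesis using tr by (simp add: nev_T_eq[OF f])
  qed
  have "circle_mean (\<lambda>z. ln (max (cmod (q z)) (cmod (h z)))) s \<le> circle_mean (\<lambda>z. ln (max (cmod (q z)) (cmod (h z)))) r"
    using Bn by (intro circle_mean_ln_max_mono qana hana s sr hz) auto
  thus ?thesis by (simp add: T)
qed

section \<open>Borel's growth lemma\<close>

lemma ex_power_of_two_interval:
  fixes x :: real
  assumes "1 \<le> x"
  obtains n :: nat where "2 ^ n \<le> x" "x < 2 ^ Suc n"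
proof -
  have "\<exists>n. x < 2 ^ Suc n"
  proof -
    obtain n where "x < 2 ^ n" using real_arch_pow[of 2 x] by auto
    also have "(2 :: real) ^ n \<le> 2 ^ Suc n" by simp
    finally show ?thesis by blast
  qed
  hence 1: "x < 2 ^ Suc (LEAST n. x < 2 ^ Suc n)" by (rule LeastI_ex)
  have "2 ^ (LEAST n. x < 2 ^ Suc n) \<le> x"
  proof (cases "LEAST n. x < 2 ^ Suc n")
    case (Suc m)
    hence "\<not> x < 2 ^ Suc m" using not_less_Least[of m "\<lambda>n. x < 2 ^ Suc n"] by simp
    thus ?thesis using Suc by simp
  qed (use assms in simp)
  thus ?thesis using 1 that by blast
qed

text \<open>
  The exceptional points with \<open>2 ^ n \<le> \<tau> r < 2 ^ Suc n\<close> lie in one interval of length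
  \<open>1 / 2 ^ n\<close>: beyond it, \<open>\<tau>\<close> has already left the dyadic range.
\<close>
lemma borel_growth_lemma:
  fixes \<tau> :: "real \<Rightarrow> real"
  assumes mono: "\<And>r s. 1 \<le> r \<Longrightarrow> r \<le> s \<Longrightarrow> \<tau> r \<le> \<tau> s" and one: "\<And>r. 1 \<le> r \<Longrightarrow> 1 \<le> \<tau> r"
  obtains E where "E \<in> sets lebesgue" "emeasure lebesgue E < \<infinity>"
    "\<And>r. 1 \<le> r \<Longrightarrow> r \<notin> E \<Longrightarrow> \<tau> (r + 1 / \<tau> r) < 4 * \<tau> r"
proof -
  define En where "En n = {r. 1 \<le> r \<and> 2 ^ n \<le> \<tau> r \<and> \<tau> r < 2 ^ Suc n \<and> 4 * \<tau> r \<le> \<tau> (r + 1 / \<tau> r)}" for n :: nat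
  define I where "I n = {Inf (En n) .. Inf (En n) + (1 / 2) ^ n}" for n
  have sub: "En n \<subseteq> I n" for n
  proof
    fix r assume r: "r \<in> En n"
    have bdd: "bdd_below (En n)" by (intro bdd_belowI[of _ 1]) (simp add: En_def)
    have "r - (1 / 2) ^ n \<le> s" if s: "s \<in> En n" for s
    proof (rule ccontr)
      assume "\<not> r - (1 / 2) ^ n \<le> s"
      hence lt: "s + (1 / 2) ^ n < r" by simp
      have s': "1 \<le> s" "2 ^ n \<le> \<tau> s" "4 * \<tau> s \<le> \<tau> (s + 1 / \<tau> s)" using s by (auto simp: En_def)
      have "1 / \<tau> s \<le> 1 / 2 ^ n" using s' by (intro frac_le) auto
      hence "s + 1 / \<tau> s \<le> r" using lt by (simp add: power_one_over)
      moreover have "1 \<le> s + 1 / \<tau> s"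
        by (rule add_increasing2) (use one[of s] s' in auto)
      ultimately have "\<tau> (s + 1 / \<tau> s) \<le> \<tau> r" by (intro mono)
      hence "4 * 2 ^ n \<le> \<tau> r" using s' by linarith
      moreover have "\<tau> r < 2 * 2 ^ n" using r by (simp add: En_def)
      ultimately show False using zero_less_power[of "2 :: real" n] by linarith
    qed
    hence "r - (1 / 2) ^ n \<le> Inf (En n)" using r by (intro cInf_greatest) auto
    moreover have "Inf (En n) \<le> r" using r bdd by (rule cInf_lower)
    ultimately show "r \<in> I n" by (simp add: I_def)
  qed
  show ?thesis
  proof (rule that[of "\<Union>n. I n"])
    show "(\<Union>n. I n) \<in> sets lebesgue" by (auto simp: I_def)
    have "emeasure lebesgue (\<Union>n. I n) \<le> (\<Sum>n. emeasure lebesgue (I n))"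
      by (rule emeasure_subadditive_countably) (auto simp: I_def)
    also have "\<dots> = (\<Sum>n. ennreal ((1 / 2) ^ n))"
      by (simp add: I_def)
    also have "\<dots> = ennreal (\<Sum>n. (1 / 2) ^ n)"
      by (rule suminf_ennreal2) (auto intro!: summable_geometric)
    also have "\<dots> < \<infinity>" by simp
    finally show "emeasure lebesgue (\<Union>n. I n) < \<infinity>" .
    fix r :: real assume r: "1 \<le> r" "r \<notin> (\<Union>n. I n)"
    obtain n where "2 ^ n \<le> \<tau> r" "\<tau> r < 2 ^ Suc n" using ex_power_of_two_interval[OF one[OF r(1)]] .
    moreover have "r \<notin> En n" using r sub by blast
    ultimately show "\<tau> (r + 1 / \<tau> r) < 4 * \<tau> r" using r by (auto simp: En_def)
  qed
qed

section \<open>Transcendental functions\<close>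

text \<open>\<open>transcendental_mero\<close> speaks of values, so vanishing off a sparse set has
  to become vanishing everywhere; nice meromorphy provides this, and the zero function is
  rational.\<close>

lemma transcendental_meroI:
  assumes "f nicely_meromorphic_on UNIV" "transcendental_mero f"
  shows "mero_nz f"
proof -
  have m: "f meromorphic_on UNIV" using assms by (simp add: nicely_meromorphic_on_def)
  have False if "eventually (\<lambda>z. f z = 0) (cosparse UNIV)"
  proof -
    have fr: "frequently (\<lambda>z. f z = 0) (at 0)"
      using that by (intro eventually_frequently) (auto simp: eventually_cosparse_open_eq)
    have "f w = 0" for w
      by (rule frequently_eq_meromorphic_imp_constant[OF fr assms(1) open_UNIV connected_UNIV]) simp_all
    hence "\<forall>z. poly 1 z \<noteq> (0::complex) \<longrightarrow> f z = poly 0 z / poly 1 z" by simp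
    thus False using assms(2) unfolding transcendental_mero_def by (metis one_neq_zero)
  qed
  thus ?thesis using mero_nz_or_zero[OF m] by blast
qed

lemma is_pole_higher_deriv_iff:
  assumes "f meromorphic_on UNIV"
  shows "is_pole ((deriv ^^ n) f) z \<longleftrightarrow> is_pole f z"
proof (induction n)
  case (Suc n)
  have "(deriv ^^ n) f meromorphic_on {z}"
    using assms by (intro meromorphic_on_higher_deriv meromorphic_on_subset[OF assms]) auto
  thus ?case using Suc is_pole_deriv_iff by simp
qed simp

text \<open>If a derivative of \<open>f\<close> vanished off a sparse set, it would have no pole.
  Then \<open>f\<close>, which has poles at the same points, would be entire with a terminating
  Taylor series, hence a polynomial.\<close>

lemma transcendental_higher_deriv:
  assumes nice: "f nicely_meromorphic_on UNIV" and tr: "transcendental_mero f"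
  shows "mero_nz ((deriv ^^ n) f)"
proof -
  have m: "f meromorphic_on UNIV" using nice by (simp add: nicely_meromorphic_on_def)
  have mn: "(deriv ^^ n) f meromorphic_on UNIV" by (intro meromorphic_on_higher_deriv m)
  have False if ev: "eventually (\<lambda>z. (deriv ^^ n) f z = 0) (cosparse UNIV)"
  proof -
    have ev': "eventually (\<lambda>z. (deriv ^^ n) f z = 0) (at a)" for a
      using ev by (auto simp: eventually_cosparse_open_eq)
    have lim: "(deriv ^^ n) f \<midarrow>a\<rightarrow> 0" for a
      using tendsto_cong[OF ev'[of a]] by simp
    have "\<not> is_pole f a" for a
      using lim[of a] is_pole_higher_deriv_iff[OF m, of n a] not_tendsto_and_filterlim_at_infinity[of "at a"]
      by (auto simp: is_pole_def)
    hence "f analytic_on {a}" for a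
      using nicely_meromorphic_on_imp_analytic_at[OF nice] by auto
    hence hol: "f holomorphic_on UNIV"
      by (intro analytic_imp_holomorphic) (auto simp: analytic_on_analytic_at[of f UNIV])
    have "(deriv ^^ n) f holomorphic_on UNIV" by (intro holomorphic_higher_deriv hol) auto
    hence lim': "(deriv ^^ n) f \<midarrow>a\<rightarrow> (deriv ^^ n) f a" for a
      using holomorphic_on_imp_continuous_on continuous_on_eq_continuous_at[OF open_UNIV] isContD by blast
    have zero: "(deriv ^^ n) f a = 0" for a
      by (rule tendsto_unique[OF at_neq_bot lim' lim])
    have zero': "(deriv ^^ k) f a = 0" if "n \<le> k" for k a
      using that
    proof (induction k arbitrary: a rule: dec_induct)
      case (step k)
      have "(deriv ^^ k) f = (\<lambda>_. 0)" using step.IH by auto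
      thus ?case by simp
    qed (rule zero)
    define p where "p = (\<Sum>k<n. monom ((deriv ^^ k) f 0 / fact k) k)"
    have "f z = poly p z" for z
    proof -
      have "((\<lambda>k. (deriv ^^ k) f 0 / fact k * (z - 0) ^ k) sums f z)"
        by (rule holomorphic_power_series[of f 0 "cmod z + 1"]) (auto intro: holomorphic_on_subset[OF hol])
      moreover have "((\<lambda>k. (deriv ^^ k) f 0 / fact k * (z - 0) ^ k) sums
          (\<Sum>k<n. (deriv ^^ k) f 0 / fact k * (z - 0) ^ k))"
        by (rule sums_finite) (auto simp: zero' not_less)
      ultimately have "f z = (\<Sum>k<n. (deriv ^^ k) f 0 / fact k * (z - 0) ^ k)" by (rule sums_unique2)
      thus ?thesis by (simp add: p_def poly_sum poly_monom)
    qed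
    hence "\<forall>z. poly 1 z \<noteq> (0::complex) \<longrightarrow> f z = poly p z / poly 1 z" by simp
    thus False using tr unfolding transcendental_mero_def by (metis one_neq_zero)
  qed
  thus ?thesis using mero_nz_or_zero[OF mn] by blast
qed

text \<open>Removing a sparse set from the plane leaves a connected open set, on which a vanishing
  derivative forces one common value.\<close>

lemma meromorphic_deriv_zero_imp_constant:
  assumes m: "F meromorphic_on UNIV" and ev: "eventually (\<lambda>z. deriv F z = 0) (cosparse UNIV)"
  obtains c where "eventually (\<lambda>z. F z = c) (cosparse UNIV)"
proof -
  define U where "U = {z. F analytic_on {z} \<and> deriv F z = 0}"
  have evU: "eventually (\<lambda>z. z \<in> U) (cosparse UNIV)"
    unfolding U_def using ev meromorphic_on_imp_analytic_cosparse[OF m] by (simp add: eventually_conj)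
  hence sp: "- U sparse_in UNIV" by (simp add: eventually_cosparse Compl_eq)
  have "connected (UNIV - (- U))"
    by (rule sparse_imp_connected[OF _ connected_UNIV open_UNIV sp]) simp
  hence conn: "connected U" by (simp add: Compl_eq_Diff_UNIV[symmetric])
  have opn: "open U" using sparse_in_UNIV_imp_closed[OF sp] by (simp add: closed_def)
  have der: "(F has_field_derivative 0) (at z)" if "z \<in> U" for z
    using that analytic_on_imp_differentiable_at[of F "{z}" z] DERIV_deriv_iff_field_differentiable[of F z]
    by (simp add: U_def)
  have "\<exists>c. \<forall>z\<in>U. F z = c"
    by (rule DERIV_zero_connected_constant[OF conn opn finite.emptyI])
       (use der in \<open>auto intro!: DERIV_isCont continuous_at_imp_continuous_on\<close>)
  then obtain c where "\<forall>z\<in>U. F z = c" by blast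
  hence "eventually (\<lambda>z. F z = c) (cosparse UNIV)"
    using evU by (auto elim: eventually_mono)
  thus ?thesis by (rule that)
qed

text \<open>Multiplying \<open>f\<close> by the powers that cancel its zeros and poles gives a
  function with vanishing logarithmic derivative, hence a constant off a sparse set.\<close>

lemma finite_divisor_log_deriv_imp_rational:
  assumes nice: "f nicely_meromorphic_on UNIV" and mf: "mero_nz f"
    and fin: "finite {a. zorder f a \<noteq> 0}"
    and ld: "\<And>z. f analytic_on {z} \<Longrightarrow> f z \<noteq> 0 \<Longrightarrow>
      deriv f z / f z = (\<Sum>a | zorder f a \<noteq> 0. of_int (zorder f a) / (z - a))"
  shows "\<not> transcendental_mero f"
proof -
  define A where "A = {a. zorder f a \<noteq> 0}"
  have finA: "finite A" using fin by (simp add: A_def)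
  define U where "U = {z. f analytic_on {z} \<and> f z \<noteq> 0}"
  have UA: "z \<noteq> a" if "z \<in> U" "a \<in> A" for z a
    using that zorder_eq_0I[of f z] by (auto simp: U_def A_def)
  have evU: "eventually (\<lambda>z. z \<in> U) (cosparse UNIV)"
    using mero_nz_sparse_irregular[OF mf] by (simp add: eventually_cosparse U_def)
  define G where "G z = f z * (\<Prod>a\<in>A. (z - a) powi (- zorder f a))" for z
  have der: "(G has_field_derivative 0) (at z)" if z: "z \<in> U" for z
  proof -
    have "((\<lambda>z. \<Prod>a\<in>A. (z - a) powi (- zorder f a)) has_field_derivative
        (\<Prod>a\<in>A. (z - a) powi (- zorder f a)) * (\<Sum>a\<in>A. of_int (- zorder f a) * (1 / (z - a)))) (at z)"
    proof (rule has_field_derivative_prod_powi[OF finA])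
      fix a assume "a \<in> A"
      hence "z - a \<noteq> 0" using UA[OF z] by auto
      thus "z - a \<noteq> 0" "((\<lambda>z. z - a) has_field_derivative (z - a) * (1 / (z - a))) (at z)"
        by (auto intro!: derivative_eq_intros)
    qed
    moreover have "(\<Sum>a\<in>A. of_int (- zorder f a) * (1 / (z - a))) = - (deriv f z / f z)"
      using ld[of z] z by (simp add: U_def A_def sum_negf)
    ultimately have P: "((\<lambda>z. \<Prod>a\<in>A. (z - a) powi (- zorder f a)) has_field_derivative
        (\<Prod>a\<in>A. (z - a) powi (- zorder f a)) * - (deriv f z / f z)) (at z)"
      by simp
    have F: "(f has_field_derivative deriv f z) (at z)"
      using z by (auto simp: U_def analytic_on_imp_differentiable_at DERIV_deriv_iff_field_differentiable)
    have "(G has_field_derivative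
        f z * ((\<Prod>a\<in>A. (z - a) powi (- zorder f a)) * - (deriv f z / f z)) +
        deriv f z * (\<Prod>a\<in>A. (z - a) powi (- zorder f a))) (at z)"
      unfolding G_def[abs_def] by (rule DERIV_mult'[OF F P])
    thus ?thesis using z by (simp add: U_def)
  qed
  have "G meromorphic_on UNIV"
    unfolding G_def[abs_def] by (intro meromorphic_intros mero_nzD(1)[OF mf])
  moreover have "eventually (\<lambda>z. deriv G z = 0) (cosparse UNIV)"
    using evU by (rule eventually_mono) (rule DERIV_imp_deriv[OF der])
  ultimately obtain c where "eventually (\<lambda>z. G z = c) (cosparse UNIV)"
    using meromorphic_deriv_zero_imp_constant by blast
  hence evc: "eventually (\<lambda>z. z \<in> U \<and> G z = c) (cosparse UNIV)"
    using evU by (rule eventually_conj[rotated])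
  define p where "p = smult c (\<Prod>a\<in>A. [:-a, 1:] ^ nat (zorder f a))"
  define q where "q = (\<Prod>a\<in>A. [:-a, 1:] ^ nat (- zorder f a))"
  have q0: "q \<noteq> 0" unfolding q_def using finA by auto
  have fU: "f z = poly p z / poly q z" if z: "z \<in> U" and Gc: "G z = c" for z
  proof -
    have "(\<Prod>a\<in>A. (z - a) powi (- zorder f a)) * poly (\<Prod>a\<in>A. [:-a, 1:] ^ nat (zorder f a)) z = poly q z"
      unfolding q_def poly_prod prod.distrib[symmetric]
    proof (rule prod.cong)
      fix a assume "a \<in> A"
      hence "z - a \<noteq> 0" using UA[OF z] by auto
      thus "(z - a) powi - zorder f a * poly ([:- a, 1:] ^ nat (zorder f a)) z = poly ([:- a, 1:] ^ nat (- zorder f a)) z"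
        by (cases "zorder f a \<ge> 0") (auto simp: power_int_def power_inverse)
    qed simp
    hence "poly p z = c * poly (\<Prod>a\<in>A. [:-a, 1:] ^ nat (zorder f a)) z"
      "f z * poly q z = G z * poly (\<Prod>a\<in>A. [:-a, 1:] ^ nat (zorder f a)) z"
      by (simp_all add: p_def G_def mult.assoc)
    moreover have "poly q z \<noteq> 0"
      unfolding q_def poly_prod using finA UA[OF z] by auto
    ultimately show ?thesis using Gc by (simp add: field_simps)
  qed
  \<comment> \<open>Rationality is demanded at every point that is not a root of \<open>q\<close>.
    Poles of \<open>f\<close> are roots of \<open>q\<close>, and at the other points both sides
    equal their limits.\<close>
  have "f z = poly p z / poly q z" if z: "poly q z \<noteq> 0" for z
  proof -
    have "\<not> is_pole f z"
    proof
      assume "is_pole f z"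
      hence "zorder f z < 0" by (simp add: mero_nz_is_pole_iff[OF mf])
      hence "z \<in> A" "poly ([:- z, 1:] ^ nat (- zorder f z)) z = 0" by (auto simp: A_def)
      hence "poly q z = 0" unfolding q_def poly_prod using finA by (intro prod_zero) auto
      thus False using z by simp
    qed
    hence lim: "f \<midarrow>z\<rightarrow> f z" using nice by (auto simp: nicely_meromorphic_on_def)
    have ev: "eventually (\<lambda>w. f w = poly p w / poly q w) (at z)"
    proof -
      have "eventually (\<lambda>w. w \<in> U \<and> G w = c) (at z)" using evc by (auto simp: eventually_cosparse_open_eq)
      thus ?thesis by (rule eventually_mono) (use fU in blast)
    qed
    have 1: "(\<lambda>w. poly p w / poly q w) \<midarrow>z\<rightarrow> f z"
      by (rule iffD1[OF tendsto_cong[OF ev] lim])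
    have 2: "(\<lambda>w. poly p w / poly q w) \<midarrow>z\<rightarrow> poly p z / poly q z"
      using z by (intro tendsto_intros)
    show ?thesis by (rule tendsto_unique[OF at_neq_bot 1 2])
  qed
  thus ?thesis using q0 unfolding transcendental_mero_def by blast
qed

text \<open>Suppose the characteristic stays below \<open>K * ln r\<close> at arbitrarily large
  regular radii. Then there are only finitely many zeros and poles. Letting the radius in
  \<open>log_deriv_bound\<close> tend to infinity along such radii leaves \<open>f' / f\<close>
  equal to its sum of principal parts, so \<open>f\<close> is rational.\<close>

theorem transcendental_ln_le_nev_T:
  assumes nice: "f nicely_meromorphic_on UNIV" and tr: "transcendental_mero f"
  shows "\<exists>R. \<forall>r\<ge>R. regular f r \<longrightarrow> K * ln r \<le> nev_T f r"
proof (rule ccontr)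
  have mf: "mero_nz f" by (rule transcendental_meroI[OF nice tr])
  assume "\<not> ?thesis"
  hence ex: "\<exists>r\<ge>R. regular f r \<and> nev_T f r < K * ln r" for R by (auto simp: not_le)
  define c where "c = ln (cmod (zor_poly f 0 0))"
  define M where "M = 2 * \<bar>K\<bar> + \<bar>c\<bar>"
  have both: "prox f r + prox (\<lambda>z. inverse (f z)) r + (divisor_N (pole_mult f) r + divisor_N (zero_mult f) r) \<le> M * ln r"
    if r: "regular f r" "nev_T f r < K * ln r" "exp 1 \<le> r" for r
  proof -
    have r0: "0 < r" using regular_pos[OF r(1)] .
    have ln1: "1 \<le> ln r" using r(3) r0 by (simp add: ln_ge_iff)
    have "nev_T f r = prox f r + divisor_N (pole_mult f) r" by (intro nev_T_eq mf r0)
    moreover have "nev_T f r = prox (\<lambda>z. inverse (f z)) r + divisor_N (zero_mult f) r + c"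
      unfolding c_def by (intro first_main_theorem mf r(1))
    moreover have "K * ln r \<le> \<bar>K\<bar> * ln r" using ln1 by (intro mult_right_mono) auto
    moreover have "\<bar>c\<bar> * 1 \<le> \<bar>c\<bar> * ln r" using ln1 by (intro mult_left_mono) auto
    moreover have "M * ln r = 2 * (\<bar>K\<bar> * ln r) + \<bar>c\<bar> * ln r" by (simp add: M_def algebra_simps)
    ultimately show ?thesis using r(2) by linarith
  qed
  define A where "A = {a. zorder f a \<noteq> 0}"
  define D where "D a = pole_mult f a + zero_mult f a" for a
  have D: "D a = \<bar>real_of_int (zorder f a)\<bar>" for a by (simp add: D_def pole_mult_def zero_mult_def)
  have lfD: "locally_finite D" unfolding D_def[abs_def] using mf by (intro locally_finite_add) auto
  have finA: "finite A"
  proof (rule ccontr)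
    assume inf: "infinite A"
    \<comment> \<open>More than \<open>2 * M\<close> points, all inside radius
      \<open>sqrt r\<close>, are too many: their number times \<open>ln (sqrt r) = ln r / 2\<close>
      is at most the count at \<open>r\<close>, hence at most \<open>M * ln r\<close>.\<close>
    obtain B where B: "finite B" "B \<subseteq> A" "card B = nat \<lceil>2 * M\<rceil> + 1"
      using infinite_arbitrarily_large[OF inf] by blast
    obtain t where t: "\<And>b. b \<in> B \<Longrightarrow> cmod b \<le> t"
      using finite_imp_bounded[OF B(1)] by (auto simp: bounded_iff)
    define R where "R = max (exp 1) ((max t 1)\<^sup>2)"
    obtain r where r: "R \<le> r" "regular f r" "nev_T f r < K * ln r" using ex by blast
    have r0: "0 < r" using regular_pos[OF r(2)] .
    have re: "exp 1 \<le> r" "(max t 1)\<^sup>2 \<le> r" using r(1) by (auto simp: R_def)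
    have ln1: "1 \<le> ln r" using re r0 by (simp add: ln_ge_iff)
    have sq: "max t 1 \<le> sqrt r" using re(2) by (rule real_le_rsqrt)
    hence sq1: "1 \<le> sqrt r" "t \<le> sqrt r" by auto
    have sqr: "sqrt r \<le> r"
    proof -
      have "sqrt r * 1 \<le> sqrt r * sqrt r" using sq1 by (intro mult_left_mono) auto
      thus ?thesis using r0 by simp
    qed
    have "real (card B) = (\<Sum>a\<in>B. 1)" by simp
    also have "\<dots> \<le> (\<Sum>a\<in>B. D a)"
    proof (rule sum_mono)
      fix a assume "a \<in> B"
      hence "1 \<le> \<bar>zorder f a\<bar>" using B by (auto simp: A_def)
      thus "1 \<le> D a" unfolding D by linarith
    qed
    also have "\<dots> \<le> (\<Sum>a | cmod a \<le> sqrt r \<and> D a \<noteq> 0. D a)"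
    proof (rule sum_mono2)
      show "finite {a. cmod a \<le> sqrt r \<and> D a \<noteq> 0}" using lfD by (auto simp: locally_finite_def)
      show "B \<subseteq> {a. cmod a \<le> sqrt r \<and> D a \<noteq> 0}"
        using B t sq1 by (force simp: A_def D)
    qed (simp add: D)
    finally have "real (card B) * ln (r / sqrt r) \<le> (\<Sum>a | cmod a \<le> sqrt r \<and> D a \<noteq> 0. D a) * ln (r / sqrt r)"
      using sq1 sqr by (intro mult_right_mono) auto
    also have "\<dots> \<le> divisor_N D r" by (rule sum_le_divisor_N[OF lfD _ sq1(1) sqr]) (simp add: D)
    also have "divisor_N D r = divisor_N (pole_mult f) r + divisor_N (zero_mult f) r" unfolding D_def[abs_def] using mf by (simp add: divisor_N_add)
    also have "\<dots> \<le> M * ln r"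
      using both[OF r(2,3) re(1)] prox_nonneg_regular[OF r(2)] prox_nonneg_regular[OF regular_inverse[OF r(2)]] by linarith
    also have "r / sqrt r = sqrt r" using r0 by (simp add: real_div_sqrt)
    also have "ln (sqrt r) = ln r / 2" using r0 by (simp add: ln_sqrt)
    finally have "real (card B) * (ln r / 2) \<le> 2 * M * (ln r / 2)" by simp
    hence "real (card B) \<le> 2 * M" using ln1 by (subst (asm) mult_le_cancel_right) auto
    moreover have "2 * M < real (card B)" unfolding B(3) by linarith
    ultimately show False by simp
  qed
  have "deriv f z / f z = (\<Sum>a\<in>A. of_int (zorder f a) / (z - a))" if z: "f analytic_on {z}" "f z \<noteq> 0" for z
  proof -
    define S where "S = (\<Sum>a\<in>A. of_int (zorder f a) / (z - a))"
    \<comment> \<open>\<open>e\<close> collects the reflected points and \<open>b\<close> bounds the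
      remainder. Both vanish at infinity, \<open>b\<close> because \<open>ln s / s\<close> tends to
      0.\<close>
    define e where "e s = (\<Sum>a\<in>A. of_int (zorder f a) * (cnj a / (complex_of_real (s\<^sup>2) - cnj a * z)))" for s
    define b where "b s = 2 * s / (s - cmod z)\<^sup>2 * (M * ln s)" for s
    have elim: "(e \<longlongrightarrow> 0) at_top"
    proof -
      have "((\<lambda>s. cnj a / (complex_of_real (s\<^sup>2) - cnj a * z)) \<longlongrightarrow> 0) at_top" for a
      proof (rule tendsto_divide_0[OF tendsto_const])
        have "filterlim (\<lambda>s::real. s\<^sup>2) at_top at_top"
          by (intro filterlim_pow_at_top filterlim_ident) auto
        hence "filterlim (\<lambda>s. complex_of_real (s\<^sup>2)) at_infinity at_top"
          by (simp add: filterlim_at_infinity_conv_norm_at_top norm_power)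
        thus "filterlim (\<lambda>s. complex_of_real (s\<^sup>2) - cnj a * z) at_infinity at_top"
          using tendsto_add_filterlim_at_infinity'[OF _ tendsto_const[of "- (cnj a * z)"]] by simp
      qed
      hence "((\<lambda>s. \<Sum>a\<in>A. of_int (zorder f a) * (cnj a / (complex_of_real (s\<^sup>2) - cnj a * z))) \<longlongrightarrow>
          (\<Sum>a\<in>A. of_int (zorder f a) * 0)) at_top"
        by (intro tendsto_sum tendsto_mult tendsto_const)
      thus ?thesis by (simp add: e_def[abs_def])
    qed
    have blim: "(b \<longlongrightarrow> 0) at_top" 
    proof -
      have "((\<lambda>s::real. cmod z / s) \<longlongrightarrow> 0) at_top"
        by (intro tendsto_divide_0[OF tendsto_const] filterlim_at_top_imp_at_infinity filterlim_ident)
      hence "((\<lambda>s. 2 * M * (1 / (1 - cmod z / s))\<^sup>2 * (ln s / s)) \<longlongrightarrow> 2 * M * (1 / (1 - 0))\<^sup>2 * 0) at_top"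
        by (intro tendsto_intros ln_x_over_x_tendsto_0) auto
      moreover have "eventually (\<lambda>s. 2 * M * (1 / (1 - cmod z / s))\<^sup>2 * (ln s / s) = b s) at_top"
        using eventually_gt_at_top[of 0]
      proof eventually_elim
        case (elim s)
        hence "1 - cmod z / s = (s - cmod z) / s" by (simp add: field_simps)
        thus ?case using elim by (simp add: b_def power_divide power2_eq_square)
      qed
      ultimately show ?thesis by (simp add: tendsto_cong)
    qed
    have le: "cmod (deriv f z / f z - S) \<le> b s + cmod (e s)"
      if s: "regular f s" "nev_T f s < K * ln s" "exp 1 \<le> s" "cmod z < s" "\<forall>a\<in>A. cmod a \<le> s" for s
    proof -
      have s0: "0 < s" using regular_pos[OF s(1)] .
      have "{a. cmod a \<le> s \<and> zorder f a \<noteq> 0} = A" using s(5) by (auto simp: A_def)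
      with log_deriv_bound[OF mf s(1,4) z]
      have "cmod (deriv f z / f z - (\<Sum>a\<in>A. of_int (zorder f a) * (1 / (z - a) + cnj a / (complex_of_real (s\<^sup>2) - cnj a * z))))
         \<le> 2 * s / (s - cmod z)\<^sup>2 * circle_mean (\<lambda>z. \<bar>ln (cmod (f z))\<bar>) s" by simp
      also have "\<dots> \<le> b s"
        unfolding b_def circle_mean_abs_ln[OF s(1)]
      proof (intro mult_left_mono)
        have "1 \<le> s" using s(3) exp_ge_add_one_self[of 1] by linarith
        hence "0 \<le> divisor_N (pole_mult f) s" "0 \<le> divisor_N (zero_mult f) s" by (auto intro!: divisor_N_nonneg)
        thus "prox f s + prox (\<lambda>z. inverse (f z)) s \<le> M * ln s" using both[OF s(1-3)] by linarith
      qed (use s0 in auto)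
      also have "(\<Sum>a\<in>A. of_int (zorder f a) * (1 / (z - a) + cnj a / (complex_of_real (s\<^sup>2) - cnj a * z))) = S + e s"
        by (simp add: S_def e_def distrib_left sum.distrib)
      finally have "cmod (deriv f z / f z - (S + e s)) \<le> b s" .
      moreover have "cmod (deriv f z / f z - S) \<le> cmod (deriv f z / f z - (S + e s)) + cmod (e s)"
        using norm_triangle_ineq[of "deriv f z / f z - (S + e s)" "e s"] by simp
      ultimately show ?thesis by linarith
    qed
    have small: "cmod (deriv f z / f z - S) \<le> \<epsilon>" if \<epsilon>: "0 < \<epsilon>" for \<epsilon>
    proof -
      have "((\<lambda>s. b s + cmod (e s)) \<longlongrightarrow> 0 + cmod 0) at_top"
        by (intro tendsto_intros blim elim)
      hence "eventually (\<lambda>s. b s + cmod (e s) < \<epsilon>) at_top"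
        using \<epsilon> by (intro order_tendstoD) auto
      moreover have "eventually (\<lambda>s. exp 1 \<le> s \<and> cmod z < s \<and> (\<forall>a\<in>A. cmod a \<le> s)) at_top"
        using finA by (auto intro!: eventually_conj eventually_ball_finite eventually_ge_at_top eventually_gt_at_top)
      ultimately have "eventually (\<lambda>s. b s + cmod (e s) < \<epsilon> \<and> exp 1 \<le> s \<and> cmod z < s \<and> (\<forall>a\<in>A. cmod a \<le> s)) at_top"
        by eventually_elim blast
      then obtain R where R: "\<And>s. R \<le> s \<Longrightarrow> b s + cmod (e s) < \<epsilon> \<and> exp 1 \<le> s \<and> cmod z < s \<and> (\<forall>a\<in>A. cmod a \<le> s)"
        by (auto simp: eventually_at_top_linorder)
      obtain s where s: "R \<le> s" "regular f s" "nev_T f s < K * ln s" using ex by blast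
      show ?thesis using le[of s] R[OF s(1)] s by force
    qed
    have "cmod (deriv f z / f z - S) \<le> 0"
    proof (rule field_le_epsilon)
      fix \<epsilon> :: real assume "0 < \<epsilon>"
      thus "cmod (deriv f z / f z - S) \<le> 0 + \<epsilon>" using small by simp
    qed
    thus ?thesis by (simp add: S_def)
  qed
  hence "\<not> transcendental_mero f"
    using finA unfolding A_def by (intro finite_divisor_log_deriv_imp_rational[OF nice mf])
  thus False using tr by simp
qed

section \<open>Tame and small functions\<close>

definition nev_majorant :: "(complex \<Rightarrow> complex) \<Rightarrow> real \<Rightarrow> real" where
  "nev_majorant f r = Sup (insert 1 {nev_T f s |s. 1 \<le> s \<and> s \<le> r \<and> regular f s})"

lemma nev_majorant_bdd:
  assumes "mero_nz f" "1 \<le> r"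
  shows "bdd_above (insert 1 {nev_T f s |s. 1 \<le> s \<and> s \<le> r \<and> regular f s})"
proof -
  obtain R where R: "r < R" "regular f R"
    using regular_radius_exists[OF assms(1), of r "r + 1"] assms(2) by auto
  have "nev_T f s \<le> nev_T f R" if "1 \<le> s" "s \<le> r" "regular f s" for s
    using that R by (intro nev_T_mono assms) auto
  thus ?thesis
    by (intro bdd_aboveI[of _ "max 1 (nev_T f R)"]) (force simp: le_max_iff_disj)
qed

lemma nev_majorant_ge_1: "mero_nz f \<Longrightarrow> 1 \<le> r \<Longrightarrow> 1 \<le> nev_majorant f r"
  unfolding nev_majorant_def by (intro cSup_upper nev_majorant_bdd) auto

lemma nev_T_le_majorant: "mero_nz f \<Longrightarrow> 1 \<le> r \<Longrightarrow> regular f r \<Longrightarrow> nev_T f r \<le> nev_majorant f r"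
  unfolding nev_majorant_def by (intro cSup_upper nev_majorant_bdd) auto

lemma nev_majorant_mono: "mero_nz f \<Longrightarrow> 1 \<le> r \<Longrightarrow> r \<le> s \<Longrightarrow> nev_majorant f r \<le> nev_majorant f s"
  unfolding nev_majorant_def by (intro cSup_subset_mono nev_majorant_bdd) force+

text \<open>Once the characteristic is at least 1, it equals its majorant at regular radii, so
  conclusions about the majorant return to \<open>f\<close> without loss.\<close>

lemma nev_majorant_le:
  assumes "mero_nz f" "1 \<le> r" "regular f r"
  shows "nev_majorant f r \<le> max 1 (nev_T f r)"
  unfolding nev_majorant_def
proof (rule cSup_least)
  fix x assume "x \<in> insert 1 {nev_T f s |s. 1 \<le> s \<and> s \<le> r \<and> regular f s}"
  then consider "x = 1" | s where "x = nev_T f s" "s \<le> r" "regular f s" by auto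
  thus "x \<le> max 1 (nev_T f r)"
  proof cases
    case (2 s)
    thus ?thesis using nev_T_mono[OF assms(1) 2(3) assms(3)] by (cases "s = r") (auto simp: le_max_iff_disj)
  qed auto
qed auto

section \<open>Function classes controlled by a growth majorant\<close>

locale growth_majorant =
  fixes \<tau> :: "real \<Rightarrow> real"
  assumes one_le: "1 \<le> r \<Longrightarrow> 1 \<le> \<tau> r"
    and mono: "1 \<le> r \<Longrightarrow> r \<le> s \<Longrightarrow> \<tau> r \<le> \<tau> s"
begin

text \<open>The shape of the error in \<open>log_deriv_lemma\<close>, with
  \<open>\<tau> (r + d)\<close> as the bound for the characteristic up to
  \<open>r + d\<close>.\<close>

definition growth :: "real \<Rightarrow> real \<Rightarrow> real" where
  "growth r d = 1 + ln (\<tau> (r + d)) + ln (r + 1) + ln (1 / d)"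

text \<open>An exponential bound is enough, because the logarithmic derivative lemma takes the
  logarithm of the characteristic, and it is coarse enough to survive products, powers and
  differentiation. \<open>C\<close> and \<open>N\<close> do not depend on the step, which can
  therefore be chosen last.\<close>

definition tame_with :: "real \<Rightarrow> real set \<Rightarrow> (complex \<Rightarrow> complex) \<Rightarrow> bool" where
  "tame_with C N g \<longleftrightarrow> 0 \<le> C \<and> countable N \<and> (\<forall>r. 1 \<le> r \<longrightarrow> r \<notin> N \<longrightarrow>
     regular g r \<and> (\<forall>d. 0 < d \<longrightarrow> d \<le> 1 \<longrightarrow> nev_T g r \<le> exp (C * growth r d)))"

definition tame :: "(complex \<Rightarrow> complex) \<Rightarrow> bool" where
  "tame g \<longleftrightarrow> mero_nz g \<and> (\<exists>C N. tame_with C N g)"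

text \<open>These are the error terms; only the proximity function is bounded. Here
  \<open>growth\<close> enters linearly and not through an exponential.\<close>

definition small_with :: "real \<Rightarrow> real set \<Rightarrow> (complex \<Rightarrow> complex) \<Rightarrow> bool" where
  "small_with C N u \<longleftrightarrow> 0 \<le> C \<and> countable N \<and> (\<forall>r. 1 \<le> r \<longrightarrow> r \<notin> N \<longrightarrow>
     continuous_on (sphere 0 r) u \<and> (\<forall>d. 0 < d \<longrightarrow> d \<le> 1 \<longrightarrow> prox u r \<le> C * growth r d))"

definition small :: "(complex \<Rightarrow> complex) \<Rightarrow> bool" where
  "small u \<longleftrightarrow> (\<exists>C N. small_with C N u)"

lemma tame_withD:
  assumes "tame_with C N g"
  shows "0 \<le> C" "countable N" "\<And>r. 1 \<le> r \<Longrightarrow> r \<notin> N \<Longrightarrow> regular g r"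
    "\<And>r d. 1 \<le> r \<Longrightarrow> r \<notin> N \<Longrightarrow> 0 < d \<Longrightarrow> d \<le> 1 \<Longrightarrow> nev_T g r \<le> exp (C * growth r d)"
  using assms by (simp_all add: tame_with_def)

lemma small_withD:
  assumes "small_with C N u"
  shows "0 \<le> C" "countable N" "\<And>r. 1 \<le> r \<Longrightarrow> r \<notin> N \<Longrightarrow> continuous_on (sphere 0 r) u"
    "\<And>r d. 1 \<le> r \<Longrightarrow> r \<notin> N \<Longrightarrow> 0 < d \<Longrightarrow> d \<le> 1 \<Longrightarrow> prox u r \<le> C * growth r d"
  using assms by (simp_all add: small_with_def)

lemma tameI:
  assumes "mero_nz g" "0 \<le> C" "countable N"
    "\<And>r d. 1 \<le> r \<Longrightarrow> r \<notin> N \<Longrightarrow> 0 < d \<Longrightarrow> d \<le> 1 \<Longrightarrow> regular g r \<Longrightarrow> nev_T g r \<le> exp (C * growth r d)"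
  shows "tame g"
proof -
  have "tame_with C (N \<union> {r. 0 < r \<and> \<not> regular g r}) g"
    using assms(2-4) countable_not_regular[OF assms(1)] by (auto simp: tame_with_def)
  thus ?thesis using assms(1) by (auto simp: tame_def)
qed

lemma smallI:
  assumes "0 \<le> C" "countable N" "\<And>r. 1 \<le> r \<Longrightarrow> r \<notin> N \<Longrightarrow> continuous_on (sphere 0 r) u"
    "\<And>r d. 1 \<le> r \<Longrightarrow> r \<notin> N \<Longrightarrow> 0 < d \<Longrightarrow> d \<le> 1 \<Longrightarrow> prox u r \<le> C * growth r d"
  shows "small u"
proof -
  have "small_with C N u" using assms by (simp add: small_with_def)
  thus ?thesis by (auto simp: small_def)
qed

lemma growth_ge_1:
  assumes "1 \<le> r" "0 < d" "d \<le> 1"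
  shows "1 \<le> growth r d"
proof -
  have "0 \<le> ln (\<tau> (r + d))" "0 \<le> ln (r + 1)" "0 \<le> ln (1 / d)"
    using assms one_le[of "r + d"] by auto
  thus ?thesis by (simp add: growth_def)
qed

text \<open>The extra \<open>w\<close> in the exponent pays for the factor 2, since
  \<open>2 \<le> exp w\<close> when \<open>1 \<le> w\<close>.\<close>

lemma exp_add_exp_le:
  fixes a b w :: real
  assumes "0 \<le> a" "0 \<le> b" "1 \<le> w"
  shows "exp (a * w) + exp (b * w) \<le> exp ((a + b + 1) * w)"
proof -
  have "exp (a * w) \<le> exp ((a + b) * w)" "exp (b * w) \<le> exp ((a + b) * w)"
    using assms by (auto simp: algebra_simps)
  hence "exp (a * w) + exp (b * w) \<le> 2 * exp ((a + b) * w)" by linarith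
  also have "2 \<le> exp w" using exp_ge_add_one_self[of w] assms(3) by linarith
  hence "2 * exp ((a + b) * w) \<le> exp w * exp ((a + b) * w)"
    by (intro mult_right_mono) auto
  also have "\<dots> = exp ((a + b + 1) * w)" by (simp add: exp_add[symmetric] algebra_simps)
  finally show ?thesis .
qed

lemma le_exp_mult:
  fixes a w :: real
  assumes "0 \<le> a" "1 \<le> w"
  shows "a * w \<le> exp (a * w)" "a \<le> exp (a * w)"
proof -
  show "a * w \<le> exp (a * w)" using exp_ge_add_one_self[of "a * w"] by linarith
  moreover have "a * 1 \<le> a * w" using assms by (intro mult_left_mono) auto
  ultimately show "a \<le> exp (a * w)" by linarith
qed

lemma tame_mero_nz: "tame g \<Longrightarrow> mero_nz g"
  by (simp add: tame_def)

lemma tame_mult: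
  assumes "tame g" "tame h"
  shows "tame (\<lambda>z. g z * h z)"
proof -
  note mg = tame_mero_nz[OF assms(1)] and mh = tame_mero_nz[OF assms(2)]
  obtain C N where "tame_with C N g" using assms(1) unfolding tame_def by blast
  note g = tame_withD[OF this]
  obtain C' N' where "tame_with C' N' h" using assms(2) unfolding tame_def by blast
  note h = tame_withD[OF this]
  show ?thesis
  proof (rule tameI)
    show "mero_nz (\<lambda>z. g z * h z)" by (intro mero_nz_mult mg mh)
    show "0 \<le> C + C' + 1" using g h by simp
    show "countable (N \<union> N')" using g h by simp
    fix r d :: real assume r: "1 \<le> r" "r \<notin> N \<union> N'" "0 < d" "d \<le> 1"
    have gg: "regular g r" "regular h r" using g(3) h(3) r by auto
    have "prox (\<lambda>z. g z * h z) r \<le> prox g r + prox h r"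
      using r by (intro prox_mult regular_continuous_on gg) auto
    moreover have "divisor_N (pole_mult (\<lambda>z. g z * h z)) r \<le> divisor_N (\<lambda>a. pole_mult g a + pole_mult h a) r"
      using r mg mh by (intro divisor_N_mono locally_finite_add locally_finite_pole_mult mero_nz_mult)
        (auto simp: pole_mult_def mero_nz_zorder_mult)
    moreover have "divisor_N (\<lambda>a. pole_mult g a + pole_mult h a) r = divisor_N (pole_mult g) r + divisor_N (pole_mult h) r"
      using mg mh by (intro divisor_N_add) auto
    ultimately have "nev_T (\<lambda>z. g z * h z) r \<le> nev_T g r + nev_T h r"
      using r mg mh by (simp add: nev_T_eq mero_nz_mult)
    also have "\<dots> \<le> exp (C * growth r d) + exp (C' * growth r d)"
      using g(4) h(4) r by (intro add_mono) auto
    also have "\<dots> \<le> exp ((C + C' + 1) * growth r d)"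
      using r by (intro exp_add_exp_le g h growth_ge_1)
    finally show "nev_T (\<lambda>z. g z * h z) r \<le> exp ((C + C' + 1) * growth r d)" .
  qed
qed

lemma tame_power:
  assumes "tame g"
  shows "tame (\<lambda>z. g z ^ n)"
proof -
  note mg = tame_mero_nz[OF assms(1)]
  obtain C N where "tame_with C N g" using assms(1) unfolding tame_def by blast
  note g = tame_withD[OF this]
  show ?thesis
  proof (rule tameI)
    show "mero_nz (\<lambda>z. g z ^ n)" by (intro mero_nz_power mg)
    show "0 \<le> real n + C" using g by simp
    show "countable N" by (rule g)
    fix r d :: real assume r: "1 \<le> r" "r \<notin> N" "0 < d" "d \<le> 1"
    have "pole_mult (\<lambda>z. g z ^ n) = (\<lambda>a. real n * pole_mult g a)"
    proof
      fix a
      have "nat (- (int n * zorder g a)) = n * nat (- zorder g a)"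
        using nat_mult_distrib[of "int n" "- zorder g a"] by simp
      thus "pole_mult (\<lambda>z. g z ^ n) a = real n * pole_mult g a"
        by (simp add: pole_mult_def mero_nz_zorder_power[OF mg])
    qed
    hence "nev_T (\<lambda>z. g z ^ n) r = real n * nev_T g r"
      using r mg by (simp add: nev_T_eq mero_nz_power prox_power divisor_N_cmult distrib_left)
    also have "\<dots> \<le> exp (real n * growth r d) * exp (C * growth r d)"
      using g(4)[OF r] nev_T_nonneg[OF mg g(3)[OF r(1,2)] r(1)] le_exp_mult(2)[of "real n" "growth r d"]
        growth_ge_1[OF r(1,3,4)]
      by (intro mult_mono) auto
    also have "\<dots> = exp ((real n + C) * growth r d)" by (simp add: exp_add distrib_right)
    finally show "nev_T (\<lambda>z. g z ^ n) r \<le> exp ((real n + C) * growth r d)" .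
  qed
qed

lemma pole_mult_sub_const:
  assumes "mero_nz g" "mero_nz (\<lambda>z. g z - c)" "c \<noteq> 0"
  shows "pole_mult (\<lambda>z. g z - c) a = pole_mult g a"
proof (cases "zorder g a < 0")
  case True
  have "zorder (\<lambda>z. g z - c) a = zorder g a"
    using True assms(3) mero_nz_const[OF assms(3)]
    by (intro zorder_diff1 mero_nzD[OF assms(1)] mero_nzD[OF mero_nz_const[OF assms(3)]]) auto
  thus ?thesis by (simp add: pole_mult_def)
next
  case False
  have "eventually (\<lambda>z. g z - c \<noteq> 0) (at a)" by (rule mero_nzD[OF assms(2)])
  hence "frequently (\<lambda>z. g z \<noteq> c) (at a)"
    by (intro eventually_frequently) (auto elim: eventually_mono)
  hence "0 \<le> zorder (\<lambda>z. g z - c) a"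
    using False assms(3)
    by (intro zorder_diff_ge mero_nzD[OF assms(1)] mero_nzD[OF mero_nz_const[OF assms(3)]]) auto
  thus ?thesis using False by (simp add: pole_mult_def)
qed

lemma tame_sub_one:
  assumes "tame g" "mero_nz (\<lambda>z. g z - 1)"
  shows "tame (\<lambda>z. g z - 1)"
proof -
  note mg = tame_mero_nz[OF assms(1)]
  obtain C N where "tame_with C N g" using assms(1) unfolding tame_def by blast
  note g = tame_withD[OF this]
  show ?thesis
  proof (rule tameI)
    show "0 \<le> C + 1 + 1" using g by simp
    show "countable N" by (rule g)
    fix r d :: real assume r: "1 \<le> r" "r \<notin> N" "0 < d" "d \<le> 1"
    have "prox (\<lambda>z. g z + (- 1)) r \<le> prox g r + prox (\<lambda>_. -1) r + ln 2"
      using r by (intro prox_add regular_continuous_on g(3) continuous_intros) auto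
    hence "prox (\<lambda>z. g z - 1) r \<le> prox g r + ln 2"
      by (simp add: prox_eq_circle_mean logplus_def)
    moreover have "pole_mult (\<lambda>z. g z - 1) = pole_mult g"
      by (intro ext pole_mult_sub_const mg assms) simp
    ultimately have "nev_T (\<lambda>z. g z - 1) r \<le> nev_T g r + ln 2"
      using r mg assms(2) by (simp add: nev_T_eq)
    also have "\<dots> \<le> exp (C * growth r d) + exp (1 * growth r d)"
      using g(4)[OF r] le_exp_mult(2)[of 1 "growth r d"] growth_ge_1[OF r(1,3,4)] ln_le_minus_one[of 2]
      by linarith
    also have "\<dots> \<le> exp ((C + 1 + 1) * growth r d)"
      using r by (intro exp_add_exp_le g growth_ge_1) auto
    finally show "nev_T (\<lambda>z. g z - 1) r \<le> exp ((C + 1 + 1) * growth r d)" .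
  qed (rule assms)
qed

lemma ln2_le_1: "ln (2::real) \<le> 1"
  using ln_le_minus_one[of 2] by simp

text \<open>The lemma on the logarithmic derivative asks for a bound at all regular radii of an
  interval, but tameness says nothing on \<open>N\<close>. Monotonicity of the characteristic brings
  the bound back from a slightly larger radius outside \<open>N\<close>, at the expense of a part of
  the step.\<close>

theorem tame_log_deriv_small:
  assumes "tame g"
  shows "small (\<lambda>z. deriv g z / g z)"
proof -
  note mg = tame_mero_nz[OF assms(1)]
  obtain C N where "tame_with C N g" using assms(1) unfolding tame_def by blast
  note g = tame_withD[OF this]
  obtain C1 where C1: "0 \<le> C1"
    and ld: "\<And>r d X. 1 \<le> r \<Longrightarrow> 0 < d \<Longrightarrow> d \<le> 1 \<Longrightarrow> 1 \<le> X \<Longrightarrow> regular g r \<Longrightarrow>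
      (\<forall>s. r \<le> s \<longrightarrow> s \<le> r + d \<longrightarrow> regular g s \<longrightarrow> nev_T g s \<le> X) \<Longrightarrow>
      prox (\<lambda>z. deriv g z / g z) r \<le> C1 * (1 + ln X + ln (r + 1) + ln (1 / d))"
    using log_deriv_lemma[OF mg] by blast
  show ?thesis
  proof (rule smallI)
    show "0 \<le> C1 * (4 * C + 2)" using C1 g(1) by simp
    show "countable N" by (rule g)
    show "continuous_on (sphere 0 r) (\<lambda>z. deriv g z / g z)" if "1 \<le> r" "r \<notin> N" for r
      by (intro regular_continuous_on_log_deriv g that)
    fix r d :: real assume r: "1 \<le> r" "r \<notin> N" "0 < d" "d \<le> 1"
    define X where "X = exp (4 * C * growth r d)"
    have W1: "1 \<le> growth r d" by (intro growth_ge_1 r)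
    have X: "1 \<le> X" unfolding X_def using g(1) W1 by simp
    have bound: "nev_T g s \<le> X" if s: "r \<le> s" "s \<le> r + d / 2" "regular g s" for s
    proof -
      \<comment> \<open>With the new step \<open>d / 4\<close> one stays below
        \<open>s' + d / 4 < r + d\<close>, so the same value of \<open>\<tau>\<close> still
        dominates.\<close>
      obtain s' where s': "r + d / 2 < s'" "s' < r + 3 * d / 4" "s' \<notin> N"
        using exists_avoiding_countable[OF g(2), of "r + d / 2" "r + 3 * d / 4"] r by auto
      have s1: "1 \<le> s'" using s' r by linarith
      have "nev_T g s \<le> nev_T g s'"
        using s s' by (intro nev_T_mono[OF mg s(3) g(3)[OF s1 s'(3)]]) auto
      also have "\<dots> \<le> exp (C * growth s' (d / 4))" using r s' s1 by (intro g(4)) auto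
      also have "\<dots> \<le> exp (C * (4 * growth r d))"
      proof -
        have "\<tau> (s' + d / 4) \<le> \<tau> (r + d)" using s' r s1 by (intro mono) auto
        moreover have "1 \<le> \<tau> (s' + d / 4)" using s1 r by (intro one_le) auto
        ultimately have a: "ln (\<tau> (s' + d / 4)) \<le> ln (\<tau> (r + d))" by simp
        have "ln (s' + 1) \<le> ln (2 * (r + 1))" using s' s1 r by (subst ln_le_cancel_iff) auto
        also have "\<dots> = ln 2 + ln (r + 1)" using r by (intro ln_mult_pos) auto
        finally have b: "ln (s' + 1) \<le> 1 + ln (r + 1)" using ln2_le_1 by linarith
        have "ln (1 / (d / 4)) = ln (2 * 2 * (1 / d))" by simp
        also have "\<dots> = ln 2 + ln 2 + ln (1 / d)" using r by (subst ln_mult_pos, simp, simp, subst ln_mult_pos) auto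
        finally have c: "ln (1 / (d / 4)) \<le> 2 + ln (1 / d)" using ln2_le_1 by linarith
        \<comment> \<open>The term \<open>ln (s' + 1)\<close> costs 1 and quartering the step costs
          \<open>ln 4\<close>, at most 2. As \<open>growth\<close> is at least 1, the sum is below
          four times it; hence the 4 in \<open>X\<close>.\<close>
        have "growth s' (d / 4) \<le> growth r d + 3" using a b c by (simp add: growth_def)
        also have "\<dots> \<le> 4 * growth r d" using W1 by simp
        finally show ?thesis using g(1) by (simp add: mult_left_mono)
      qed
      finally show ?thesis by (simp add: X_def mult_ac)
    qed
    have "prox (\<lambda>z. deriv g z / g z) r \<le> C1 * (1 + ln X + ln (r + 1) + ln (1 / (d / 2)))"
      using r X bound by (intro ld g(3)) auto
    also have "\<dots> \<le> C1 * ((4 * C + 2) * growth r d)"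
    proof (intro mult_left_mono C1)
      have "ln (1 / (d / 2)) = ln (2 * (1 / d))" by simp
      also have "\<dots> = ln 2 + ln (1 / d)" using r by (intro ln_mult_pos) auto
      finally have "ln (1 / (d / 2)) \<le> 1 + ln (1 / d)" using ln2_le_1 by linarith
      moreover have "1 + ln (r + 1) + ln (1 / d) \<le> growth r d"
        using one_le[of "r + d"] r by (simp add: growth_def)
      moreover have "ln X = 4 * C * growth r d" by (simp add: X_def)
      ultimately have "1 + ln X + ln (r + 1) + ln (1 / (d / 2)) \<le> 4 * C * growth r d + 2 * growth r d"
        using W1 by linarith
      thus "1 + ln X + ln (r + 1) + ln (1 / (d / 2)) \<le> (4 * C + 2) * growth r d"
        by (simp add: distrib_right)
    qed
    finally show "prox (\<lambda>z. deriv g z / g z) r \<le> C1 * (4 * C + 2) * growth r d" by (simp add: mult_ac)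
  qed
qed

text \<open>A pole of order \<open>p\<close> becomes one of order \<open>p + 1\<close>, which is at
  most \<open>2 * p\<close>.\<close>

lemma pole_mult_deriv_le:
  assumes "mero_nz g" "mero_nz (deriv g)"
  shows "pole_mult (deriv g) a \<le> 2 * pole_mult g a"
proof (cases "zorder g a < 0")
  case True
  have "zorder (deriv g) a = zorder g a - 1"
    using True mero_nzD(1,3)[OF assms(1)] meromorphic_on_isolated_singularity meromorphic_on_not_essential
    by (intro zorder_deriv_minus_1) auto
  thus ?thesis using True by (simp add: pole_mult_def)
next
  case False
  hence "\<not> is_pole (deriv g) a"
    using is_pole_deriv_iff[OF mero_nzD(1)[OF assms(1)]] mero_nz_is_pole_iff[OF assms(1)] by simp
  thus ?thesis using mero_nz_is_pole_iff[OF assms(2)] by (simp add: pole_mult_def)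
qed

text \<open>Writing the derivative as \<open>g * (deriv g / g)\<close> bounds its proximity function
  by that of \<open>g\<close> plus an error, and its poles at most double; so its characteristic is
  at most twice that of \<open>g\<close> plus an error.\<close>

lemma tame_deriv:
  assumes "tame g" "mero_nz (deriv g)"
  shows "tame (deriv g)"
proof -
  note mg = tame_mero_nz[OF assms(1)]
  obtain C N where "tame_with C N g" using assms(1) unfolding tame_def by blast
  note g = tame_withD[OF this]
  obtain C' N' where "small_with C' N' (\<lambda>z. deriv g z / g z)" using tame_log_deriv_small[OF assms(1)] unfolding small_def by blast
  note h = small_withD[OF this]
  show ?thesis
  proof (rule tameI)
    show "0 \<le> (C + C + 1) + C' + 1" using g h by simp
    show "countable (N \<union> N')" using g h by simp
    fix r d :: real assume r: "1 \<le> r" "r \<notin> N \<union> N'" "0 < d" "d \<le> 1"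
    have gr: "regular g r" using g(3) r by auto
    have W1: "1 \<le> growth r d" by (intro growth_ge_1 r)
    have "prox (deriv g) r = prox (\<lambda>z. g z * (deriv g z / g z)) r"
      using r regular_nonzero[OF gr] by (intro prox_cong) auto
    also have "\<dots> \<le> prox g r + prox (\<lambda>z. deriv g z / g z) r"
      using r by (intro prox_mult regular_continuous_on gr h) auto
    also have "prox (\<lambda>z. deriv g z / g z) r \<le> C' * growth r d" using r by (intro h(4)) auto
    finally have 1: "prox (deriv g) r \<le> prox g r + C' * growth r d" by simp
    have "divisor_N (pole_mult (deriv g)) r \<le> divisor_N (\<lambda>a. 2 * pole_mult g a) r"
      using r mg assms(2)
      by (intro divisor_N_mono locally_finite_cmult locally_finite_pole_mult pole_mult_deriv_le)
    hence 2: "divisor_N (pole_mult (deriv g)) r \<le> 2 * divisor_N (pole_mult g) r" by (simp add: divisor_N_cmult)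
    have "nev_T (deriv g) r = prox (deriv g) r + divisor_N (pole_mult (deriv g)) r"
      "nev_T g r = prox g r + divisor_N (pole_mult g) r"
      using r mg assms(2) by (simp_all add: nev_T_eq)
    hence "nev_T (deriv g) r \<le> (nev_T g r + nev_T g r) + C' * growth r d"
      using 1 2 prox_nonneg_regular[OF gr] by linarith
    also have "\<dots> \<le> (exp (C * growth r d) + exp (C * growth r d)) + exp (C' * growth r d)"
      using r W1 h(1) by (intro add_mono g(4) le_exp_mult) auto
    also have "\<dots> \<le> exp ((C + C + 1) * growth r d) + exp (C' * growth r d)"
      by (intro add_mono exp_add_exp_le g W1 order_refl)
    also have "\<dots> \<le> exp (((C + C + 1) + C' + 1) * growth r d)"
      using g(1) h(1) W1 by (intro exp_add_exp_le) auto
    finally show "nev_T (deriv g) r \<le> exp (((C + C + 1) + C' + 1) * growth r d)" .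
  qed (rule assms)
qed

lemma small_mult:
  assumes "small u" "small v"
  shows "small (\<lambda>z. u z * v z)"
proof -
  obtain C N where "small_with C N u" using assms(1) unfolding small_def by blast
  note u = small_withD[OF this]
  obtain C' N' where "small_with C' N' v" using assms(2) unfolding small_def by blast
  note v = small_withD[OF this]
  show ?thesis
  proof (rule smallI)
    show "0 \<le> C + C'" "countable (N \<union> N')" using u v by auto
    show "continuous_on (sphere 0 r) (\<lambda>z. u z * v z)" if "1 \<le> r" "r \<notin> N \<union> N'" for r
      using that by (intro continuous_intros u v) auto
    fix r d :: real assume r: "1 \<le> r" "r \<notin> N \<union> N'" "0 < d" "d \<le> 1"
    have "prox (\<lambda>z. u z * v z) r \<le> prox u r + prox v r"
      using r by (intro prox_mult u v) auto
    thus "prox (\<lambda>z. u z * v z) r \<le> (C + C') * growth r d"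
      using u(4)[of r d] v(4)[of r d] r by (simp add: distrib_right)
  qed
qed

lemma small_const: "small (\<lambda>_. c)"
proof (rule smallI[of "logplus (cmod c)" "{}"])
  fix r d :: real assume "1 \<le> r" "0 < d" "d \<le> 1"
  hence "logplus (cmod c) * 1 \<le> logplus (cmod c) * growth r d" by (intro mult_left_mono growth_ge_1) auto
  thus "prox (\<lambda>_. c) r \<le> logplus (cmod c) * growth r d" by (simp add: prox_eq_circle_mean)
qed auto

lemma small_power: "small u \<Longrightarrow> small (\<lambda>z. u z ^ n)"
  by (induction n) (auto intro: small_const small_mult)

lemma small_cong:
  assumes "small u" "countable M" "\<And>r z. 1 \<le> r \<Longrightarrow> r \<notin> M \<Longrightarrow> z \<in> sphere 0 r \<Longrightarrow> u z = v z"
  shows "small v"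
proof -
  obtain C N where "small_with C N u" using assms(1) unfolding small_def by blast
  note u = small_withD[OF this]
  show ?thesis
  proof (rule smallI[OF u(1), of "N \<union> M"])
    show "countable (N \<union> M)" using u assms(2) by simp
    show "continuous_on (sphere 0 r) v" if "1 \<le> r" "r \<notin> N \<union> M" for r
      using u(3)[of r] that assms(3) continuous_on_cong[of "sphere 0 r" "sphere 0 r" u v] by auto
    fix r d :: real assume r: "1 \<le> r" "r \<notin> N \<union> M" "0 < d" "d \<le> 1"
    have "prox v r = prox u r" using r assms(3) by (intro prox_cong) auto
    thus "prox v r \<le> C * growth r d" using u(4)[of r d] r by simp
  qed
qed

text \<open>The quotient telescopes into a product of logarithmic derivatives of successive
  derivatives.\<close>

lemma higher_deriv_quotient_small:
  assumes "\<And>j. j \<le> k \<Longrightarrow> tame ((deriv ^^ j) f)"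
  shows "small (\<lambda>z. (deriv ^^ k) f z / f z)"
  using assms
proof (induction k)
  case 0
  have "tame f" using 0[of 0] by simp
  show ?case
    by (rule small_cong[OF small_const countable_not_regular[OF tame_mero_nz[OF \<open>tame f\<close>]]])
       (auto simp: regular_def)
next
  case (Suc k)
  have tk: "tame ((deriv ^^ k) f)" using Suc.prems[of k] by simp
  have "small (\<lambda>z. deriv ((deriv ^^ k) f) z / (deriv ^^ k) f z * ((deriv ^^ k) f z / f z))"
    using Suc by (intro small_mult tame_log_deriv_small tk Suc.IH) auto
  thus ?case
    by (rule small_cong[OF _ countable_not_regular[OF tame_mero_nz[OF tk]]]) (auto simp: regular_def)
qed

end

section \<open>The main inequality\<close>

lemma deriv_sub_const:
  assumes "F analytic_on {w}"
  shows "deriv (\<lambda>z. F z - c) w = deriv F w"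
  using analytic_on_imp_differentiable_at[OF assms] by simp

text \<open>At a pole of \<open>f\<close>, the order of \<open>G' / G\<close> is -1, and the cost 1
  is at most half the multiplicity, which is at least 2. At a zero of order \<open>p\<close>,
  \<open>G' / G\<close> has order at least \<open>q0 * p - 1\<close>, which leaves at most
  \<open>qk * p + 1\<close>, hence at most \<open>(qk + 1) * p\<close>. Elsewhere its only poles are
  simple ones at the zeros of \<open>G\<close>.\<close>

lemma divisor_bound:
  fixes f :: "complex \<Rightarrow> complex" and k q0 qk :: nat
  defines "F \<equiv> (\<lambda>z. f z ^ q0 * (deriv ^^ k) f z ^ qk)"
  defines "G \<equiv> (\<lambda>z. F z - 1)"
  assumes mf: "mero_nz f" and mk: "mero_nz ((deriv ^^ k) f)"
    and mG: "mero_nz G" and mG': "mero_nz (deriv G)"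
    and ns: "zorder f a \<noteq> -1" and q0: "1 \<le> q0"
  shows "real (q0 + qk) * zero_mult f a - real_of_int (zorder (\<lambda>z. deriv G z / G z) a) \<le>
    (real qk + 1) * zero_mult f a + (1 / 2) * pole_mult f a + (if zorder G a > 0 then 1 else 0)"
proof -
  have mF: "mero_nz F" unfolding F_def by (intro mero_nz_mult mero_nz_power mf mk)
  have m1: "mero_nz (\<lambda>_. 1)" by (intro mero_nz_const) simp
  have oF: "zorder F a = int q0 * zorder f a + int qk * zorder ((deriv ^^ k) f) a"
    unfolding F_def by (simp add: mero_nz_zorder_mult mero_nz_power mero_nz_zorder_power mf mk)
  have oH: "zorder (\<lambda>z. deriv G z / G z) a = zorder (deriv G) a - zorder G a"
    by (intro mero_nz_zorder_divide mG mG')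
  have pk: "zorder ((deriv ^^ k) f) a < 0 \<longleftrightarrow> zorder f a < 0"
    using is_pole_higher_deriv_iff[of f k a] mero_nz_is_pole_iff[OF mf] mero_nz_is_pole_iff[OF mk] mf
    by (simp add: mero_nz_def)
  have dG: "zorder (deriv G) a = zorder G a - 1" if "zorder G a \<noteq> 0"
    using that mero_nzD(1,3)[OF mG] meromorphic_on_isolated_singularity meromorphic_on_not_essential
    by (intro zorder_deriv_minus_1) auto
  have freq: "frequently (\<lambda>z. F z \<noteq> 1) (at a)"
    using mero_nzD(3)[OF mG, of a] by (simp add: G_def)
  consider "zorder f a < 0" | "zorder f a > 0" | "zorder f a = 0" by linarith
  thus ?thesis
  proof cases
    case 1
    have "int q0 * zorder f a < 0" using 1 q0 by (simp add: mult_pos_neg)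
    moreover have "int qk * zorder ((deriv ^^ k) f) a \<le> 0" using 1 pk by (simp add: mult_nonneg_nonpos)
    ultimately have "zorder F a < 0" unfolding oF by linarith
    hence "zorder G a = zorder F a"
      unfolding G_def by (intro zorder_diff1 mero_nzD[OF mF] mero_nzD[OF m1]) auto
    with \<open>zorder F a < 0\<close> have "zorder (\<lambda>z. deriv G z / G z) a = -1" using dG oH by simp
    moreover have "2 \<le> pole_mult f a" "zero_mult f a = 0" using 1 ns by (auto simp: pole_mult_def zero_mult_def)
    ultimately show ?thesis by simp
  next
    case 2
    have "0 \<le> int qk * zorder ((deriv ^^ k) f) a" using 2 pk by simp
    hence ge: "int q0 * zorder f a \<le> zorder F a" unfolding oF by simp
    moreover have "0 < int q0 * zorder f a" using 2 q0 by simp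
    ultimately have pos: "0 < zorder F a" by linarith
    hence G0: "zorder G a = 0"
      unfolding G_def by (subst zorder_diff2) (auto intro: mero_nzD[OF mF] mero_nzD[OF m1])
    have "eventually (\<lambda>w. F analytic_on {w}) (at a)"
      using meromorphic_on_imp_analytic_cosparse[OF mero_nzD(1)[OF mF, of UNIV]]
      by (auto simp: eventually_cosparse_open_eq)
    hence "eventually (\<lambda>w. deriv G w = deriv F w) (at a)"
      unfolding G_def by eventually_elim (rule deriv_sub_const)
    hence "zorder (deriv G) a = zorder (deriv F) a" by (rule zorder_cong) simp
    also have "\<dots> = zorder F a - 1"
      using pos mero_nzD(1,3)[OF mF] meromorphic_on_isolated_singularity meromorphic_on_not_essential
      by (intro zorder_deriv_minus_1) auto
    finally have oH': "zorder (\<lambda>z. deriv G z / G z) a = zorder F a - 1" using oH G0 by simp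
    have "int (q0 + qk) * zorder f a - zorder (\<lambda>z. deriv G z / G z) a \<le> (int qk + 1) * zorder f a"
      using ge 2 unfolding oH' by (simp add: algebra_simps)
    hence "real_of_int (int (q0 + qk) * zorder f a - zorder (\<lambda>z. deriv G z / G z) a) \<le>
        real_of_int ((int qk + 1) * zorder f a)" by (simp only: of_int_le_iff)
    moreover have "zero_mult f a = real_of_int (zorder f a)" "pole_mult f a = 0"
      using 2 by (auto simp: zero_mult_def pole_mult_def)
    ultimately show ?thesis using G0 by simp
  next
    case 3
    have z: "zero_mult f a = 0" "pole_mult f a = 0" using 3 by (auto simp: zero_mult_def pole_mult_def)
    have "0 \<le> zorder F a" using 3 pk unfolding oF by simp
    hence G0: "0 \<le> zorder G a"
      unfolding G_def by (intro zorder_diff_ge mero_nzD[OF mF] mero_nzD[OF m1] freq) auto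
    show ?thesis
    proof (cases "zorder G a = 0")
      case True
      hence "\<not> is_pole (deriv G) a"
        using is_pole_deriv_iff[OF mero_nzD(1)[OF mG]] mero_nz_is_pole_iff[OF mG] by simp
      hence "0 \<le> zorder (deriv G) a" using mero_nz_is_pole_iff[OF mG'] by simp
      thus ?thesis using True z oH by simp
    next
      case False
      thus ?thesis using G0 z dG oH by simp
    qed
  qed
qed

context growth_majorant
begin

lemma tame_higher_deriv:
  assumes "tame f" "\<And>j. mero_nz ((deriv ^^ j) f)"
  shows "tame ((deriv ^^ j) f)"
proof (induction j)
  case (Suc j)
  thus ?case using tame_deriv[OF Suc] assms(2)[of "Suc j"] by simp
qed (use assms in simp)

theorem main_inequality:
  fixes f :: "complex \<Rightarrow> complex" and k q0 qk :: nat
  defines "F \<equiv> (\<lambda>z. f z ^ q0 * (deriv ^^ k) f z ^ qk)"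
  defines "G \<equiv> (\<lambda>z. F z - 1)"
  assumes tf: "tame f" and mj: "\<And>j. mero_nz ((deriv ^^ j) f)"
    and mG: "mero_nz G" and mG': "mero_nz (deriv G)"
    and ns: "\<And>a. zorder f a \<noteq> -1" and q0: "1 \<le> q0"
  shows "\<exists>C N. countable N \<and> (\<forall>r d. 1 \<le> r \<longrightarrow> r \<notin> N \<longrightarrow> 0 < d \<longrightarrow> d \<le> 1 \<longrightarrow>
    (real q0 - 3 / 2) * nev_T f r \<le> zero_Nbar G r + C * growth r d)"
proof -
  note mf = tame_mero_nz[OF tf]
  note tj = tame_higher_deriv[OF tf mj]
  define n where "n = q0 + qk"
  define A where "A z = (deriv ^^ k) f z / f z" for z
  define H where "H z = deriv G z / G z" for z
  define s1 where "s1 z = A z ^ qk" for z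
  define s2 where "s2 z = -1 * (A z ^ qk * (deriv F z / F z))" for z
  have tF: "tame F" unfolding F_def by (intro tame_mult tame_power tf tj)
  have tG: "tame G" unfolding G_def by (rule tame_sub_one[OF tF mG[unfolded G_def]])
  have mH: "mero_nz H" unfolding H_def by (intro mero_nz_divide mG mG')
  have sA: "small A" unfolding A_def by (intro higher_deriv_quotient_small tj)
  have "small s1" unfolding s1_def by (intro small_power sA)
  then obtain C1 N1 where "small_with C1 N1 s1" unfolding small_def by blast
  note s1 = small_withD[OF this]
  have "small s2" unfolding s2_def
    by (intro small_mult small_const small_power sA tame_log_deriv_small tF)
  then obtain C2 N2 where "small_with C2 N2 s2" unfolding small_def by blast
  note s2 = small_withD[OF this]
  have "small H" unfolding H_def by (intro tame_log_deriv_small tG)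
  then obtain C3 N3 where "small_with C3 N3 H" unfolding small_def by blast
  note sH = small_withD[OF this]
  define cf where "cf = ln (cmod (zor_poly f 0 0))"
  define cH where "cH = ln (cmod (zor_poly H 0 0))"
  \<comment> \<open>Bounded terms: \<open>ln 2\<close> from splitting a sum, \<open>cH\<close> from
    Jensen's formula for \<open>H\<close>, and \<open>cf\<close> once for each use of the first main
    theorem, with its coefficient. All are absorbed because \<open>growth\<close> is at least
    1.\<close>
  define K where "K = ln 2 + \<bar>cH\<bar> + real n * \<bar>cf\<bar> + (real qk + 1) * \<bar>cf\<bar>"
  define N where "N = N1 \<union> N2 \<union> N3 \<union> {r. 0 < r \<and> \<not> regular f r} \<union>
    {r. 0 < r \<and> \<not> regular ((deriv ^^ k) f) r} \<union> {r. 0 < r \<and> \<not> regular G r} \<union> {r. 0 < r \<and> \<not> regular (deriv G) r}"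
  show ?thesis
  proof (intro exI[of _ "C1 + C2 + C3 + K"] exI[of _ N] conjI allI impI)
    show "countable N"
      unfolding N_def using s1(2) s2(2) sH(2) mf mj mG mG' by (simp add: countable_not_regular)
    fix r d :: real assume r: "1 \<le> r" "r \<notin> N" "0 < d" "d \<le> 1"
    have r0: "0 < r" using r by simp
    have rN: "r \<notin> N1" "r \<notin> N2" "r \<notin> N3" using r by (auto simp: N_def)
    have gf: "regular f r" and gk: "regular ((deriv ^^ k) f) r" and gG: "regular G r" and gG': "regular (deriv G) r"
      using r by (auto simp: N_def)
    have gH: "regular H r" unfolding H_def by (intro regular_divide gG gG')
    have W1: "1 \<le> growth r d" by (intro growth_ge_1 r)
    define T where "T = nev_T f r"
    \<comment> \<open>The core is \<open>1 / F = 1 - (F - 1) / F\<close>, where \<open>F - 1\<close>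
      is rewritten as \<open>F' / H\<close>, and \<open>1 / f ^ n\<close> is \<open>1 / F\<close>
      times the power of \<open>A\<close>.\<close>
    have id: "inverse (f z) ^ n = s1 z + s2 z * inverse (H z)" if z: "z \<in> sphere 0 r" for z
    proof -
      have "F analytic_on {z}"
        unfolding F_def using gf gk z by (intro analytic_intros) (auto simp: regular_def)
      hence D: "deriv G z = deriv F z" unfolding G_def by (rule deriv_sub_const)
      define a b u where "a = f z" and "b = (deriv ^^ k) f z" and "u = deriv F z"
      have nz: "a \<noteq> 0" "b \<noteq> 0" "u \<noteq> 0"
        using regular_nonzero[OF gf z] regular_nonzero[OF gk z] regular_nonzero[OF gG' z]
        by (simp_all add: a_def b_def u_def D)
      have Fz: "F z = a ^ q0 * b ^ qk" by (simp add: F_def a_def b_def)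
      have Fnz: "F z \<noteq> 0" using nz by (simp add: Fz)
      have "s1 z + s2 z * inverse (H z) = (b / a) ^ qk * (1 - u / F z * (G z / u))"
        unfolding s1_def s2_def H_def A_def D a_def[symmetric] b_def[symmetric] u_def[symmetric]
        by (simp add: algebra_simps)
      also have "1 - u / F z * (G z / u) = 1 / F z"
        using nz Fnz by (simp add: G_def field_simps)
      also have "(b / a) ^ qk * (1 / F z) = inverse a ^ n"
        using nz by (simp add: Fz n_def power_add power_divide power_inverse field_simps)
      finally show ?thesis by (simp add: a_def)
    qed
    have "real n * prox (\<lambda>z. inverse (f z)) r = prox (\<lambda>z. inverse (f z) ^ n) r"
      by (rule prox_power[symmetric])
    also have "\<dots> = prox (\<lambda>z. s1 z + s2 z * inverse (H z)) r"
      using r0 id by (intro prox_cong) auto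
    also have "\<dots> \<le> prox s1 r + prox (\<lambda>z. s2 z * inverse (H z)) r + ln 2"
      using r0 rN r by (intro prox_add continuous_intros s1 s2 regular_continuous_on[OF gH] ballI regular_nonzero[OF gH]) auto
    also have "prox (\<lambda>z. s2 z * inverse (H z)) r \<le> prox s2 r + prox (\<lambda>z. inverse (H z)) r"
      using r0 rN r by (intro prox_mult s2 regular_continuous_on[OF regular_inverse[OF gH]]) auto
    also have "prox (\<lambda>z. inverse (H z)) r = prox H r - divisor_N (\<lambda>a. real_of_int (zorder H a)) r - cH"
      using prox_sub_prox_inverse[OF mH gH] by (simp add: cH_def)
    finally have "real n * prox (\<lambda>z. inverse (f z)) r \<le>
        prox s1 r + prox s2 r + prox H r - divisor_N (\<lambda>a. real_of_int (zorder H a)) r - cH + ln 2" by simp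
    moreover have "prox s1 r \<le> C1 * growth r d" "prox s2 r \<le> C2 * growth r d" "prox H r \<le> C3 * growth r d"
      using s1(4) s2(4) sH(4) rN r by auto
    ultimately have 1: "real n * prox (\<lambda>z. inverse (f z)) r \<le>
        (C1 + C2 + C3) * growth r d - divisor_N (\<lambda>a. real_of_int (zorder H a)) r + \<bar>cH\<bar> + ln 2"
      unfolding distrib_right by linarith
    have T1: "T = prox (\<lambda>z. inverse (f z)) r + divisor_N (zero_mult f) r + cf"
      unfolding T_def cf_def by (rule first_main_theorem[OF mf gf])
    have T2: "T = prox f r + divisor_N (pole_mult f) r" unfolding T_def by (rule nev_T_eq[OF mf r0])
    have "real n * T = real n * prox (\<lambda>z. inverse (f z)) r + real n * divisor_N (zero_mult f) r + real n * cf"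
      unfolding T1 by (simp add: algebra_simps)
    moreover have "real n * cf \<le> real n * \<bar>cf\<bar>" by (intro mult_left_mono) auto
    moreover have "real n * divisor_N (zero_mult f) r - divisor_N (\<lambda>a. real_of_int (zorder H a)) r =
        divisor_N (\<lambda>a. real n * zero_mult f a - real_of_int (zorder H a)) r"
      using mf mH by (simp add: divisor_N_diff locally_finite_cmult divisor_N_cmult)
    moreover have "divisor_N (\<lambda>a. real n * zero_mult f a - real_of_int (zorder H a)) r \<le>
        divisor_N (\<lambda>a. (real qk + 1) * zero_mult f a + (1 / 2) * pole_mult f a + (if zorder G a > 0 then 1 else 0)) r"
    proof (rule divisor_N_mono)
      have "locally_finite (\<lambda>a. real n * zero_mult f a + (-1) * real_of_int (zorder H a))"
        using mf mH by (intro locally_finite_add locally_finite_cmult) auto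
      thus "locally_finite (\<lambda>a. real n * zero_mult f a - real_of_int (zorder H a))" by simp
      show "locally_finite (\<lambda>a. (real qk + 1) * zero_mult f a + (1 / 2) * pole_mult f a + (if zorder G a > 0 then 1 else 0))"
        by (intro locally_finite_add locally_finite_cmult
          locally_finite_zero_mult[OF mf] locally_finite_pole_mult[OF mf]
          locally_finiteI[OF mG]) simp
      fix a show "real n * zero_mult f a - real_of_int (zorder H a) \<le>
          (real qk + 1) * zero_mult f a + (1 / 2) * pole_mult f a + (if zorder G a > 0 then 1 else 0)"
        using divisor_bound[OF mf mj mG[unfolded G_def F_def] mG'[unfolded G_def F_def] ns q0, of a]
        unfolding n_def H_def G_def F_def .
    qed (rule r)
    moreover have "divisor_N (\<lambda>a. (real qk + 1) * zero_mult f a + (1 / 2) * pole_mult f a + (if zorder G a > 0 then 1 else 0)) r =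
        (real qk + 1) * divisor_N (zero_mult f) r + (1 / 2) * divisor_N (pole_mult f) r + zero_Nbar G r"
    proof -
      have lf: "locally_finite (\<lambda>a. if zorder G a > 0 then 1 else 0)"
        by (rule locally_finiteI[OF mG]) simp
      have lf1: "locally_finite (\<lambda>a. (real qk + 1) * zero_mult f a)"
        "locally_finite (\<lambda>a. (1 / 2) * pole_mult f a)"
        using mf by (auto intro!: locally_finite_cmult simp del: times_divide_eq_left)
      show ?thesis
        unfolding divisor_N_add[OF locally_finite_add[OF lf1] lf] divisor_N_add[OF lf1] divisor_N_cmult
          zero_Nbar_eq_divisor_N[OF mG r0] by simp
    qed
    moreover have "(real qk + 1) * divisor_N (zero_mult f) r \<le> (real qk + 1) * (T + \<bar>cf\<bar>)"
      using T1 prox_nonneg_regular[OF regular_inverse[OF gf]] by (intro mult_left_mono) auto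
    hence "(real qk + 1) * divisor_N (zero_mult f) r \<le> (real qk + 1) * T + (real qk + 1) * \<bar>cf\<bar>"
      by (simp only: distrib_left)
    moreover have "divisor_N (pole_mult f) r \<le> T" using T2 prox_nonneg_regular[OF gf] by simp
    moreover have "K * 1 \<le> K * growth r d" using W1 by (intro mult_left_mono) (auto simp: K_def)
    ultimately have "real n * T \<le> (C1 + C2 + C3) * growth r d + K * growth r d + (real qk + 1) * T + (1 / 2) * T + zero_Nbar G r"
      using 1 K_def by linarith
    \<comment> \<open>The coefficient is \<open>n - (qk + 1) - 1 / 2\<close> with
      \<open>n = q0 + qk\<close>.\<close>
    thus "(real q0 - 3 / 2) * nev_T f r \<le> zero_Nbar G r + (C1 + C2 + C3 + K) * growth r d"
      unfolding T_def[symmetric] n_def by (simp add: algebra_simps)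
  qed
qed

text \<open>This serves to exclude a constant \<open>F\<close>, for which \<open>H\<close> would
  vanish. A zero of \<open>f\<close> is no pole of the derivative and would be a zero of
  \<open>F\<close>, so \<open>f\<close> has no zeros; and \<open>1 / f ^ n\<close> is a constant
  multiple of a small function. The first main theorem then makes the characteristic of
  \<open>f\<close> itself an error term.\<close>

theorem constant_case_inequality:
  fixes f :: "complex \<Rightarrow> complex" and k q0 qk :: nat
  defines "F \<equiv> (\<lambda>z. f z ^ q0 * (deriv ^^ k) f z ^ qk)"
  assumes tf: "tame f" and mj: "\<And>j. mero_nz ((deriv ^^ j) f)" and q0: "1 \<le> q0"
    and const: "eventually (\<lambda>z. F z = c) (cosparse UNIV)"
  shows "\<exists>C N. countable N \<and> (\<forall>r d. 1 \<le> r \<longrightarrow> r \<notin> N \<longrightarrow> 0 < d \<longrightarrow> d \<le> 1 \<longrightarrow>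
    nev_T f r \<le> C * growth r d)"
proof -
  note mf = tame_mero_nz[OF tf]
  note tj = tame_higher_deriv[OF tf mj]
  have mF: "mero_nz F" unfolding F_def by (intro mero_nz_mult mero_nz_power mf mj)
  define n where "n = q0 + qk"
  define s where "s z = ((deriv ^^ k) f z / f z) ^ qk * inverse c" for z
  have Fc: "eventually (\<lambda>z. F z = c) (at a)" for a
    using const by (auto simp: eventually_cosparse_open_eq)
  have limc: "F \<midarrow>a\<rightarrow> c" for a using tendsto_cong[OF Fc[of a]] by simp
  have c0: "c \<noteq> 0"
  proof
    assume "c = 0"
    have "eventually (\<lambda>z. F z = c \<and> F z \<noteq> 0) (at 0)"
      by (intro eventually_conj Fc mero_nzD(2)[OF mF])
    hence "eventually (\<lambda>z. False) (at (0::complex))"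
      by (rule eventually_mono) (simp add: \<open>c = 0\<close>)
    thus False by simp
  qed
  have nozero: "zorder f a \<le> 0" for a
  proof (rule ccontr)
    assume "\<not> zorder f a \<le> 0"
    hence pos: "0 < zorder f a" by simp
    have "\<not> zorder ((deriv ^^ k) f) a < 0"
      using pos is_pole_higher_deriv_iff[of f k a] mero_nz_is_pole_iff[OF mf] mero_nz_is_pole_iff[OF mj] mf
      by (simp add: mero_nz_def)
    hence "0 \<le> int qk * zorder ((deriv ^^ k) f) a" by simp
    moreover have "0 < int q0 * zorder f a" using pos q0 by simp
    ultimately have "0 < zorder F a"
      unfolding F_def by (simp add: mero_nz_zorder_mult mero_nz_power mero_nz_zorder_power mf mj)
    hence "F \<midarrow>a\<rightarrow> 0" by (simp add: mero_nz_tendsto_0_iff[OF mF])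
    from tendsto_unique[OF at_neq_bot limc this] c0 show False by simp
  qed
  have "small s" unfolding s_def by (intro small_mult small_power small_const higher_deriv_quotient_small tj)
  then obtain C1 N1 where "small_with C1 N1 s" unfolding small_def by blast
  note s = small_withD[OF this]
  define cf where "cf = ln (cmod (zor_poly f 0 0))"
  define N where "N = N1 \<union> {r. 0 < r \<and> \<not> regular f r} \<union> {r. 0 < r \<and> \<not> regular ((deriv ^^ k) f) r}"
  show ?thesis
  proof (intro exI[of _ "C1 + \<bar>cf\<bar>"] exI[of _ N] conjI allI impI)
    show "countable N"
      unfolding N_def using s(2) mf mj by (simp add: countable_not_regular)
    fix r d :: real assume r: "1 \<le> r" "r \<notin> N" "0 < d" "d \<le> 1"
    have r0: "0 < r" using r by simp
    have gf: "regular f r" and gk: "regular ((deriv ^^ k) f) r" and rN1: "r \<notin> N1" using r by (auto simp: N_def)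
    have W1: "1 \<le> growth r d" by (intro growth_ge_1 r)
    have id: "inverse (f z) ^ n = s z" if z: "z \<in> sphere 0 r" for z
    proof -
      have "F analytic_on {z}"
        unfolding F_def using gf gk z by (intro analytic_intros) (auto simp: regular_def)
      hence "F \<midarrow>z\<rightarrow> F z" by (intro isContD analytic_at_imp_isCont)
      from tendsto_unique[OF at_neq_bot this limc] have "F z = c" .
      moreover have "f z \<noteq> 0" "(deriv ^^ k) f z \<noteq> 0" using regular_nonzero[OF gf z] regular_nonzero[OF gk z] .
      ultimately show ?thesis
        using c0 unfolding s_def n_def by (simp add: F_def power_add power_divide power_inverse field_simps)
    qed
    have "divisor_N (zero_mult f) r = 0" using nozero by (simp add: divisor_N_def zero_mult_def)
    hence T: "nev_T f r = prox (\<lambda>z. inverse (f z)) r + cf"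
      using first_main_theorem[OF mf gf] by (simp add: cf_def)
    have p0: "0 \<le> prox (\<lambda>z. inverse (f z)) r" by (intro prox_nonneg_regular regular_inverse gf)
    have "1 * prox (\<lambda>z. inverse (f z)) r \<le> real n * prox (\<lambda>z. inverse (f z)) r"
      using q0 p0 by (intro mult_right_mono) (auto simp: n_def)
    also have "\<dots> = prox (\<lambda>z. inverse (f z) ^ n) r" by (rule prox_power[symmetric])
    also have "\<dots> = prox s r" using r0 id by (intro prox_cong) auto
    also have "\<dots> \<le> C1 * growth r d" using s(4) r rN1 by auto
    finally have "nev_T f r \<le> C1 * growth r d + \<bar>cf\<bar>" unfolding T by simp
    moreover have "\<bar>cf\<bar> * 1 \<le> \<bar>cf\<bar> * growth r d" using W1 by (intro mult_left_mono) auto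
    ultimately show "nev_T f r \<le> (C1 + \<bar>cf\<bar>) * growth r d" by (simp add: distrib_right)
  qed
qed

end

section \<open>The majorant of \<open>f\<close> itself and the final choice of the step\<close>

lemma growth_majorant_nev_majorant: "mero_nz f \<Longrightarrow> growth_majorant (nev_majorant f)"
  by unfold_locales (auto intro: nev_majorant_ge_1 nev_majorant_mono)

lemma tame_self:
  assumes "mero_nz f"
  shows "growth_majorant.tame (nev_majorant f) f"
proof -
  interpret growth_majorant "nev_majorant f" by (rule growth_majorant_nev_majorant[OF assms])
  show ?thesis
  proof (rule tameI[of f 1 "{}", OF assms])
    fix r d :: real assume r: "1 \<le> r" "0 < d" "d \<le> 1" "regular f r"
    have "nev_T f r \<le> nev_majorant f (r + d)"
      using nev_T_le_majorant[OF assms r(1,4)] mono[OF r(1), of "r + d"] r by linarith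
    also have "\<dots> = exp (ln (nev_majorant f (r + d)))"
      using one_le[of "r + d"] r by simp
    also have "\<dots> \<le> exp (1 * growth r d)"
      using r by (simp add: growth_def)
    finally show "nev_T f r \<le> exp (1 * growth r d)" .
  qed auto
qed

text \<open>With \<open>d\<close> the reciprocal of the characteristic, Borel's lemma bounds
  \<open>growth\<close> by a constant plus multiples of \<open>ln T\<close> and \<open>ln r\<close>;
  the former is small against \<open>T\<close> trivially, the latter by transcendence.
  \<open>E\<close> comes from Borel's lemma alone and hence serves all \<open>C\<close> and
  \<open>\<epsilon>\<close>.\<close>

lemma growth_absorbed:
  assumes nice: "f nicely_meromorphic_on UNIV" and tr: "transcendental_mero f"
  obtains E where "E \<in> sets lebesgue" "emeasure lebesgue E < \<infinity>"
    "\<And>C \<epsilon>. 0 < \<epsilon> \<Longrightarrow> \<exists>R\<ge>1. \<forall>r\<ge>R. r \<notin> E \<longrightarrow> regular f r \<longrightarrow> 1 \<le> nev_T f r \<and>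
      (\<exists>d. 0 < d \<and> d \<le> 1 \<and> C * growth_majorant.growth (nev_majorant f) r d \<le> \<epsilon> * nev_T f r)"
proof -
  have mf: "mero_nz f" by (rule transcendental_meroI[OF nice tr])
  interpret growth_majorant "nev_majorant f" by (rule growth_majorant_nev_majorant[OF mf])
  obtain E where E: "E \<in> sets lebesgue" "emeasure lebesgue E < \<infinity>"
    and grow: "\<And>r. 1 \<le> r \<Longrightarrow> r \<notin> E \<Longrightarrow> nev_majorant f (r + 1 / nev_majorant f r) < 4 * nev_majorant f r"
    using borel_growth_lemma[of "nev_majorant f", OF mono one_le] by blast
  show ?thesis
  proof (rule that[OF E])
    fix C \<epsilon> :: real assume \<epsilon>: "0 < \<epsilon>"
    define C' where "C' = \<bar>C\<bar>"
    have C': "0 \<le> C'" "C \<le> C'" by (auto simp: C'_def)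
    have "((\<lambda>t. C' * (1 + ln 8) * (1 / t) + 2 * C' * (ln t / t)) \<longlongrightarrow> C' * (1 + ln 8) * 0 + 2 * C' * 0) at_top"
      by (intro tendsto_intros ln_x_over_x_tendsto_0 tendsto_divide_0[OF tendsto_const]
          filterlim_at_top_imp_at_infinity filterlim_ident)
    hence "eventually (\<lambda>t. C' * (1 + ln 8) * (1 / t) + 2 * C' * (ln t / t) < \<epsilon> / 2) at_top"
      using \<epsilon> by (intro order_tendstoD) auto
    then obtain T0 where T0: "\<And>t. T0 \<le> t \<Longrightarrow> C' * (1 + ln 8) * (1 / t) + 2 * C' * (ln t / t) < \<epsilon> / 2"
      by (auto simp: eventually_at_top_linorder)
    \<comment> \<open>The multiple 1 of \<open>ln r\<close> forces the characteristic beyond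
      \<open>T0\<close> and 1. The multiple \<open>2 * C' / \<epsilon>\<close> below makes
      \<open>C' * ln r\<close> at most half of the allowed error; the other half is for the terms
      governed by \<open>T0\<close>.\<close>
    obtain R1 where R1: "\<forall>r\<ge>R1. regular f r \<longrightarrow> 1 * ln r \<le> nev_T f r"
      using transcendental_ln_le_nev_T[OF nice tr] by blast
    obtain R2 where R2: "\<forall>r\<ge>R2. regular f r \<longrightarrow> (2 * C' / \<epsilon>) * ln r \<le> nev_T f r"
      using transcendental_ln_le_nev_T[OF nice tr] by blast
    define R where "R = max (max R1 R2) (max 1 (exp (max T0 1)))"
    show "\<exists>R\<ge>1. \<forall>r\<ge>R. r \<notin> E \<longrightarrow> regular f r \<longrightarrow> 1 \<le> nev_T f r \<and>
      (\<exists>d. 0 < d \<and> d \<le> 1 \<and> C * growth r d \<le> \<epsilon> * nev_T f r)"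
    proof (rule exI[of _ R], intro conjI allI impI)
      show "1 \<le> R" by (simp add: R_def le_max_iff_disj)
      fix r assume r: "R \<le> r" "r \<notin> E" "regular f r"
      have "1 \<le> R" by (simp add: R_def le_max_iff_disj)
      define t where "t = nev_T f r"
      have r': "R1 \<le> r" "R2 \<le> r" "1 \<le> r" "exp (max T0 1) \<le> r"
        using r(1) \<open>1 \<le> R\<close> by (auto simp: R_def)
      have "max T0 1 \<le> ln r" using r'(3,4) by (simp add: ln_ge_iff del: max.bounded_iff)
      also have "ln r \<le> t" using R1 r' r(3) by (simp add: t_def)
      finally have t: "T0 \<le> t" "1 \<le> t" by auto
      show "1 \<le> nev_T f r" using t by (simp add: t_def)
      \<comment> \<open>Hence the step \<open>1 / t\<close> chosen next is exactly the one in
        Borel's lemma.\<close>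
      have \<tau>: "nev_majorant f r = t"
        using nev_majorant_le[OF mf r'(3) r(3)] nev_T_le_majorant[OF mf r'(3) r(3)] t
        by (simp add: t_def max_def split: if_splits)
      define d where "d = 1 / t"
      have d: "0 < d" "d \<le> 1" using t by (auto simp: d_def)
      have "nev_majorant f (r + d) < 4 * t" using grow[OF r'(3) r(2)] by (simp add: \<tau> d_def)
      moreover have "1 \<le> nev_majorant f (r + d)" using r' d by (intro one_le) auto
      ultimately have "ln (nev_majorant f (r + d)) \<le> ln (4 * t)" by (subst ln_le_cancel_iff) auto
      also have "\<dots> = ln 4 + ln t" using t by (intro ln_mult_pos) auto
      finally have a: "ln (nev_majorant f (r + d)) \<le> ln 4 + ln t" .
      have "ln (r + 1) \<le> ln (2 * r)" using r' by (subst ln_le_cancel_iff) auto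
      also have "\<dots> = ln 2 + ln r" using r' by (intro ln_mult_pos) auto
      finally have b: "ln (r + 1) \<le> ln 2 + ln r" .
      have "ln (4 * 2 :: real) = ln 4 + ln 2" by (intro ln_mult_pos) auto
      hence "growth r d \<le> (1 + ln 8 + 2 * ln t) + ln r"
        using a b by (simp add: growth_def d_def)
      hence "C' * growth r d \<le> C' * ((1 + ln 8 + 2 * ln t) + ln r)" by (intro mult_left_mono C')
      also have "\<dots> = C' * (1 + ln 8 + 2 * ln t) + C' * ln r" by (rule distrib_left)
      also have "C' * (1 + ln 8 + 2 * ln t) \<le> \<epsilon> / 2 * t"
      proof -
        have "C' * (1 + ln 8 + 2 * ln t) = (C' * (1 + ln 8) * (1 / t) + 2 * C' * (ln t / t)) * t"
          using t by (simp add: field_simps)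
        also have "\<dots> \<le> \<epsilon> / 2 * t" using T0[OF t(1)] t by (intro mult_right_mono) auto
        finally show ?thesis .
      qed
      also have "C' * ln r \<le> \<epsilon> / 2 * t"
      proof -
        have "2 * C' / \<epsilon> * ln r \<le> t" using R2 r' r(3) by (simp add: t_def)
        hence "\<epsilon> / 2 * (2 * C' / \<epsilon> * ln r) \<le> \<epsilon> / 2 * t" using \<epsilon> by (intro mult_left_mono) auto
        thus ?thesis using \<epsilon> by simp
      qed
      finally have "C' * growth r d \<le> \<epsilon> * t" by simp
      moreover have "C * growth r d \<le> C' * growth r d"
        using C' growth_ge_1[OF r'(3) d] by (intro mult_right_mono) auto
      ultimately show "\<exists>d. 0 < d \<and> d \<le> 1 \<and> C * growth r d \<le> \<epsilon> * nev_T f r"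
        using d by (intro exI[of _ d]) (simp add: t_def)
    qed
  qed
qed

lemma sets_lebesgue_countable:
  fixes N :: "real set"
  assumes "countable N"
  shows "N \<in> sets lebesgue" "emeasure lebesgue N = 0"
proof -
  have "N \<in> null_sets lebesgue"
    using countable_imp_null_set_lborel[OF assms] by (rule null_sets_completionI)
  thus "N \<in> sets lebesgue" "emeasure lebesgue N = 0" by auto
qed

text \<open>Otherwise \<open>E\<close> would contain an interval longer than its own measure. It
  supplies the radius at which an asymptotic contradiction is read off.\<close>

lemma finite_measure_imp_ex_large:
  fixes E :: "real set"
  assumes "E \<in> sets lebesgue" "emeasure lebesgue E < \<infinity>"
  shows "\<exists>r\<ge>R. r \<notin> E"
proof (rule ccontr)
  assume "\<not> ?thesis"
  hence sub: "{R..R + (enn2real (emeasure lebesgue E) + 1)} \<subseteq> E" by force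
  have "emeasure lebesgue {R..R + (enn2real (emeasure lebesgue E) + 1)} \<le> emeasure lebesgue E"
    using sub assms(1) by (rule emeasure_mono)
  moreover have "emeasure lebesgue {R..R + (enn2real (emeasure lebesgue E) + 1)} =
      ennreal (enn2real (emeasure lebesgue E) + 1)"
    by (simp add: add_nonneg_nonneg)
  moreover have "emeasure lebesgue E = ennreal (enn2real (emeasure lebesgue E))"
    using assms(2) by simp
  ultimately have "ennreal (enn2real (emeasure lebesgue E) + 1) \<le> ennreal (enn2real (emeasure lebesgue E))"
    by metis
  thus False by (simp add: ennreal_le_iff)
qed

theorem theorem2p1:
  fixes f :: "complex \<Rightarrow> complex" and k q0 qk :: nat
  assumes "f nicely_meromorphic_on UNIV"
    and "transcendental_mero f"
    and "\<forall>z. is_pole f z \<longrightarrow> zorder f z \<noteq> -1"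
    and "k \<ge> 1" and "q0 \<ge> 2" and "qk \<ge> 1"
  shows "le_up_to_S f (nev_T f)
           (\<lambda>r. 6 / (2 * real q0 - 3) *
                zero_Nbar (\<lambda>z. f z ^ q0 * ((deriv ^^ k) f z) ^ qk - 1) r)"
proof -
  note nice = assms(1) and tr = assms(2)
  have q1: "1 \<le> q0" using assms(5) by simp
  have mf: "mero_nz f" by (rule transcendental_meroI[OF nice tr])
  interpret growth_majorant "nev_majorant f" by (rule growth_majorant_nev_majorant[OF mf])
  note tf = tame_self[OF mf]
  note mj = transcendental_higher_deriv[OF nice tr]
  define F where "F = (\<lambda>z. f z ^ q0 * (deriv ^^ k) f z ^ qk)"
  define G where "G = (\<lambda>z. F z - 1)"
  have mF: "mero_nz F" unfolding F_def by (intro mero_nz_mult mero_nz_power mf mj)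
  have merF: "F meromorphic_on UNIV" by (rule mero_nzD[OF mF])
  have merG: "G meromorphic_on UNIV" unfolding G_def by (intro meromorphic_intros merF)
  obtain E where E: "E \<in> sets lebesgue" "emeasure lebesgue E < \<infinity>"
    and absorb: "\<And>C \<epsilon>. 0 < \<epsilon> \<Longrightarrow> \<exists>R\<ge>1. \<forall>r\<ge>R. r \<notin> E \<longrightarrow> regular f r \<longrightarrow> 1 \<le> nev_T f r \<and>
      (\<exists>d. 0 < d \<and> d \<le> 1 \<and> C * growth r d \<le> \<epsilon> * nev_T f r)"
    using growth_absorbed[OF nice tr] by blast
  define bad where "bad = {r. 0 < r \<and> \<not> regular f r}"
  have union: "E \<union> (N \<union> bad) \<in> sets lebesgue" "emeasure lebesgue (E \<union> (N \<union> bad)) < \<infinity>"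
    if "countable N" for N
  proof -
    have "countable (N \<union> bad)" using that countable_not_regular[OF mf] by (simp add: bad_def)
    note c = sets_lebesgue_countable[OF this]
    show "E \<union> (N \<union> bad) \<in> sets lebesgue" by (rule sets.Un[OF E(1) c(1)])
    have "emeasure lebesgue (E \<union> (N \<union> bad)) \<le> emeasure lebesgue E + emeasure lebesgue (N \<union> bad)"
      by (intro emeasure_subadditive E c)
    also have "\<dots> < \<infinity>" using E c by simp
    finally show "emeasure lebesgue (E \<union> (N \<union> bad)) < \<infinity>" .
  qed
  \<comment> \<open>Otherwise \<open>F\<close> is constant, and at a large radius outside the
    exceptional sets the characteristic would be at most half of itself although it is at least
    1.\<close>
  have mG': "mero_nz (deriv G)"
  proof (rule ccontr)
    assume "\<not> mero_nz (deriv G)"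
    hence "eventually (\<lambda>z. deriv G z = 0) (cosparse UNIV)"
      using mero_nz_or_zero[OF meromorphic_on_deriv[OF merG]] by blast
    then obtain u where "eventually (\<lambda>z. G z = u) (cosparse UNIV)"
      using meromorphic_deriv_zero_imp_constant[OF merG] by blast
    hence const: "eventually (\<lambda>z. F z = u + 1) (cosparse UNIV)"
      by (rule eventually_mono) (auto simp: G_def)
    obtain C N where "countable N \<and> (\<forall>r d. 1 \<le> r \<longrightarrow> r \<notin> N \<longrightarrow> 0 < d \<longrightarrow> d \<le> 1 \<longrightarrow>
        nev_T f r \<le> C * growth r d)"
      using constant_case_inequality[OF tf mj q1 const[unfolded F_def]] by (elim exE)
    hence CN: "countable N" "\<And>r d. 1 \<le> r \<Longrightarrow> r \<notin> N \<Longrightarrow> 0 < d \<Longrightarrow> d \<le> 1 \<Longrightarrow>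
        nev_T f r \<le> C * growth r d" by simp_all
    obtain R where R: "1 \<le> R" "\<forall>r\<ge>R. r \<notin> E \<longrightarrow> regular f r \<longrightarrow> 1 \<le> nev_T f r \<and>
      (\<exists>d. 0 < d \<and> d \<le> 1 \<and> C * growth r d \<le> (1 / 2) * nev_T f r)"
      using absorb[of "1 / 2" C] by auto
    obtain r where r: "R \<le> r" "r \<notin> E \<union> (N \<union> bad)"
      using finite_measure_imp_ex_large[OF union[OF CN(1)]] by blast
    have "regular f r" "1 \<le> r" "r \<notin> E" "r \<notin> N" using r R(1) by (auto simp: bad_def)
    moreover from this obtain d where "1 \<le> nev_T f r" "0 < d" "d \<le> 1" "C * growth r d \<le> (1 / 2) * nev_T f r"
      using R(2) r(1) by blast
    ultimately show False using CN(2)[of r d] by simp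
  qed
  \<comment> \<open>This follows from the preceding fact: if \<open>G\<close> vanished off a sparse
    set, its derivative would vanish near the origin, apart from the origin itself.\<close>
  have mG: "mero_nz G"
  proof (rule ccontr)
    assume "\<not> mero_nz G"
    hence "eventually (\<lambda>z. G z = 0) (cosparse UNIV)" using mero_nz_or_zero[OF merG] by blast
    hence "eventually (\<lambda>z. G z = 0) (at 0)" by (auto simp: eventually_cosparse_open_eq)
    then obtain S where S: "open S" "0 \<in> S" "\<And>w. w \<in> S \<Longrightarrow> w \<noteq> 0 \<Longrightarrow> G w = 0"
      by (auto simp: eventually_at_topological)
    have "deriv G w = 0" if "w \<in> S - {0}" for w
    proof -
      have "eventually (\<lambda>w. w \<in> S - {0}) (nhds w)"
        using that S(1) by (intro eventually_nhds_in_open) auto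
      hence "eventually (\<lambda>w. G w = 0) (nhds w)" by eventually_elim (use S in auto)
      hence "deriv G w = deriv (\<lambda>_. 0) w" by (rule deriv_cong_ev) simp
      thus ?thesis by simp
    qed
    moreover have "eventually (\<lambda>w. w \<in> S - {0}) (at 0)" using S by (intro eventually_at_in_open)
    ultimately have "eventually (\<lambda>w. deriv G w = 0) (at 0)" by (auto elim: eventually_mono)
    with mero_nzD(2)[OF mG', of 0] have "eventually (\<lambda>w. False) (at (0::complex))"
      by eventually_elim simp
    thus False by simp
  qed
  have ns: "zorder f a \<noteq> -1" for a
    using assms(3) mero_nz_is_pole_iff[OF mf, of a] by auto
  obtain C N where "countable N \<and> (\<forall>r d. 1 \<le> r \<longrightarrow> r \<notin> N \<longrightarrow> 0 < d \<longrightarrow> d \<le> 1 \<longrightarrow>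
      (real q0 - 3 / 2) * nev_T f r \<le> zero_Nbar G r + C * growth r d)"
    using main_inequality[OF tf mj mG[unfolded G_def F_def] mG'[unfolded G_def F_def] ns q1]
    unfolding G_def F_def by (elim exE)
  hence CN: "countable N" "\<And>r d. 1 \<le> r \<Longrightarrow> r \<notin> N \<Longrightarrow> 0 < d \<Longrightarrow> d \<le> 1 \<Longrightarrow>
      (real q0 - 3 / 2) * nev_T f r \<le> zero_Nbar G r + C * growth r d" by simp_all
  define B where "B r = 6 / (2 * real q0 - 3) * zero_Nbar G r" for r
  have q: "0 < 2 * real q0 - 3" using assms(5) by linarith
  have "le_up_to_S f (nev_T f) B"
    unfolding le_up_to_S_def
  \<comment> \<open>The error is the positive part of the actual excess, so the pointwise inequality
    holds at every radius and only the size of the error for large \<open>r\<close> is left to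
    prove.\<close>
  proof (intro exI[of _ "\<lambda>r. max 0 (nev_T f r - B r)"] exI[of _ "E \<union> (N \<union> bad)"] conjI union CN(1) allI impI)
    fix \<epsilon> :: real assume \<epsilon>: "0 < \<epsilon>"
    obtain R where R: "1 \<le> R" "\<forall>r\<ge>R. r \<notin> E \<longrightarrow> regular f r \<longrightarrow> 1 \<le> nev_T f r \<and>
      (\<exists>d. 0 < d \<and> d \<le> 1 \<and> 2 * C / (2 * real q0 - 3) * growth r d \<le> \<epsilon> * nev_T f r)"
      using absorb[OF \<epsilon>, of "2 * C / (2 * real q0 - 3)"] by blast
    show "\<exists>R. \<forall>r\<ge>R. r \<notin> E \<union> (N \<union> bad) \<longrightarrow> \<bar>max 0 (nev_T f r - B r)\<bar> \<le> \<epsilon> * nev_T f r"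
    proof (intro exI[of _ R] allI impI)
      fix r assume r: "R \<le> r" "r \<notin> E \<union> (N \<union> bad)"
      have r': "regular f r" "1 \<le> r" "r \<notin> E" "r \<notin> N" using r R(1) by (auto simp: bad_def)
      then obtain d where d: "1 \<le> nev_T f r" "0 < d" "d \<le> 1"
        "2 * C / (2 * real q0 - 3) * growth r d \<le> \<epsilon> * nev_T f r"
        using R(2) r(1) by blast
      have "(real q0 - 3 / 2) * nev_T f r \<le> zero_Nbar G r + C * growth r d"
        by (intro CN r' d)
      hence "(2 * real q0 - 3) * nev_T f r \<le> 2 * zero_Nbar G r + 2 * C * growth r d"
        by (simp add: algebra_simps)
      hence "nev_T f r \<le> (2 * zero_Nbar G r + 2 * C * growth r d) / (2 * real q0 - 3)"
        using q by (simp add: pos_le_divide_eq mult.commute)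
      also have "\<dots> = 2 / (2 * real q0 - 3) * zero_Nbar G r + 2 * C / (2 * real q0 - 3) * growth r d"
        by (simp add: add_divide_distrib)
      also have "\<dots> \<le> B r + \<epsilon> * nev_T f r"
      \<comment> \<open>Raising the factor from 2 to 6 needs a nonnegative counting function, which
        is ensured by \<open>1 \<le> r\<close>.\<close>
      proof (rule add_mono[OF _ d(4)])
        have "0 \<le> zero_Nbar G r"
          using r' by (subst zero_Nbar_eq_divisor_N[OF mG]) (auto intro!: divisor_N_nonneg)
        thus "2 / (2 * real q0 - 3) * zero_Nbar G r \<le> B r"
          unfolding B_def using q by (intro mult_right_mono divide_right_mono) auto
      qed
      finally show "\<bar>max 0 (nev_T f r - B r)\<bar> \<le> \<epsilon> * nev_T f r"
        using \<epsilon> d(1) by (simp add: max_def)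
    qed
  qed auto
  thus ?thesis by (simp add: B_def[abs_def] G_def F_def)
qed

end
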